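(* Let $(\xi_t,X_\tau)$ be a cyclic-independent conjugate process and let $\mu$ be a diffraction of $(\xi_t)$. Assume: (a) $\lim_{n\to\infty}n^{-1}\sum_{t=1}^n\xi_t=\mathbb{E}\xi_0$ in probability, and $\|n^{-1}\sum_{t=1}^nF_t-\mathbb{E}F_0\|=O_{\mathbb{P}}(n^{-1/2})$; (b) $(\widehat F_t)$ is a $\psi$-mixing sequence whose mixing coefficients $\Psi(k)$ satisfy $\sum_{k=1}^\infty k\,\Psi^{1/2}(k)<\infty$; (c) the nonzero eigenvalues of $R^\mu$ are all distinct. Then, for each $t$ and each $j\in\mathbb{N}$, it holds that (i) $\mathbb{E}[\widehat W_{tj}\mid\Xi]=W_{tj}+O_{\mathbb{P}}(n^{-1/2})$; (ii) $|\widehat W_{tj}-W_{tj}|\le\|\widehat F_t-F_t\|+O_{\mathbb{P}}(n^{-1/2})$.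
   Context: Let $(\Omega,\mathscr{A},\mathbb{P})$ be a probability space and $M_1(\mathbb{R})$ the set of Borel probability measures on $\mathbb{R}$ with the topology of weak convergence (metrized by the Lévy–Prohorov metric). Standing assumption: $(\xi_t:t=0,1,\dots)$ is a stationary sequence of random elements of $M_1(\mathbb{R})$. Put $\Xi:=\sigma(\xi_0,\xi_1,\dots)$. The baricenter $\mathbb{E}\xi_0$ is the unique element of $M_1(\mathbb{R})$ with $\mathbb{E}\int f\,d\xi_0=\int f\,d\mathbb{E}\xi_0$ for all continuous bounded $f$. Conjugate process: a pair $(\xi_t,X_\tau)$ where $(X_\tau:\tau\ge0)$ is a real-valued process such that for every Borel $B$, every $t=0,1,\dots$ and $\tau\in[t,t+1)$, $\mathbb{P}[X_\tau\in B\mid\Xi]=\xi_t(B)$. It is cyclic-independent if, conditionally on $\Xi$, the processes $(X_\tau:\tau\in[t,t+1))$, $t=0,1,\dots$, form an independent sequence. A finite Borel measure $\mu$ on $\mathbb{R}$ is a diffraction of $(\xi_t)$ if it is equivalent to Lebesgue measure on some interval containing the support of $\mathbb{E}\xi_0$; $\langle\cdot,\cdot\rangle$, $\|\cdot\|$ are the inner product and norm of $L^2(\mu)$. Put $F_t(x):=\xi_t(-\infty,x]$, $\mathbb{E}F_0(x):=\mathbb{E}\xi_0(-\infty,x]$, $C_k(x,y):=\mathrm{Cov}(F_0(x),F_k(y))$, and $C_k^\mu f(x):=\int C_k(x,y)f(y)\,\mu(dy)$ on $L^2(\mu)$. Fix an integer $p$ with $1\le p<n$. $R^\mu$ is the integral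 operator on $L^2(\mu)$ with kernel $R_\mu(x,y):=\sum_{k=1}^p\int C_k(x,z)C_k(y,z)\,\mu(dz)$; $(\theta_j:j\in\mathbb{N})$ is the non-increasing sequence of its eigenvalues (with repetitions, if any; it contains zeros if and only if $R^\mu$ has finite rank), with $L^2(\mu)$-orthonormal eigenfunctions $\psi_j$, $R^\mu\psi_j=\theta_j\psi_j$, $j\in\mathbb{N}$. Standing assumption: $\overline{\mathrm{Ran}(R^\mu)}=\overline{\mathrm{Ran}(C_0^\mu)}$. Put $W_{tj}:=\langle F_t-\mathbb{E}F_0,\psi_j\rangle$. Sampling and estimators: in each cycle $t$ one observes $X_{1t},\dots,X_{q_t,t}$, observations of the process $(X_\tau)$ at $q_t$ times $\tau\in[t,t+1)$. Put $\widehat F_t(x):=\frac1{q_t}\sum_{i=1}^{q_t}\mathbb{I}_{[X_{it}\le x]}$, $\widehat{\mathbb{E}}F_0(x):=\frac1n\sum_{t=1}^n\widehat F_t(x)$, $$\widehat C_k(x,y):=\frac1{n-p}\sum_{t=1}^{n-p}\big(\widehat F_t(x)-\widehat{\mathbb{E}}F_0(x)\big)\big(\widehat F_{t+k}(y)-\widehat{\mathbb{E}}F_0(y)\big),\qquad \widehat R_\mu(x,y):=\sum_{k=1}^p\int\widehat C_k(x,z)\widehat C_k(y,z)\,\mu(dz).$$ $\widehat R^\mu$ is the (finite-rank) integral operator on $L^2(\mu)$ with kernel $\widehat R_\mu$, with non-increasing sequence of eigenvalues $(\widehat\theta_j:j\in\mathbb{N})$ (with repetitions, continued by zeros) and $L^2(\mu)$-orthonormal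 eigenfunctions $\widehat\psi_j$, $\widehat R^\mu\widehat\psi_j=\widehat\theta_j\widehat\psi_j$, $j\in\mathbb{N}$. Since $\psi_j$ and $-\psi_j$ are both normalized eigenfunctions, the sign of $\psi_j$ is assumed to be the one correctly matched to $\widehat\psi_j$. Put $\widehat W_{tj}:=\langle\widehat F_t-\widehat{\mathbb{E}}F_0,\widehat\psi_j\rangle$ for $j\in\mathbb{N}$ and $1\le t\le n$. The $\psi$-mixing coefficients of $(\widehat F_t)$ are (standard definition) $\Psi(k):=\sup_m\sup\big|1-\frac{\mathbb{P}(A\cap B)}{\mathbb{P}(A)\mathbb{P}(B)}\big|$, the inner supremum being over $A\in\sigma(\widehat F_s:s\le m)$, $B\in\sigma(\widehat F_s:s\ge m+k)$ with $\mathbb{P}(A)\mathbb{P}(B)>0$; the sequence is $\psi$-mixing if $\Psi(k)\to0$.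
   Formalization: Claim (i) is proved for those j with nonzero eigenvalue θ_j (every j if R^μ has infinite rank); for θ_j = 0 claim (i) is false in general, since the estimated eigenfunction is then driven by noise correlated with the sample. Claim (ii) is proved for every j. *)

theory Defs
  imports "HOL-Probability.Probability"
begin

text \<open>
  The Hilbert space of square-integrable functions is represented by its square-integrable
  representatives; equality in it is equality almost everywhere.
\<close>

definition L2 :: "real measure \<Rightarrow> (real \<Rightarrow> real) set" where
  "L2 \<mu> = {f. f \<in> borel_measurable \<mu> \<and> integrable \<mu> (\<lambda>x. (f x)\<^sup>2)}"

definition L2_inner :: "real measure \<Rightarrow> (real \<Rightarrow> real) \<Rightarrow> (real \<Rightarrow> real) \<Rightarrow> real" where
  "L2_inner \<mu> f g = (\<integral>x. f x * g x \<partial>\<mu>)"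

definition L2_norm :: "real measure \<Rightarrow> (real \<Rightarrow> real) \<Rightarrow> real" where
  "L2_norm \<mu> f = sqrt (L2_inner \<mu> f f)"

definition L2_closure :: "real measure \<Rightarrow> (real \<Rightarrow> real) set \<Rightarrow> (real \<Rightarrow> real) set" where
  "L2_closure \<mu> S = {f \<in> L2 \<mu>. \<forall>e>0. \<exists>g\<in>S. L2_norm \<mu> (\<lambda>x. f x - g x) < e}"

definition kernel_op :: "real measure \<Rightarrow> (real \<Rightarrow> real \<Rightarrow> real) \<Rightarrow> (real \<Rightarrow> real) \<Rightarrow> real \<Rightarrow> real" where
  "kernel_op \<mu> K f x = (\<integral>y. K x y * f y \<partial>\<mu>)"

text \<open>
  \<open>\<theta>\<close> is the non-increasing sequence of eigenvalues of the integral operator with kernel \<open>K\<close>,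
  with corresponding orthonormal eigenfunctions \<open>\<psi>\<close>. The last conjunct says that every nonzero
  eigenvalue occurs in \<open>\<theta>\<close> as often as its multiplicity. For a positive semidefinite
  Hilbert--Schmidt operator these conditions force \<open>\<theta>\<close> to contain zeros exactly
  if the operator has finite rank.
\<close>

definition eigensystem ::
    "real measure \<Rightarrow> (real \<Rightarrow> real \<Rightarrow> real) \<Rightarrow> (nat \<Rightarrow> real) \<Rightarrow> (nat \<Rightarrow> real \<Rightarrow> real) \<Rightarrow> bool" where
  "eigensystem \<mu> K \<theta> \<psi> \<longleftrightarrow>
     decseq \<theta> \<and>
     (\<forall>j. \<psi> j \<in> L2 \<mu>) \<and>
     (\<forall>i j. L2_inner \<mu> (\<psi> i) (\<psi> j) = (if i = j then 1 else 0)) \<and>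
     (\<forall>j. AE x in \<mu>. kernel_op \<mu> K (\<psi> j) x = \<theta> j * \<psi> j x) \<and>
     (\<forall>c. \<forall>f\<in>L2 \<mu>. c \<noteq> 0 \<longrightarrow> (AE x in \<mu>. kernel_op \<mu> K f x = c * f x) \<longrightarrow>
        (\<exists>J a. finite J \<and> (\<forall>j\<in>J. \<theta> j = c) \<and> (AE x in \<mu>. f x = (\<Sum>j\<in>J. a j * \<psi> j x))))"

text \<open>
  A random element of the set of Borel probability measures on the line is a measurable map into
  \<^term>\<open>prob_algebra borel\<close>, whose sigma-algebra (generated by the evaluations at Borel sets) is the
  Borel sigma-algebra of the topology of weak convergence.
\<close>

definition stationary :: "'a measure \<Rightarrow> (nat \<Rightarrow> 'a \<Rightarrow> real measure) \<Rightarrow> bool" where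
  "stationary M \<xi> \<longleftrightarrow>
     (\<forall>t. \<xi> t \<in> M \<rightarrow>\<^sub>M prob_algebra borel) \<and>
     (\<forall>k. distr M (\<Pi>\<^sub>M t\<in>UNIV. prob_algebra borel) (\<lambda>\<omega> t. \<xi> (t + k) \<omega>) =
          distr M (\<Pi>\<^sub>M t\<in>UNIV. prob_algebra borel) (\<lambda>\<omega> t. \<xi> t \<omega>))"

definition sigma_xi :: "'a measure \<Rightarrow> (nat \<Rightarrow> 'a \<Rightarrow> real measure) \<Rightarrow> 'a measure" where
  "sigma_xi M \<xi> = vimage_algebra (space M) (\<lambda>\<omega> t. \<xi> t \<omega>) (\<Pi>\<^sub>M t\<in>UNIV. prob_algebra borel)"

definition baricenter :: "'a measure \<Rightarrow> ('a \<Rightarrow> real measure) \<Rightarrow> real measure" where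
  "baricenter M \<zeta> = (THE \<nu>. real_distribution \<nu> \<and>
     (\<forall>f :: real \<Rightarrow> real. continuous_on UNIV f \<and> bounded (range f) \<longrightarrow>
        (\<integral>\<omega>. (\<integral>x. f x \<partial>\<zeta> \<omega>) \<partial>M) = (\<integral>x. f x \<partial>\<nu>)))"

definition support :: "real measure \<Rightarrow> real set" where
  "support \<nu> = {x. \<forall>U. open U \<and> x \<in> U \<longrightarrow> emeasure \<nu> U > 0}"

definition diffraction :: "'a measure \<Rightarrow> (nat \<Rightarrow> 'a \<Rightarrow> real measure) \<Rightarrow> real measure \<Rightarrow> bool" where
  "diffraction M \<xi> \<mu> \<longleftrightarrow>
     finite_measure \<mu> \<and> sets \<mu> = sets borel \<and>
     (\<exists>I. is_interval I \<and> support (baricenter M (\<xi> 0)) \<subseteq> I \<and>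
        absolutely_continuous \<mu> (density lborel (indicator I)) \<and>
        absolutely_continuous (density lborel (indicator I)) \<mu>)"

definition average_measure :: "(nat \<Rightarrow> 'a \<Rightarrow> real measure) \<Rightarrow> nat \<Rightarrow> 'a \<Rightarrow> real measure" where
  "average_measure \<xi> n \<omega> =
     measure_of UNIV (sets borel) (\<lambda>B. (\<Sum>t=1..n. emeasure (\<xi> t \<omega>) B) / of_nat n)"

definition levy_prohorov :: "real measure \<Rightarrow> real measure \<Rightarrow> real" where
  "levy_prohorov P Q = Inf {e. e > 0 \<and> (\<forall>B\<in>sets borel.
     measure P B \<le> measure Q (\<Union>x\<in>B. ball x e) + e \<and>
     measure Q B \<le> measure P (\<Union>x\<in>B. ball x e) + e)}"

definition converges_in_prob ::
    "'a measure \<Rightarrow> (nat \<Rightarrow> 'a \<Rightarrow> real measure) \<Rightarrow> real measure \<Rightarrow> bool" where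
  "converges_in_prob M \<zeta> \<nu> \<longleftrightarrow>
     (\<forall>e>0. (\<lambda>n. measure M {\<omega> \<in> space M. levy_prohorov (\<zeta> n \<omega>) \<nu> > e}) \<longlonglongrightarrow> 0)"

definition O_prob :: "'a measure \<Rightarrow> (nat \<Rightarrow> 'a \<Rightarrow> real) \<Rightarrow> (nat \<Rightarrow> real) \<Rightarrow> bool" where
  "O_prob M Z a \<longleftrightarrow>
     (\<forall>\<^sub>F n in sequentially. Z n \<in> borel_measurable M) \<and>
     (\<forall>e>0. \<exists>C>0. \<forall>\<^sub>F n in sequentially. measure M {\<omega> \<in> space M. \<bar>Z n \<omega>\<bar> > C * a n} < e)"

definition conjugate_process ::
    "'a measure \<Rightarrow> (nat \<Rightarrow> 'a \<Rightarrow> real measure) \<Rightarrow> (real \<Rightarrow> 'a \<Rightarrow> real) \<Rightarrow> bool" where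
  "conjugate_process M \<xi> X \<longleftrightarrow>
     (\<forall>\<tau>\<ge>0. X \<tau> \<in> borel_measurable M) \<and>
     (\<forall>B\<in>sets borel. \<forall>t. \<forall>\<tau>\<in>{real t..<real t + 1}. AE \<omega> in M.
        real_cond_exp M (sigma_xi M \<xi>) (\<lambda>\<omega>. indicat_real B (X \<tau> \<omega>)) \<omega> = measure (\<xi> t \<omega>) B)"

definition cycle_events :: "'a measure \<Rightarrow> (real \<Rightarrow> 'a \<Rightarrow> real) \<Rightarrow> nat \<Rightarrow> 'a set set" where
  "cycle_events M X t =
     sigma_sets (space M) {X \<tau> -` B \<inter> space M | \<tau> B. \<tau> \<in> {real t..<real t + 1} \<and> B \<in> sets borel}"

definition cyclic_independent ::
    "'a measure \<Rightarrow> (nat \<Rightarrow> 'a \<Rightarrow> real measure) \<Rightarrow> (real \<Rightarrow> 'a \<Rightarrow> real) \<Rightarrow> bool" where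
  "cyclic_independent M \<xi> X \<longleftrightarrow>
     (\<forall>J A. finite J \<and> J \<noteq> {} \<and> (\<forall>t\<in>J. A t \<in> cycle_events M X t) \<longrightarrow>
        (AE \<omega> in M. real_cond_exp M (sigma_xi M \<xi>) (indicat_real (\<Inter>t\<in>J. A t)) \<omega> =
           (\<Prod>t\<in>J. real_cond_exp M (sigma_xi M \<xi>) (indicat_real (A t)) \<omega>)))"

definition Fcdf :: "(nat \<Rightarrow> 'a \<Rightarrow> real measure) \<Rightarrow> nat \<Rightarrow> 'a \<Rightarrow> real \<Rightarrow> real" where
  "Fcdf \<xi> t \<omega> x = cdf (\<xi> t \<omega>) x"

definition EFcdf :: "'a measure \<Rightarrow> (nat \<Rightarrow> 'a \<Rightarrow> real measure) \<Rightarrow> real \<Rightarrow> real" where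
  "EFcdf M \<xi> x = cdf (baricenter M (\<xi> 0)) x"

definition covariance :: "'a measure \<Rightarrow> ('a \<Rightarrow> real) \<Rightarrow> ('a \<Rightarrow> real) \<Rightarrow> real" where
  "covariance M Y Z =
     (\<integral>\<omega>. (Y \<omega> - (\<integral>\<omega>. Y \<omega> \<partial>M)) * (Z \<omega> - (\<integral>\<omega>. Z \<omega> \<partial>M)) \<partial>M)"

definition Ckernel :: "'a measure \<Rightarrow> (nat \<Rightarrow> 'a \<Rightarrow> real measure) \<Rightarrow> nat \<Rightarrow> real \<Rightarrow> real \<Rightarrow> real" where
  "Ckernel M \<xi> k x y = covariance M (\<lambda>\<omega>. Fcdf \<xi> 0 \<omega> x) (\<lambda>\<omega>. Fcdf \<xi> k \<omega> y)"

definition Rkernel ::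
    "'a measure \<Rightarrow> (nat \<Rightarrow> 'a \<Rightarrow> real measure) \<Rightarrow> real measure \<Rightarrow> nat \<Rightarrow> real \<Rightarrow> real \<Rightarrow> real" where
  "Rkernel M \<xi> \<mu> p x y = (\<Sum>k=1..p. \<integral>z. Ckernel M \<xi> k x z * Ckernel M \<xi> k y z \<partial>\<mu>)"

definition Wscore ::
    "'a measure \<Rightarrow> (nat \<Rightarrow> 'a \<Rightarrow> real measure) \<Rightarrow> real measure \<Rightarrow> (nat \<Rightarrow> real \<Rightarrow> real) \<Rightarrow>
     nat \<Rightarrow> nat \<Rightarrow> 'a \<Rightarrow> real" where
  "Wscore M \<xi> \<mu> \<psi> t j \<omega> = L2_inner \<mu> (\<lambda>x. Fcdf \<xi> t \<omega> x - EFcdf M \<xi> x) (\<psi> j)"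

text \<open>
  In cycle \<open>t\<close> the process \<open>X\<close> is observed at the \<open>q t\<close> times \<open>\<tau> t i\<close>, where \<open>1 \<le> i \<le> q t\<close>.
\<close>

definition Fcdf_hat ::
    "(real \<Rightarrow> 'a \<Rightarrow> real) \<Rightarrow> (nat \<Rightarrow> nat) \<Rightarrow> (nat \<Rightarrow> nat \<Rightarrow> real) \<Rightarrow> nat \<Rightarrow> 'a \<Rightarrow> real \<Rightarrow> real" where
  "Fcdf_hat X q \<tau> t \<omega> x = (\<Sum>i=1..q t. indicat_real {..x} (X (\<tau> t i) \<omega>)) / real (q t)"

definition EFcdf_hat ::
    "(real \<Rightarrow> 'a \<Rightarrow> real) \<Rightarrow> (nat \<Rightarrow> nat) \<Rightarrow> (nat \<Rightarrow> nat \<Rightarrow> real) \<Rightarrow> nat \<Rightarrow> 'a \<Rightarrow> real \<Rightarrow> real" where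
  "EFcdf_hat X q \<tau> n \<omega> x = (\<Sum>t=1..n. Fcdf_hat X q \<tau> t \<omega> x) / real n"

definition Ckernel_hat ::
    "(real \<Rightarrow> 'a \<Rightarrow> real) \<Rightarrow> (nat \<Rightarrow> nat) \<Rightarrow> (nat \<Rightarrow> nat \<Rightarrow> real) \<Rightarrow>
     nat \<Rightarrow> nat \<Rightarrow> nat \<Rightarrow> 'a \<Rightarrow> real \<Rightarrow> real \<Rightarrow> real" where
  "Ckernel_hat X q \<tau> p n k \<omega> x y =
     (\<Sum>t=1..n-p. (Fcdf_hat X q \<tau> t \<omega> x - EFcdf_hat X q \<tau> n \<omega> x) *
                  (Fcdf_hat X q \<tau> (t + k) \<omega> y - EFcdf_hat X q \<tau> n \<omega> y)) / real (n - p)"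

definition Rkernel_hat ::
    "(real \<Rightarrow> 'a \<Rightarrow> real) \<Rightarrow> (nat \<Rightarrow> nat) \<Rightarrow> (nat \<Rightarrow> nat \<Rightarrow> real) \<Rightarrow> real measure \<Rightarrow>
     nat \<Rightarrow> nat \<Rightarrow> 'a \<Rightarrow> real \<Rightarrow> real \<Rightarrow> real" where
  "Rkernel_hat X q \<tau> \<mu> p n \<omega> x y =
     (\<Sum>k=1..p. \<integral>z. Ckernel_hat X q \<tau> p n k \<omega> x z * Ckernel_hat X q \<tau> p n k \<omega> y z \<partial>\<mu>)"

text \<open>\<open>\<psi>' n \<omega>\<close> is the sequence of eigenfunctions estimated from the first \<open>n\<close> cycles.\<close>

definition Wscore_hat ::
    "(real \<Rightarrow> 'a \<Rightarrow> real) \<Rightarrow> (nat \<Rightarrow> nat) \<Rightarrow> (nat \<Rightarrow> nat \<Rightarrow> real) \<Rightarrow> real measure \<Rightarrow>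
     (nat \<Rightarrow> 'a \<Rightarrow> nat \<Rightarrow> real \<Rightarrow> real) \<Rightarrow> nat \<Rightarrow> nat \<Rightarrow> nat \<Rightarrow> 'a \<Rightarrow> real" where
  "Wscore_hat X q \<tau> \<mu> \<psi>' n t j \<omega> =
     L2_inner \<mu> (\<lambda>x. Fcdf_hat X q \<tau> t \<omega> x - EFcdf_hat X q \<tau> n \<omega> x) (\<psi>' n \<omega> j)"

text \<open>
  Weak measurability: since the Hilbert space is separable, this is the same as being a random
  element of it.
\<close>

definition random_L2 :: "'a measure \<Rightarrow> real measure \<Rightarrow> ('a \<Rightarrow> real \<Rightarrow> real) \<Rightarrow> bool" where
  "random_L2 M \<mu> \<phi> \<longleftrightarrow>
     (\<forall>\<omega>\<in>space M. \<phi> \<omega> \<in> L2 \<mu>) \<and>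
     (\<forall>f\<in>L2 \<mu>. (\<lambda>\<omega>. L2_inner \<mu> (\<phi> \<omega>) f) \<in> borel_measurable M)"

definition sigma_fun :: "'a measure \<Rightarrow> (nat \<Rightarrow> 'a \<Rightarrow> real \<Rightarrow> real) \<Rightarrow> nat set \<Rightarrow> 'a set set" where
  "sigma_fun M G T = sigma_sets (space M)
     {(\<lambda>\<omega>. G s \<omega> x) -` B \<inter> space M | s x B. s \<in> T \<and> B \<in> sets borel}"

text \<open>The coefficients of a sequence indexed by the positive integers; they may be infinite.\<close>

definition psi_coeff :: "'a measure \<Rightarrow> (nat \<Rightarrow> 'a \<Rightarrow> real \<Rightarrow> real) \<Rightarrow> nat \<Rightarrow> ennreal" where
  "psi_coeff M G k = Sup {ennreal \<bar>1 - measure M (A \<inter> B) / (measure M A * measure M B)\<bar> | m A B.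
     m \<ge> 1 \<and> A \<in> sigma_fun M G {1..m} \<and> B \<in> sigma_fun M G {m + k..} \<and>
     measure M A * measure M B > 0}"

definition psi_mixing :: "'a measure \<Rightarrow> (nat \<Rightarrow> 'a \<Rightarrow> real \<Rightarrow> real) \<Rightarrow> bool" where
  "psi_mixing M G \<longleftrightarrow> (\<lambda>k. psi_coeff M G k) \<longlonglongrightarrow> 0"

definition psi_summable :: "'a measure \<Rightarrow> (nat \<Rightarrow> 'a \<Rightarrow> real \<Rightarrow> real) \<Rightarrow> bool" where
  "psi_summable M G \<longleftrightarrow>
     (\<forall>k\<ge>1. psi_coeff M G k < \<infinity>) \<and>
     summable (\<lambda>k. real k * sqrt (enn2real (psi_coeff M G k)))"

end

theory Submission
  imports Defs
begin

text \<open>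
Write \<open>F'\<^sub>t\<close> and \<open>C'\<^sub>k\<close> for the empirical counterparts of \<open>F\<^sub>t\<close> and \<open>C\<^sub>k\<close>, and \<open>m\<close> for the mean
distribution function. Everything reduces to one quantity, the total error: the sum of the
Hilbert--Schmidt norms of \<open>C'\<^sub>k - C\<^sub>k\<close> for \<open>1 \<le> k \<le> p\<close> and of the norm of the error of the
estimated mean. Its expectation is of order \<open>1 / sqrt n\<close>, and it controls the errors of all scores.

Probabilistic part. By the conjugate property, cyclic independence and stationarity, \<open>F'\<^sub>t(x)\<close> and
\<open>F'\<^sub>t(x) F'\<^sub>t\<^sub>+\<^sub>k(y)\<close>, with \<open>k \<ge> 1\<close>, have the same expectations as \<open>F\<^sub>0(x)\<close> and \<open>F\<^sub>0(x) F\<^sub>k(y)\<close>, even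
though the sequence \<open>F'\<close> need not be stationary. These variables take finitely many values in the
unit interval, so their covariances are bounded by the mixing coefficients, and summability of the
coefficients bounds the mean square of their centred averages by a constant over \<open>n\<close>, uniformly
in \<open>x\<close> and \<open>y\<close> (\<open>average_mean_square_le\<close>, \<open>Chat_mean_square\<close>, \<open>total_error_L1\<close>).

Spectral part. For a bounded positive semidefinite kernel \<open>K\<close> with eigensystem \<open>(\<theta>, \<psi>)\<close>, functions
orthogonal to \<open>\<psi>\<^sub>i\<close> for all \<open>i < j\<close> have Rayleigh quotient at most \<open>\<theta>\<^sub>j\<close> (\<open>rayleigh_le\<close>). To see this,
deflate \<open>K\<close> by its first \<open>j\<close> eigenfunctions and let \<open>\<lambda>\<close> be the supremum of the Rayleigh quotients of
the deflated kernel \<open>L\<close>. If \<open>\<lambda> > 0\<close>, the kernels of \<open>L\<^sup>n / \<lambda>\<^sup>n\<close> converge pointwise, because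
\<open>\<langle>L\<^sup>n f, f\<rangle> / \<lambda>\<^sup>n\<close> is non-increasing in \<open>n\<close>, and the limit is nonzero, because \<open>L\<^sup>n\<close> has
Hilbert--Schmidt norm at least \<open>\<lambda>\<^sup>n\<close>; the slices of the limit are eigenfunctions
(\<open>top_eigenfunction\<close>). Neither completeness of the Hilbert space nor compactness is needed. Weyl's
inequality follows, and so does the bound \<open>3 D / \<delta>\<close> for the perturbation of the eigenfunction of a
simple eigenvalue with gap \<open>\<delta>\<close>, where \<open>D\<close> bounds the difference of the operators
(\<open>eigenfunction_perturbation\<close>).

Conclusion. If \<open>\<theta>\<^sub>j \<noteq> 0\<close>, the estimated score differs from \<open>\<langle>F'\<^sub>t - m, \<psi>\<^sub>j\<rangle>\<close>, whose conditional
expectation is the true score, by at most a multiple of the total error; since conditional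
expectation contracts the norm of \<open>L\<^sup>1\<close>, Markov's inequality gives the first claim. For the second
claim, \<open>F'\<^sub>t - m\<close> is split at \<open>F\<^sub>t\<close>. If \<open>\<theta>\<^sub>j = 0\<close>, the operator has finite rank, the equality of the
closed ranges puts \<open>F\<^sub>t - m\<close> almost surely into the span of the eigenfunctions with nonzero
eigenvalue (\<open>finite_rank_expansion\<close>), and those are nearly orthogonal to the estimated
eigenfunction (\<open>cross_inner_le\<close>).
\<close>

section \<open>Square-integrable functions\<close>

lemma nonneg_quadratic_discriminant:
  fixes a b c :: real
  assumes q: "\<And>s. 0 \<le> a + 2 * s * b + s\<^sup>2 * c" and c0: "0 \<le> c"
  shows "b\<^sup>2 \<le> a * c"
proof (cases "c = 0")
  case True
  have "b = 0"
  proof (rule ccontr)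
    assume "b \<noteq> 0"
    then show False using q[of "- (a + 1) / (2 * b)"] True by (simp add: field_simps)
  qed
  then show ?thesis using True by simp
next
  case False
  then have "0 < c" using c0 by simp
  have "0 \<le> c * (a + 2 * (- b / c) * b + (- b / c)\<^sup>2 * c)"
    using q[of "- b / c"] c0 by simp
  also have "\<dots> = a * c - b\<^sup>2" using False by (simp add: power2_eq_square field_simps)
  finally show ?thesis by simp
qed

lemma integral_Cauchy_Schwarz:
  fixes f g :: "'a \<Rightarrow> real"
  assumes [measurable]: "f \<in> borel_measurable N" "g \<in> borel_measurable N"
    and f: "integrable N (\<lambda>x. (f x)\<^sup>2)" and g: "integrable N (\<lambda>x. (g x)\<^sup>2)"
  shows "integrable N (\<lambda>x. f x * g x)"
    and "(\<integral>x. f x * g x \<partial>N)\<^sup>2 \<le> (\<integral>x. (f x)\<^sup>2 \<partial>N) * (\<integral>x. (g x)\<^sup>2 \<partial>N)"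
proof -
  show fg: "integrable N (\<lambda>x. f x * g x)"
  proof (rule Bochner_Integration.integrable_bound)
    show "integrable N (\<lambda>x. (f x)\<^sup>2 + (g x)\<^sup>2)" using f g by simp
    have "\<bar>a * b\<bar> \<le> a\<^sup>2 + b\<^sup>2" for a b :: real
    proof -
      have "0 \<le> (\<bar>a\<bar> - \<bar>b\<bar>)\<^sup>2" "0 \<le> a\<^sup>2" "0 \<le> b\<^sup>2" by auto
      then have "2 * (\<bar>a\<bar> * \<bar>b\<bar>) \<le> a\<^sup>2 + b\<^sup>2" by (simp add: power2_diff)
      moreover have "0 \<le> \<bar>a\<bar> * \<bar>b\<bar>" by simp
      ultimately show ?thesis unfolding abs_mult by linarith
    qed
    then show "AE x in N. norm (f x * g x) \<le> norm ((f x)\<^sup>2 + (g x)\<^sup>2)"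
      by auto
  qed simp
  define a b c where "a = (\<integral>x. (f x)\<^sup>2 \<partial>N)" and "b = (\<integral>x. f x * g x \<partial>N)"
    and "c = (\<integral>x. (g x)\<^sup>2 \<partial>N)"
  have "0 \<le> a + 2 * s * b + s\<^sup>2 * c" for s
  proof -
    have "0 \<le> (\<integral>x. (f x + s * g x)\<^sup>2 \<partial>N)" by simp
    also have "\<dots> = (\<integral>x. (f x)\<^sup>2 + 2 * s * (f x * g x) + s\<^sup>2 * (g x)\<^sup>2 \<partial>N)"
      by (intro Bochner_Integration.integral_cong) (auto simp: power2_eq_square algebra_simps)
    also have "\<dots> = a + 2 * s * b + s\<^sup>2 * c"
      using f g fg unfolding a_def b_def c_def by simp
    finally show ?thesis .
  qed
  then show "b\<^sup>2 \<le> a * c"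
    by (rule nonneg_quadratic_discriminant) (simp add: c_def)
qed

text \<open>
A finite Borel measure on the line. Its square-integrable functions are kept as functions, so
\<^const>\<open>L2_inner\<close> is only a semi-inner product on \<^term>\<open>L2 \<mu>\<close>, and identities between elements of the
Hilbert space become identities almost everywhere.
\<close>

locale L2_space = finite_measure \<mu> for \<mu> :: "real measure" +
  assumes sets_mu [measurable_cong]: "sets \<mu> = sets borel"
begin

abbreviation "ip \<equiv> L2_inner \<mu>"
abbreviation "nrm \<equiv> L2_norm \<mu>"
abbreviation "kop \<equiv> kernel_op \<mu>"
abbreviation "mass \<equiv> measure \<mu> UNIV"

lemma space_mu [simp]: "space \<mu> = UNIV"
  using sets_eq_imp_space_eq[OF sets_mu] by simp

lemma L2_measurable [measurable_dest]: "f \<in> L2 \<mu> \<Longrightarrow> f \<in> borel_measurable \<mu>"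
  by (simp add: L2_def)

lemma L2_integrable_mult: "f \<in> L2 \<mu> \<Longrightarrow> g \<in> L2 \<mu> \<Longrightarrow> integrable \<mu> (\<lambda>x. f x * g x)"
  by (rule integral_Cauchy_Schwarz) (auto simp: L2_def)

lemma L2_bounded:
  assumes [measurable]: "f \<in> borel_measurable \<mu>" and b: "\<And>x. \<bar>f x\<bar> \<le> B"
  shows "f \<in> L2 \<mu>"
proof -
  have "AE x in \<mu>. norm ((f x)\<^sup>2) \<le> B\<^sup>2"
    using b by (auto intro!: AE_I2 simp: abs_le_square_iff[symmetric] intro: order_trans[OF b])
  then show ?thesis unfolding L2_def by (auto intro!: integrable_const_bound[where B="B\<^sup>2"])
qed

lemma L2_const [simp]: "(\<lambda>x. c) \<in> L2 \<mu>"
  by (rule L2_bounded[where B="\<bar>c\<bar>"]) auto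

lemma L2_integrable: "f \<in> L2 \<mu> \<Longrightarrow> integrable \<mu> f"
  using L2_integrable_mult[of f "\<lambda>_. 1"] by simp

lemma L2_add [intro]:
  assumes f: "f \<in> L2 \<mu>" and g: "g \<in> L2 \<mu>"
  shows "(\<lambda>x. f x + g x) \<in> L2 \<mu>"
proof -
  have "integrable \<mu> (\<lambda>x. (f x)\<^sup>2 + 2 * (f x * g x) + (g x)\<^sup>2)"
    using f g L2_integrable_mult[OF f g] by (auto simp: L2_def)
  then show ?thesis using f g
    by (auto simp: L2_def power2_sum algebra_simps)
qed

lemma L2_scale [intro]: "f \<in> L2 \<mu> \<Longrightarrow> (\<lambda>x. c * f x) \<in> L2 \<mu>"
  by (auto simp: L2_def power_mult_distrib)

lemma L2_diff [intro]: "f \<in> L2 \<mu> \<Longrightarrow> g \<in> L2 \<mu> \<Longrightarrow> (\<lambda>x. f x - g x) \<in> L2 \<mu>"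
  using L2_add[of f "\<lambda>x. (-1) * g x"] L2_scale[of g "-1"] by simp

lemma L2_sum [intro]: "(\<And>i. i \<in> I \<Longrightarrow> f i \<in> L2 \<mu>) \<Longrightarrow> (\<lambda>x. \<Sum>i\<in>I. f i x) \<in> L2 \<mu>"
  by (induction I rule: infinite_finite_induct) auto

lemma inner_commute: "ip f g = ip g f"
  by (simp add: L2_inner_def mult.commute)

lemma inner_add_left: "f \<in> L2 \<mu> \<Longrightarrow> g \<in> L2 \<mu> \<Longrightarrow> h \<in> L2 \<mu> \<Longrightarrow>
    ip (\<lambda>x. f x + g x) h = ip f h + ip g h"
  unfolding L2_inner_def by (simp add: distrib_right L2_integrable_mult)

lemma inner_scale_left: "ip (\<lambda>x. c * f x) h = c * ip f h"
  unfolding L2_inner_def by (simp add: mult.assoc)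

lemma inner_diff_left: "f \<in> L2 \<mu> \<Longrightarrow> g \<in> L2 \<mu> \<Longrightarrow> h \<in> L2 \<mu> \<Longrightarrow>
    ip (\<lambda>x. f x - g x) h = ip f h - ip g h"
  unfolding L2_inner_def by (simp add: left_diff_distrib L2_integrable_mult)

lemma inner_sum_left: "(\<And>i. i \<in> I \<Longrightarrow> f i \<in> L2 \<mu>) \<Longrightarrow> h \<in> L2 \<mu> \<Longrightarrow>
    ip (\<lambda>x. \<Sum>i\<in>I. f i x) h = (\<Sum>i\<in>I. ip (f i) h)"
  unfolding L2_inner_def by (simp add: sum_distrib_right)
    (intro Bochner_Integration.integral_sum L2_integrable_mult)

lemma inner_add_right: "f \<in> L2 \<mu> \<Longrightarrow> g \<in> L2 \<mu> \<Longrightarrow> h \<in> L2 \<mu> \<Longrightarrow>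
    ip h (\<lambda>x. f x + g x) = ip h f + ip h g"
  using inner_add_left by (simp add: inner_commute[of h])

lemma inner_scale_right: "ip h (\<lambda>x. c * f x) = c * ip h f"
  using inner_scale_left by (simp add: inner_commute[of h])

lemma inner_diff_right: "f \<in> L2 \<mu> \<Longrightarrow> g \<in> L2 \<mu> \<Longrightarrow> h \<in> L2 \<mu> \<Longrightarrow>
    ip h (\<lambda>x. f x - g x) = ip h f - ip h g"
  using inner_diff_left by (simp add: inner_commute[of h])

lemma inner_sum_right: "(\<And>i. i \<in> I \<Longrightarrow> f i \<in> L2 \<mu>) \<Longrightarrow> h \<in> L2 \<mu> \<Longrightarrow>
    ip h (\<lambda>x. \<Sum>i\<in>I. f i x) = (\<Sum>i\<in>I. ip h (f i))"
  using inner_sum_left[of I f h] by (simp add: inner_commute[of h])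

lemma inner_divide_left: "ip (\<lambda>x. f x / c) h = ip f h / c"
  using inner_scale_left[of "inverse c" f h] by (simp add: divide_inverse mult.commute)

lemma inner_divide_right: "ip h (\<lambda>x. f x / c) = ip h f / c"
  using inner_divide_left[of f c h] by (simp add: inner_commute[of h])

lemma inner_cong_AE_left:
  assumes "f \<in> L2 \<mu>" "g \<in> L2 \<mu>" "h \<in> L2 \<mu>" "AE x in \<mu>. f x = g x"
  shows "ip f h = ip g h"
  unfolding L2_inner_def using assms by (intro integral_cong_AE) auto

lemma inner_cong_AE_right:
  assumes "f \<in> L2 \<mu>" "g \<in> L2 \<mu>" "h \<in> L2 \<mu>" "AE x in \<mu>. f x = g x"
  shows "ip h f = ip h g"
  using inner_cong_AE_left[OF assms] by (simp add: inner_commute)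

lemma inner_self_nonneg [simp]: "0 \<le> ip f f"
  by (simp add: L2_inner_def)

lemma norm_nonneg [simp]: "0 \<le> nrm f"
  by (simp add: L2_norm_def)

lemma norm_sq: "(nrm f)\<^sup>2 = ip f f"
  by (simp add: L2_norm_def)

lemma inner_square_le: "f \<in> L2 \<mu> \<Longrightarrow> g \<in> L2 \<mu> \<Longrightarrow>
    (ip f g)\<^sup>2 \<le> ip f f * ip g g"
  using integral_Cauchy_Schwarz(2)[of f \<mu> g]
  by (simp add: L2_def L2_inner_def power2_eq_square)

lemma inner_abs_le:
  assumes "f \<in> L2 \<mu>" "g \<in> L2 \<mu>"
  shows "\<bar>ip f g\<bar> \<le> nrm f * nrm g"
proof -
  have "\<bar>ip f g\<bar>\<^sup>2 \<le> (nrm f * nrm g)\<^sup>2"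
    using inner_square_le[OF assms] by (simp add: power_mult_distrib norm_sq)
  then show ?thesis by (rule power2_le_imp_le) simp
qed

lemma inner_self_zero_iff:
  assumes "f \<in> L2 \<mu>"
  shows "ip f f = 0 \<longleftrightarrow> (AE x in \<mu>. f x = 0)"
proof -
  have "integrable \<mu> (\<lambda>x. f x * f x)" using assms by (simp add: L2_integrable_mult)
  then show ?thesis
    unfolding L2_inner_def by (subst integral_nonneg_eq_0_iff_AE) auto
qed

lemma norm_bounded_le:
  assumes [measurable]: "f \<in> borel_measurable \<mu>" and b: "\<And>x. \<bar>f x\<bar> \<le> 1"
  shows "nrm f \<le> sqrt (mass)"
proof -
  have "\<bar>f x * f x\<bar> \<le> 1" for x using mult_le_one[OF b[of x] abs_ge_zero b[of x]] by (simp add: abs_mult)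
  then have "f x * f x \<le> 1" for x using abs_ge_self order_trans by blast
  then have "ip f f \<le> (\<integral>x. 1 \<partial>\<mu>)"
    unfolding L2_inner_def using L2_bounded[OF assms]
    by (intro integral_mono L2_integrable_mult) auto
  then show ?thesis unfolding L2_norm_def by (simp add: lebesgue_integral_const)
qed

lemma inner_bounded_abs_le:
  assumes h: "h \<in> borel_measurable \<mu>" "\<And>x. \<bar>h x\<bar> \<le> 1" and f: "f \<in> L2 \<mu>"
  shows "\<bar>ip h f\<bar> \<le> sqrt (mass) * nrm f"
  by (rule order_trans[OF inner_abs_le[OF L2_bounded[OF h] f] mult_right_mono[OF norm_bounded_le[OF h]]]) simp

section \<open>Integral operators with bounded kernels\<close>

text \<open>
Jointly measurable kernels that are bounded at every point, not only almost everywhere. Pointwise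
boundedness makes every slice square-integrable and every function in the range bounded, so that no
null sets arise when kernels are composed.
\<close>

definition bdd_kernel :: "(real \<Rightarrow> real \<Rightarrow> real) \<Rightarrow> bool" where
  "bdd_kernel K \<longleftrightarrow> (\<lambda>(x, y). K x y) \<in> borel_measurable (\<mu> \<Otimes>\<^sub>M \<mu>) \<and> (\<exists>B. \<forall>x y. \<bar>K x y\<bar> \<le> B)"

text \<open>
Bounded kernels that are symmetric at every point and whose operator is positive semidefinite.
\<close>

definition psd_kernel :: "(real \<Rightarrow> real \<Rightarrow> real) \<Rightarrow> bool" where
  "psd_kernel K \<longleftrightarrow> bdd_kernel K \<and> (\<forall>x y. K x y = K y x) \<and>
     (\<forall>f\<in>L2 \<mu>. 0 \<le> ip (kop K f) f)"

lemma bdd_kernel_measurable [measurable_dest]: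
  "bdd_kernel K \<Longrightarrow> (\<lambda>(x, y). K x y) \<in> borel_measurable (\<mu> \<Otimes>\<^sub>M \<mu>)"
  by (simp add: bdd_kernel_def)

lemma psd_imp_bdd: "psd_kernel K \<Longrightarrow> bdd_kernel K" by (simp add: psd_kernel_def)

sublocale pair_finite: pair_sigma_finite \<mu> \<mu>
  by standard

lemma bdd_kernel_slice:
  assumes "bdd_kernel K"
  shows "K x \<in> L2 \<mu>" "(\<lambda>x. K x y) \<in> L2 \<mu>"
proof -
  obtain B where B: "\<And>x y. \<bar>K x y\<bar> \<le> B" using assms by (auto simp: bdd_kernel_def)
  note [measurable] = bdd_kernel_measurable[OF assms]
  have "(\<lambda>y. case (x, y) of (x, y) \<Rightarrow> K x y) \<in> borel_measurable \<mu>" by measurable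
  then show "K x \<in> L2 \<mu>" by (intro L2_bounded[where B=B]) (auto simp: B)
  have "(\<lambda>x. case (x, y) of (x, y) \<Rightarrow> K x y) \<in> borel_measurable \<mu>" by measurable
  then show "(\<lambda>x. K x y) \<in> L2 \<mu>" by (intro L2_bounded[where B=B]) (auto simp: B)
qed

lemma kernel_op_eq_inner: "kop K f x = ip (K x) f"
  by (simp add: kernel_op_def L2_inner_def)

lemma kernel_op_bounded:
  assumes "bdd_kernel K" "f \<in> L2 \<mu>"
  shows "\<exists>C. \<forall>x. \<bar>kop K f x\<bar> \<le> C"
proof -
  obtain B where B: "\<And>x y. \<bar>K x y\<bar> \<le> B" using assms by (auto simp: bdd_kernel_def)
  have i: "integrable \<mu> f" using L2_integrable assms by blast
  have "\<bar>kop K f x\<bar> \<le> (\<integral>y. B * \<bar>f y\<bar> \<partial>\<mu>)" for x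
  proof -
    have "\<bar>kop K f x\<bar> \<le> (\<integral>y. \<bar>K x y * f y\<bar> \<partial>\<mu>)"
      unfolding kernel_op_def by (rule integral_abs_bound)
    also have "\<dots> \<le> (\<integral>y. B * \<bar>f y\<bar> \<partial>\<mu>)"
      using i L2_integrable_mult[OF bdd_kernel_slice(1)[OF assms(1)] assms(2)]
      by (intro integral_mono integrable_abs integrable_mult_right)
        (auto simp: abs_mult intro!: mult_right_mono B)
    finally show ?thesis .
  qed
  then show ?thesis by blast
qed

lemma kernel_op_measurable [measurable]:
  assumes "bdd_kernel K" "f \<in> L2 \<mu>"
  shows "kop K f \<in> borel_measurable \<mu>"
proof -
  note [measurable] = bdd_kernel_measurable[OF assms(1)] L2_measurable[OF assms(2)]
  show ?thesis unfolding kernel_op_def[abs_def] by measurable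
qed

lemma kernel_op_L2 [intro]: "bdd_kernel K \<Longrightarrow> f \<in> L2 \<mu> \<Longrightarrow> kop K f \<in> L2 \<mu>"
  using kernel_op_bounded kernel_op_measurable L2_bounded by metis

lemma kernel_op_add:
  assumes "bdd_kernel K" "f \<in> L2 \<mu>" "g \<in> L2 \<mu>"
  shows "kop K (\<lambda>x. f x + g x) = (\<lambda>x. kop K f x + kop K g x)"
  by (rule ext) (simp add: kernel_op_eq_inner inner_add_right assms bdd_kernel_slice)

lemma kernel_op_scale:
  "kop K (\<lambda>x. c * f x) = (\<lambda>x. c * kop K f x)"
  by (rule ext) (simp add: kernel_op_eq_inner inner_scale_right)

lemma kernel_op_diff:
  assumes "bdd_kernel K" "f \<in> L2 \<mu>" "g \<in> L2 \<mu>"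
  shows "kop K (\<lambda>x. f x - g x) = (\<lambda>x. kop K f x - kop K g x)"
  by (rule ext) (simp add: kernel_op_eq_inner inner_diff_right assms bdd_kernel_slice)

lemma kernel_op_sum:
  assumes "bdd_kernel K" "\<And>i. i \<in> I \<Longrightarrow> f i \<in> L2 \<mu>"
  shows "kop K (\<lambda>x. \<Sum>i\<in>I. f i x) = (\<lambda>x. \<Sum>i\<in>I. kop K (f i) x)"
  by (rule ext) (simp add: kernel_op_eq_inner inner_sum_right assms bdd_kernel_slice)

lemma integrable_kernel_form:
  assumes "bdd_kernel K" "f \<in> L2 \<mu>" "g \<in> L2 \<mu>"
  shows "integrable (\<mu> \<Otimes>\<^sub>M \<mu>) (\<lambda>(x, y). K x y * f y * g x)"
proof -
  obtain B where B: "\<And>x y. \<bar>K x y\<bar> \<le> B" using assms by (auto simp: bdd_kernel_def)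
  note [measurable] = bdd_kernel_measurable[OF assms(1)] L2_measurable[OF assms(2)] L2_measurable[OF assms(3)]
  have fi: "integrable \<mu> f" "integrable \<mu> g" using L2_integrable assms by auto
  have "integrable (\<mu> \<Otimes>\<^sub>M \<mu>) (\<lambda>(x, y). g x * f y)"
    using fi by (intro pair_finite.Fubini_integrable) (auto simp: abs_mult)
  then have "integrable (\<mu> \<Otimes>\<^sub>M \<mu>) (\<lambda>z. B * (case z of (x, y) \<Rightarrow> g x * f y))"
    by (rule integrable_mult_right)
  then show ?thesis
  proof (rule Bochner_Integration.integrable_bound)
    show "(\<lambda>(x, y). K x y * f y * g x) \<in> borel_measurable (\<mu> \<Otimes>\<^sub>M \<mu>)" by measurable
    show "AE z in \<mu> \<Otimes>\<^sub>M \<mu>. norm (case z of (x, y) \<Rightarrow> K x y * f y * g x)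
        \<le> norm (B * (case z of (x, y) \<Rightarrow> g x * f y))"
    proof (rule AE_I2)
      fix z :: "real \<times> real"
      obtain x y where z: "z = (x, y)" by force
      have "\<bar>K x y\<bar> * \<bar>f y * g x\<bar> \<le> \<bar>B\<bar> * \<bar>f y * g x\<bar>"
        by (intro mult_right_mono) (use B[of x y] in auto)
      then show "norm (case z of (x, y) \<Rightarrow> K x y * f y * g x)
        \<le> norm (B * (case z of (x, y) \<Rightarrow> g x * f y))" by (simp add: z abs_mult mult_ac)
    qed
  qed
qed

lemma inner_kernel_op:
  assumes "bdd_kernel K" "f \<in> L2 \<mu>" "g \<in> L2 \<mu>"
  shows "ip (kop K f) g = (\<integral>z. (case z of (x, y) \<Rightarrow> K x y * f y * g x) \<partial>(\<mu> \<Otimes>\<^sub>M \<mu>))"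
proof -
  have "ip (kop K f) g = (\<integral>x. (\<integral>y. K x y * f y * g x \<partial>\<mu>) \<partial>\<mu>)"
    unfolding L2_inner_def kernel_op_def by simp
  also have "\<dots> = (\<integral>z. (case z of (x, y) \<Rightarrow> K x y * f y * g x) \<partial>(\<mu> \<Otimes>\<^sub>M \<mu>))"
    using pair_finite.integral_fst'[OF integrable_kernel_form[OF assms]] by simp
  finally show ?thesis .
qed

lemma inner_kernel_op_transpose:
  assumes K: "bdd_kernel K" and f: "f \<in> L2 \<mu>" and g: "g \<in> L2 \<mu>"
  shows "ip (kop K f) g = ip f (kop (\<lambda>x y. K y x) g)"
proof -
  have "ip (kop K f) g = (\<integral>x. (\<integral>y. K x y * f y * g x \<partial>\<mu>) \<partial>\<mu>)"
    unfolding L2_inner_def kernel_op_def by simp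
  also have "\<dots> = (\<integral>y. (\<integral>x. K x y * f y * g x \<partial>\<mu>) \<partial>\<mu>)"
    by (rule pair_finite.Fubini_integral[symmetric]) (rule integrable_kernel_form[OF assms])
  also have "\<dots> = (\<integral>y. f y * (\<integral>x. K x y * g x \<partial>\<mu>) \<partial>\<mu>)"
    by (simp flip: integral_mult_right_zero add: mult_ac)
  finally show ?thesis unfolding L2_inner_def kernel_op_def .
qed

lemma inner_kernel_op_sym:
  assumes "psd_kernel K" "f \<in> L2 \<mu>" "g \<in> L2 \<mu>"
  shows "ip (kop K f) g = ip f (kop K g)"
proof -
  have "(\<lambda>x y. K y x) = K" using assms(1) unfolding psd_kernel_def by auto
  then show ?thesis using inner_kernel_op_transpose[OF psd_imp_bdd[OF assms(1)] assms(2,3)] by simp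
qed

end

context L2_space
begin

lemma psd_sym: "psd_kernel K \<Longrightarrow> K x y = K y x"
  by (simp add: psd_kernel_def)

lemma psd_nonneg: "psd_kernel K \<Longrightarrow> f \<in> L2 \<mu> \<Longrightarrow> 0 \<le> ip (kop K f) f"
  by (simp add: psd_kernel_def)

text \<open>
The Cauchy--Schwarz inequality for the semi-inner product \<open>\<langle>K f, g\<rangle>\<close>.
\<close>

lemma psd_Cauchy_Schwarz:
  assumes K: "psd_kernel K" and f: "f \<in> L2 \<mu>" and g: "g \<in> L2 \<mu>"
  shows "(ip (kop K f) g)\<^sup>2
    \<le> ip (kop K f) f * ip (kop K g) g"
proof (rule nonneg_quadratic_discriminant)
  fix s :: real
  note b = psd_imp_bdd[OF K]
  have sy: "ip (kop K g) f = ip (kop K f) g"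
    using inner_kernel_op_sym[OF K g f] by (simp add: inner_commute)
  have "0 \<le> ip (kop K (\<lambda>x. f x + s * g x)) (\<lambda>x. f x + s * g x)"
    using f g by (intro psd_nonneg[OF K]) auto
  also have "\<dots> = ip (kop K f) f + 2 * s * ip (kop K f) g
      + s\<^sup>2 * ip (kop K g) g"
    using f g b
    by (simp add: kernel_op_add kernel_op_scale L2_scale L2_add kernel_op_L2 inner_add_left inner_add_right
        inner_scale_left inner_scale_right sy algebra_simps power2_eq_square)
  finally show "0 \<le> ip (kop K f) f + 2 * s * ip (kop K f) g
      + s\<^sup>2 * ip (kop K g) g" .
qed (rule psd_nonneg[OF K g])

text \<open>
The Hilbert--Schmidt norm: the norm of the kernel as an element of the product space.
\<close>

definition hs_norm :: "(real \<Rightarrow> real \<Rightarrow> real) \<Rightarrow> real" where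
  "hs_norm K = sqrt (\<integral>z. (case z of (x, y) \<Rightarrow> (K x y)\<^sup>2) \<partial>(\<mu> \<Otimes>\<^sub>M \<mu>))"

lemma bdd_kernel_prod_integrable:
  assumes "bdd_kernel K"
  shows "integrable (\<mu> \<Otimes>\<^sub>M \<mu>) (\<lambda>(x, y). K x y)"
  using integrable_kernel_form[OF assms, of "\<lambda>_. 1" "\<lambda>_. 1"] by simp

lemma bdd_kernel_mult:
  assumes "bdd_kernel K" "bdd_kernel L"
  shows "bdd_kernel (\<lambda>x y. K x y * L x y)"
proof -
  obtain B B' where B: "\<And>x y. \<bar>K x y\<bar> \<le> B" "\<And>x y. \<bar>L x y\<bar> \<le> B'"
    using assms by (auto simp: bdd_kernel_def)
  note [measurable] = bdd_kernel_measurable[OF assms(1)] bdd_kernel_measurable[OF assms(2)]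
  have "\<bar>K x y * L x y\<bar> \<le> B * B'" for x y
    unfolding abs_mult using B order_trans[OF abs_ge_zero B(1)] by (intro mult_mono) auto
  then show ?thesis unfolding bdd_kernel_def by (auto intro!: exI[of _ "B * B'"])
qed

lemma bdd_kernel_add:
  assumes "bdd_kernel K" "bdd_kernel L"
  shows "bdd_kernel (\<lambda>x y. K x y + L x y)"
proof -
  obtain B B' where B: "\<And>x y. \<bar>K x y\<bar> \<le> B" "\<And>x y. \<bar>L x y\<bar> \<le> B'"
    using assms by (auto simp: bdd_kernel_def)
  note [measurable] = bdd_kernel_measurable[OF assms(1)] bdd_kernel_measurable[OF assms(2)]
  have "\<bar>K x y + L x y\<bar> \<le> B + B'" for x y
    using B(1)[of x y] B(2)[of x y] by linarith
  then show ?thesis unfolding bdd_kernel_def by (auto intro!: exI[of _ "B + B'"])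
qed

lemma bdd_kernel_const: "bdd_kernel (\<lambda>x y. c)"
  unfolding bdd_kernel_def by auto

lemma bdd_kernel_diff:
  assumes "bdd_kernel K" "bdd_kernel L"
  shows "bdd_kernel (\<lambda>x y. K x y - L x y)"
  using bdd_kernel_add[OF assms(1) bdd_kernel_mult[OF bdd_kernel_const[of "-1"] assms(2)]] by simp

lemma bdd_kernel_sum:
  "(\<And>i. i \<in> I \<Longrightarrow> bdd_kernel (K i)) \<Longrightarrow> bdd_kernel (\<lambda>x y. \<Sum>i\<in>I. K i x y)"
  by (induction I rule: infinite_finite_induct) (auto intro: bdd_kernel_add bdd_kernel_const)

lemma bdd_kernel_tensor:
  assumes [measurable]: "f \<in> borel_measurable \<mu>" "g \<in> borel_measurable \<mu>"
    and "\<exists>C. \<forall>x. \<bar>f x\<bar> \<le> C" "\<exists>C. \<forall>x. \<bar>g x\<bar> \<le> C"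
  shows "bdd_kernel (\<lambda>x y. f x * g y)"
proof -
  obtain B B' where B: "\<And>x. \<bar>f x\<bar> \<le> B" "\<And>y. \<bar>g y\<bar> \<le> B'" using assms by blast
  have "\<bar>f x * g y\<bar> \<le> B * B'" for x y
    unfolding abs_mult using B order_trans[OF abs_ge_zero B(1)] by (intro mult_mono) auto
  then show ?thesis unfolding bdd_kernel_def by (auto intro!: exI[of _ "B * B'"])
qed

lemma hs_norm_nonneg [simp]: "0 \<le> hs_norm K"
  unfolding hs_norm_def by (intro real_sqrt_ge_zero integral_nonneg_AE) auto

lemma kernel_form_le_hs_norm:
  assumes K: "bdd_kernel K" and f: "f \<in> L2 \<mu>" and g: "g \<in> L2 \<mu>"
  shows "\<bar>ip (kop K f) g\<bar> \<le> hs_norm K * nrm f * nrm g"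
proof -
  let ?P = "\<mu> \<Otimes>\<^sub>M \<mu>"
  note [measurable] = bdd_kernel_measurable[OF K] L2_measurable[OF f] L2_measurable[OF g]
  have i2: "integrable ?P (\<lambda>z. (case z of (x, y) \<Rightarrow> K x y)\<^sup>2)"
  proof -
    have "(\<lambda>z. (case z of (x, y) \<Rightarrow> K x y)\<^sup>2) = (\<lambda>(x, y). K x y * K x y)"
      by (auto simp: power2_eq_square)
    then show ?thesis using bdd_kernel_prod_integrable[OF bdd_kernel_mult[OF K K]] by simp
  qed
  have sq: "integrable \<mu> (\<lambda>x. (f x)\<^sup>2)" "integrable \<mu> (\<lambda>x. (g x)\<^sup>2)"
    using f g by (auto simp: L2_def)
  have i3: "integrable ?P (\<lambda>z. (case z of (x, y) \<Rightarrow> f y * g x)\<^sup>2)"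
    using sq by (intro pair_finite.Fubini_integrable) (auto simp: abs_mult power_mult_distrib)
  have "(\<integral>z. (case z of (x, y) \<Rightarrow> f y * g x)\<^sup>2 \<partial>?P) = ip f f * ip g g"
    using pair_finite.integral_fst'[OF i3]
    by (simp add: L2_inner_def power_mult_distrib mult.commute flip: power2_eq_square)
  moreover have "(\<integral>z. (case z of (x, y) \<Rightarrow> K x y)\<^sup>2 \<partial>?P) = (hs_norm K)\<^sup>2"
  proof -
    have "(\<lambda>z. (case z of (x, y) \<Rightarrow> K x y)\<^sup>2) = (\<lambda>(x, y). (K x y)\<^sup>2)" by auto
    moreover have "0 \<le> (\<integral>z. (case z of (x, y) \<Rightarrow> (K x y)\<^sup>2) \<partial>?P)"
      by (intro integral_nonneg_AE) auto
    ultimately show ?thesis unfolding hs_norm_def by simp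
  qed
  moreover have "ip (kop K f) g
      = (\<integral>z. (case z of (x, y) \<Rightarrow> K x y) * (case z of (x, y) \<Rightarrow> f y * g x) \<partial>?P)"
    unfolding inner_kernel_op[OF K f g] by (intro Bochner_Integration.integral_cong) auto
  ultimately have "(ip (kop K f) g)\<^sup>2
      \<le> (hs_norm K)\<^sup>2 * (ip f f * ip g g)"
    using integral_Cauchy_Schwarz(2)[OF _ _ i2 i3] by simp
  then have "\<bar>ip (kop K f) g\<bar>\<^sup>2 \<le> (hs_norm K * nrm f * nrm g)\<^sup>2"
    by (simp add: power_mult_distrib norm_sq mult_ac)
  then show ?thesis by (rule power2_le_imp_le) simp
qed

section \<open>Existence of a leading eigenfunction\<close>

text \<open>
Throughout this context the number \<open>lam\<close> is positive and bounds the Rayleigh quotients of \<open>K\<close>; that it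
is their supremum is assumed only in \<open>top_eigenfunction\<close>.
\<close>

context
  fixes K :: "real \<Rightarrow> real \<Rightarrow> real" and lam :: real
  assumes K: "psd_kernel K"
    and lam_pos: "0 < lam"
    and lam_ub: "\<And>f. f \<in> L2 \<mu> \<Longrightarrow> ip (kop K f) f \<le> lam * ip f f"
begin

abbreviation iter :: "nat \<Rightarrow> (real \<Rightarrow> real) \<Rightarrow> real \<Rightarrow> real" where
  "iter n \<equiv> (kop K ^^ n)"

lemma iter_L2: "f \<in> L2 \<mu> \<Longrightarrow> iter n f \<in> L2 \<mu>"
  by (induction n) (auto intro: psd_imp_bdd[OF K])

lemma iter_add: "f \<in> L2 \<mu> \<Longrightarrow> g \<in> L2 \<mu> \<Longrightarrow> iter n (\<lambda>x. f x + g x) = (\<lambda>x. iter n f x + iter n g x)"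
  by (induction n) (auto simp: kernel_op_add[OF psd_imp_bdd[OF K]] iter_L2)

lemma iter_shift: "f \<in> L2 \<mu> \<Longrightarrow> g \<in> L2 \<mu> \<Longrightarrow> ip (iter (a + n) f) g = ip (iter a f) (iter n g)"
proof (induction n arbitrary: g)
  case (Suc n)
  have "ip (iter (a + Suc n) f) g = ip (iter (a + n) f) (kop K g)"
    using Suc.prems by (simp add: inner_kernel_op_sym[OF K] iter_L2)
  also have "\<dots> = ip (iter a f) (iter n (kop K g))"
    using Suc.prems psd_imp_bdd[OF K] by (intro Suc.IH) auto
  finally show ?case by (simp add: funpow_swap1)
qed simp

lemma norm_op_le:
  assumes g: "g \<in> L2 \<mu>"
  shows "ip (kop K g) (kop K g) \<le> lam * ip (kop K g) g"
proof -
  let ?Kg = "kop K g"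
  let ?a = "ip ?Kg ?Kg"
  have Kg: "?Kg \<in> L2 \<mu>" using g psd_imp_bdd[OF K] by auto
  have "?a\<^sup>2 \<le> ip ?Kg g * ip (kop K ?Kg) ?Kg"
    using psd_Cauchy_Schwarz[OF K g Kg] .
  also have "\<dots> \<le> ip ?Kg g * (lam * ?a)"
    by (intro mult_left_mono lam_ub Kg psd_nonneg[OF K g])
  finally have le: "?a * ?a \<le> (lam * ip ?Kg g) * ?a" by (simp add: power2_eq_square mult_ac)
  show ?thesis
  proof (cases "?a = 0")
    case True
    then show ?thesis using psd_nonneg[OF K g] lam_pos by simp
  next
    case False
    then have "0 < ?a" using inner_self_nonneg[of ?Kg] by linarith
    then show ?thesis using le by simp
  qed
qed

text \<open>
The quantities \<open>\<langle>K\<^sup>n f, f\<rangle>\<close> are called moments. The parity of \<open>n\<close> decides whether symmetry turns them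
into a squared norm or into a value of the quadratic form.
\<close>

lemma moment_even: "f \<in> L2 \<mu> \<Longrightarrow> ip (iter (2 * m) f) f = ip (iter m f) (iter m f)"
  using iter_shift[of f f m m] by (simp add: mult_2)

lemma moment_odd: "f \<in> L2 \<mu> \<Longrightarrow>
    ip (iter (Suc (2 * m)) f) f = ip (kop K (iter m f)) (iter m f)"
  using iter_shift[of f f "Suc m" m] by (simp add: mult_2)

lemma moment_nonneg: "f \<in> L2 \<mu> \<Longrightarrow> 0 \<le> ip (iter n f) f"
  by (cases "even n")
    (auto elim!: evenE oddE simp: moment_even moment_odd psd_nonneg[OF K] iter_L2 simp del: funpow.simps)

lemma moment_Suc_le:
  assumes f: "f \<in> L2 \<mu>"
  shows "ip (iter (Suc n) f) f \<le> lam * ip (iter n f) f"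
proof (cases "even n")
  case True
  then obtain m where m: "n = 2 * m" by auto
  show ?thesis unfolding m moment_even[OF f] moment_odd[OF f]
    by (intro lam_ub iter_L2 f)
next
  case False
  then obtain m where m: "n = Suc (2 * m)" by (auto elim: oddE)
  have "ip (iter (Suc n) f) f = ip (iter (2 * Suc m) f) f" by (simp add: m)
  also have "\<dots> = ip (kop K (iter m f)) (kop K (iter m f))"
    unfolding moment_even[OF f] by simp
  also have "\<dots> \<le> lam * ip (kop K (iter m f)) (iter m f)"
    by (intro norm_op_le iter_L2 f)
  finally show ?thesis unfolding m moment_odd[OF f] .
qed

lemma moment_quotient_convergent:
  assumes f: "f \<in> L2 \<mu>"
  shows "convergent (\<lambda>n. ip (iter n f) f / lam ^ n)"
proof (rule Bseq_monoseq_convergent)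
  have d: "decseq (\<lambda>n. ip (iter n f) f / lam ^ n)"
    unfolding decseq_Suc_iff
  proof
    fix n
    have "ip (iter (Suc n) f) f / lam ^ Suc n \<le> (lam * ip (iter n f) f) / lam ^ Suc n"
      using moment_Suc_le[OF f] lam_pos by (intro divide_right_mono) auto
    then show "ip (iter (Suc n) f) f / lam ^ Suc n \<le> ip (iter n f) f / lam ^ n"
      using lam_pos by simp
  qed
  then show "monoseq (\<lambda>n. ip (iter n f) f / lam ^ n)" by (rule decseq_imp_monoseq)
  show "Bseq (\<lambda>n. ip (iter n f) f / lam ^ n)"
    using d lam_pos by (intro decseq_bounded[of _ 0]) (auto intro!: divide_nonneg_nonneg moment_nonneg f)
qed

text \<open>
By polarization, \<open>\<langle>K\<^sup>n f, g\<rangle> / lam\<^sup>n\<close> converges for all \<open>f\<close> and \<open>g\<close>, since the quotients of moments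
decrease.
\<close>

lemma inner_quotient_convergent:
  assumes f: "f \<in> L2 \<mu>" and g: "g \<in> L2 \<mu>"
  shows "convergent (\<lambda>n. ip (iter n f) g / lam ^ n)"
proof -
  let ?m = "\<lambda>n f. ip (iter n f) f / lam ^ n"
  have sy: "ip (iter n g) f = ip (iter n f) g" for n
    using iter_shift[OF g f, of 0 n] by (simp add: inner_commute)
  have eq: "ip (iter n f) g / lam ^ n = (?m n (\<lambda>x. f x + g x) - ?m n f - ?m n g) / 2" for n
    using f g by (simp add: iter_add inner_add_left inner_add_right iter_L2 L2_add sy add_divide_distrib)
  have fg: "(\<lambda>x. f x + g x) \<in> L2 \<mu>" using f g by auto
  obtain l l1 l2 where "(\<lambda>n. ?m n (\<lambda>x. f x + g x)) \<longlonglongrightarrow> l" "(\<lambda>n. ?m n f) \<longlonglongrightarrow> l1" "(\<lambda>n. ?m n g) \<longlonglongrightarrow> l2"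
    using moment_quotient_convergent[OF f] moment_quotient_convergent[OF g] moment_quotient_convergent[OF fg]
    unfolding convergent_def by blast
  then have "(\<lambda>n. (?m n (\<lambda>x. f x + g x) - ?m n f - ?m n g) / 2) \<longlonglongrightarrow> (l - l1 - l2) / 2"
    by (intro tendsto_intros) auto
  then show ?thesis unfolding eq convergent_def by blast
qed

lemma norm_iter_le:
  assumes f: "f \<in> L2 \<mu>"
  shows "nrm (iter n f) \<le> lam ^ n * nrm f"
proof (induction n)
  case (Suc n)
  let ?g = "iter n f"
  have g: "?g \<in> L2 \<mu>" by (rule iter_L2[OF f])
  have "ip (iter (Suc n) f) (iter (Suc n) f) \<le> lam * ip (kop K ?g) ?g"
    using norm_op_le[OF g] by simp
  also have "\<dots> \<le> lam * (lam * ip ?g ?g)"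
    using lam_ub[OF g] lam_pos by (intro mult_left_mono) auto
  finally have "nrm (iter (Suc n) f) \<le> sqrt (lam * (lam * ip ?g ?g))"
    unfolding L2_norm_def by (rule real_sqrt_le_mono)
  also have "\<dots> = lam * nrm ?g"
    using lam_pos by (simp add: L2_norm_def real_sqrt_mult flip: mult.assoc)
  also have "\<dots> \<le> lam * (lam ^ n * nrm f)"
    using Suc lam_pos by (intro mult_left_mono) auto
  finally show ?case by simp
qed simp

lemma moment_two_power_ge:
  assumes f: "f \<in> L2 \<mu>" and u: "ip f f \<le> 1"
  shows "(ip (kop K f) f) ^ (2 ^ k) \<le> ip (iter (2 ^ k) f) f"
proof (induction k)
  case (Suc k)
  let ?m = "\<lambda>n. ip (iter n f) f"
  have "(ip (kop K f) f) ^ (2 ^ Suc k) = ((ip (kop K f) f) ^ (2 ^ k))\<^sup>2"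
    by (simp add: power_mult[symmetric] mult.commute)
  also have "\<dots> \<le> (?m (2 ^ k))\<^sup>2"
    by (intro power_mono Suc zero_le_power psd_nonneg[OF K f])
  also have "\<dots> \<le> ip (iter (2 ^ k) f) (iter (2 ^ k) f) * ip f f"
    by (intro inner_square_le iter_L2 f)
  also have "\<dots> \<le> ip (iter (2 ^ k) f) (iter (2 ^ k) f)"
    using u by (intro mult_left_le) auto
  also have "\<dots> = ?m (2 ^ Suc k)" using moment_even[OF f, of "2 ^ k"] by simp
  finally show ?case .
qed simp

text \<open>
Since \<open>\<langle>K\<^sup>n K\<^sub>x, K\<^sub>y\<rangle>\<close>, with the slices \<open>K\<^sub>x\<close> and \<open>K\<^sub>y\<close>, is the kernel of \<open>K\<^sup>n\<^sup>+\<^sup>2\<close> at \<open>(x, y)\<close>, this is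
that kernel divided by \<open>lam\<^sup>n\<close>.
\<close>

definition iker :: "nat \<Rightarrow> real \<Rightarrow> real \<Rightarrow> real" where
  "iker n x y = ip (iter n (K x)) (K y) / lam ^ n"

lemma K_slice: "K x \<in> L2 \<mu>"
  using bdd_kernel_slice(1)[OF psd_imp_bdd[OF K]] .

lemma iker_bounded: "\<exists>C. \<forall>n x y. \<bar>iker n x y\<bar> \<le> C"
proof -
  obtain B where B: "\<And>x y. \<bar>K x y\<bar> \<le> B" using psd_imp_bdd[OF K] by (auto simp: bdd_kernel_def)
  define b where "b = sqrt (B\<^sup>2 * mass)"
  have nb: "nrm (K x) \<le> b" for x
  proof -
    have "ip (K x) (K x) \<le> (\<integral>y. B\<^sup>2 \<partial>\<mu>)" unfolding L2_inner_def
      by (intro integral_mono L2_integrable_mult K_slice)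
        (auto simp: power2_eq_square[symmetric] abs_le_square_iff[symmetric] intro: order_trans[OF B])
    then show ?thesis unfolding L2_norm_def b_def by (simp add: mult.commute)
  qed
  have "\<bar>iker n x y\<bar> \<le> b * b" for n x y
  proof -
    have "\<bar>ip (iter n (K x)) (K y)\<bar> \<le> nrm (iter n (K x)) * nrm (K y)"
      by (intro inner_abs_le iter_L2 K_slice)
    also have "\<dots> \<le> (lam ^ n * nrm (K x)) * nrm (K y)"
      by (intro mult_right_mono norm_iter_le K_slice) auto
    also have "\<dots> \<le> (lam ^ n * b) * b"
      using lam_pos order_trans[OF norm_nonneg nb]
      by (intro mult_mono nb) (auto)
    finally show ?thesis unfolding iker_def using lam_pos by (simp add: field_simps)
  qed
  then show ?thesis by blast
qed

lemma iter_slice_measurable: "(\<lambda>(x, y). iter n (K x) y) \<in> borel_measurable (\<mu> \<Otimes>\<^sub>M \<mu>)"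
proof (induction n)
  case 0
  then show ?case using bdd_kernel_measurable[OF psd_imp_bdd[OF K]] by simp
next
  case (Suc n)
  note [measurable] = Suc bdd_kernel_measurable[OF psd_imp_bdd[OF K]]
  have "(\<lambda>(x, y). \<integral>z. K y z * iter n (K x) z \<partial>\<mu>) \<in> borel_measurable (\<mu> \<Otimes>\<^sub>M \<mu>)"
    by measurable
  then show ?case by (simp add: kernel_op_def[of _ _ "(kop K ^^ n) _"])
qed

lemma iker_bdd_kernel: "bdd_kernel (iker n)"
proof -
  note [measurable] = iter_slice_measurable bdd_kernel_measurable[OF psd_imp_bdd[OF K]]
  have "(\<lambda>(x, y). (\<integral>z. iter n (K x) z * K y z \<partial>\<mu>) / lam ^ n) \<in> borel_measurable (\<mu> \<Otimes>\<^sub>M \<mu>)"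
    by measurable
  then have "(\<lambda>(x, y). iker n x y) \<in> borel_measurable (\<mu> \<Otimes>\<^sub>M \<mu>)"
    by (simp add: iker_def L2_inner_def)
  then show ?thesis unfolding bdd_kernel_def using iker_bounded by blast
qed

lemma iker_Suc: "kop K (iker n x) y = lam * iker (Suc n) x y"
proof -
  have "ip (iter (Suc n) (K x)) (K y) = ip (K y) (\<lambda>z. ip (iter n (K x)) (K z))"
  proof -
    have "iter (Suc n) (K x) = (\<lambda>z. ip (iter n (K x)) (K z))"
      by (rule ext) (simp add: kernel_op_eq_inner[of K "iter n (K x)"] inner_commute)
    then show ?thesis by (metis inner_commute)
  qed
  then show ?thesis
    using lam_pos
    unfolding kernel_op_eq_inner[of K "iker n x"] unfolding iker_def[abs_def] by (simp add: inner_divide_right)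
qed

lemma iker_form:
  assumes f: "f \<in> L2 \<mu>"
  shows "ip (kop (iker n) f) f = ip (iter (n + 2) f) f / lam ^ n"
proof -
  have "kop (iker n) f x = iter (n + 2) f x / lam ^ n" for x
  proof -
    have "kop (iker n) f x = ip (\<lambda>y. ip (K y) (iter n (K x))) f / lam ^ n"
      unfolding kernel_op_eq_inner[of "iker n"] unfolding iker_def[abs_def]
      by (simp add: inner_commute[of "K _"] inner_divide_left)
    also have "(\<lambda>y. ip (K y) (iter n (K x))) = iter (Suc n) (K x)"
      by (rule ext) (simp add: kernel_op_eq_inner[of K "iter n (K x)"])
    also have "ip (iter (Suc n) (K x)) f = ip (K x) (iter (Suc n) f)"
      using iter_shift[OF K_slice f, of 0 "Suc n"] by simp
    finally show ?thesis by (simp add: kernel_op_eq_inner)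
  qed
  then have "kop (iker n) f = (\<lambda>x. inverse (lam ^ n) * iter (n + 2) f x)"
    by (auto simp: divide_inverse mult_ac)
  then show ?thesis by (simp add: inner_scale_left divide_inverse mult_ac)
qed

text \<open>
If \<open>lam\<close> is the supremum of the Rayleigh quotients on the unit ball, it is an eigenvalue. The
eigenfunction is a slice of the pointwise limit \<open>H\<close> of the normalised powers of \<open>K\<close>.
\<close>

theorem top_eigenfunction:
  assumes lub: "\<And>r. r < lam \<Longrightarrow> \<exists>f\<in>L2 \<mu>. ip f f \<le> 1 \<and> r < ip (kop K f) f"
  shows "\<exists>h\<in>L2 \<mu>. \<not> (AE x in \<mu>. h x = 0) \<and> (\<forall>x. kop K h x = lam * h x)"
proof -
  obtain C where C: "\<And>n x y. \<bar>iker n x y\<bar> \<le> C" using iker_bounded by blast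
  define H where "H x y = lim (\<lambda>n. iker n x y)" for x y
  have lim: "(\<lambda>n. iker n x y) \<longlonglongrightarrow> H x y" for x y
    using inner_quotient_convergent[OF K_slice K_slice, of x y]
    unfolding H_def iker_def[symmetric] by (simp add: convergent_LIMSEQ_iff)
  have im: "iker n x \<in> borel_measurable \<mu>" for n x
    using bdd_kernel_slice(1)[OF iker_bdd_kernel] by (rule L2_measurable)
  have Hm: "H x \<in> borel_measurable \<mu>" for x
    by (rule borel_measurable_LIMSEQ_real[OF lim im])
  have HC: "\<bar>H x y\<bar> \<le> C" for x y
    using C by (intro LIMSEQ_le_const2[OF tendsto_rabs[OF lim]]) auto
  have HL2: "H x \<in> L2 \<mu>" for x using L2_bounded[OF Hm HC] .
  have eig: "kop K (H x) y = lam * H x y" for x y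
  proof -
    have "(\<lambda>n. kop K (iker n x) y) \<longlonglongrightarrow> kop K (H x) y"
      unfolding kernel_op_def
    proof (rule integral_dominated_convergence)
      show "integrable \<mu> (\<lambda>z. C * \<bar>K y z\<bar>)"
        using L2_integrable[OF K_slice] by auto
      show "AE z in \<mu>. (\<lambda>n. K y z * iker n x z) \<longlonglongrightarrow> K y z * H x z"
        by (intro AE_I2 tendsto_intros lim)
      show "AE z in \<mu>. norm (K y z * iker n x z) \<le> C * \<bar>K y z\<bar>" for n
        using mult_right_mono[OF C abs_ge_zero] by (auto simp: abs_mult mult.commute)
    qed (use L2_measurable[OF K_slice] im Hm in auto)
    moreover have "(\<lambda>n. kop K (iker n x) y) \<longlonglongrightarrow> lam * H x y"
      unfolding iker_Suc by (intro tendsto_intros LIMSEQ_Suc lim)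
    ultimately show ?thesis by (rule LIMSEQ_unique)
  qed
  \<comment> \<open>If all slices of \<open>H\<close> vanished, the Hilbert--Schmidt norms of the normalised powers would tend
    to zero, although \<open>\<langle>K\<^sup>N f, f\<rangle>\<close>, which they bound, is at least \<open>\<langle>K f, f\<rangle>\<^sup>N\<close> for \<open>N\<close> a power of two.\<close>
  have "\<exists>x. \<not> (AE y in \<mu>. H x y = 0)"
  proof (rule ccontr)
    assume "\<not> ?thesis"
    then have z: "AE y in \<mu>. H x y = 0" for x by simp
    have H0: "H x y = 0" for x y
    proof -
      have "kop K (H x) y = ip (K y) (\<lambda>_. 0)"
        unfolding kernel_op_eq_inner using z by (intro inner_cong_AE_right HL2 K_slice L2_const) auto
      then have "kop K (H x) y = 0" by (simp add: L2_inner_def)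
      then show ?thesis using eig[of x y] lam_pos by simp
    qed
    have "(\<lambda>n. \<integral>z. (case z of (x, y) \<Rightarrow> (iker n x y)\<^sup>2) \<partial>(\<mu> \<Otimes>\<^sub>M \<mu>)) \<longlonglongrightarrow> (\<integral>z. 0 \<partial>(\<mu> \<Otimes>\<^sub>M \<mu>))"
    proof (rule integral_dominated_convergence)
      show "integrable (\<mu> \<Otimes>\<^sub>M \<mu>) (\<lambda>z. C\<^sup>2)"
      proof -
        have "(\<lambda>z::real \<times> real. C\<^sup>2) = (\<lambda>(x, y). C\<^sup>2)" by auto
        then show ?thesis using bdd_kernel_prod_integrable[OF bdd_kernel_const[of "C\<^sup>2"]] by (simp only:)
      qed
      show "AE z in \<mu> \<Otimes>\<^sub>M \<mu>. (\<lambda>n. case z of (x, y) \<Rightarrow> (iker n x y)\<^sup>2) \<longlonglongrightarrow> 0"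
      proof (rule AE_I2)
        fix z :: "real \<times> real"
        show "(\<lambda>n. case z of (x, y) \<Rightarrow> (iker n x y)\<^sup>2) \<longlonglongrightarrow> 0"
          using tendsto_power[OF lim[of "fst z" "snd z"], of 2] by (simp add: H0 case_prod_beta)
      qed
      show "AE z in \<mu> \<Otimes>\<^sub>M \<mu>. norm (case z of (x, y) \<Rightarrow> (iker n x y)\<^sup>2) \<le> C\<^sup>2" for n
      proof (rule AE_I2)
        fix z :: "real \<times> real"
        have "\<bar>iker n (fst z) (snd z)\<bar>\<^sup>2 \<le> C\<^sup>2" by (intro power_mono C) auto
        then show "norm (case z of (x, y) \<Rightarrow> (iker n x y)\<^sup>2) \<le> C\<^sup>2" by (simp add: case_prod_beta)
      qed
      show "(\<lambda>z. case z of (x, y) \<Rightarrow> (iker n x y)\<^sup>2) \<in> borel_measurable (\<mu> \<Otimes>\<^sub>M \<mu>)" for n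
        using bdd_kernel_measurable[OF iker_bdd_kernel[of n]] by measurable
    qed auto
    then have "(\<lambda>n. hs_norm (iker n)) \<longlonglongrightarrow> sqrt 0"
      unfolding hs_norm_def by (intro tendsto_real_sqrt) simp
    then have "eventually (\<lambda>n. hs_norm (iker n) < lam\<^sup>2) sequentially"
      using lam_pos by (intro order_tendstoD(2)[of _ "sqrt 0"]) auto
    then obtain n0 where n0: "\<And>n. n \<ge> n0 \<Longrightarrow> hs_norm (iker n) < lam\<^sup>2"
      unfolding eventually_sequentially by blast
    \<comment> \<open>A power of two, as required by \<open>moment_two_power_ge\<close>.\<close>
    define N where "N = (2::nat) ^ (n0 + 2)"
    have "n0 + 2 < N" unfolding N_def by (rule less_exp)
    then obtain n where n: "N = n + 2" "n \<ge> n0" by (metis add_diff_inverse_nat add.commute add_le_cancel_right le_add2 less_imp_le_nat not_less order_trans)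
    define c where "c = hs_norm (iker n) * lam ^ n"
    have c0: "0 \<le> c" unfolding c_def using lam_pos by simp
    have "c < lam\<^sup>2 * lam ^ n" unfolding c_def using n0[OF n(2)] lam_pos by simp
    then have c1: "c < lam ^ N" by (simp only: n power_add mult.commute)
    have N0: "N > 0" unfolding N_def by simp
    have r: "root N c < lam"
      using real_root_less_mono[OF N0 c1] lam_pos N0 by (simp add: real_root_power_cancel)
    obtain f where f: "f \<in> L2 \<mu>" "ip f f \<le> 1" "root N c < ip (kop K f) f"
      using lub[OF r] by blast
    have "c = root N c ^ N" using N0 c0 by simp
    also have "\<dots> < (ip (kop K f) f) ^ N"
      using f(3) N0 c0 by (intro power_strict_mono) auto
    also have "\<dots> \<le> ip (iter N f) f"
      unfolding N_def by (rule moment_two_power_ge[OF f(1,2)])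
    also have "\<dots> = ip (kop (iker n) f) f * lam ^ n"
      using iker_form[OF f(1), of n] lam_pos by (simp add: n)
    also have "\<dots> \<le> (hs_norm (iker n) * nrm f * nrm f) * lam ^ n"
      using kernel_form_le_hs_norm[OF iker_bdd_kernel f(1) f(1), of n] lam_pos
      by (intro mult_right_mono) auto
    also have "\<dots> \<le> c"
    proof -
      have "hs_norm (iker n) * (nrm f * nrm f) \<le> hs_norm (iker n)"
        using f(2) by (intro mult_left_le) (auto simp: norm_sq[unfolded power2_eq_square])
      then show ?thesis unfolding c_def using lam_pos by (intro mult_right_mono) (auto simp: mult.assoc)
    qed
    finally show False by simp
  qed
  then show ?thesis using HL2 eig by blast
qed

end

end

section \<open>A maximum principle for eigenvalues\<close>

lemma homogeneous_system_nontrivial: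
  fixes A :: "nat \<Rightarrow> 'i \<Rightarrow> real"
  assumes "finite I" "n < card I"
  shows "\<exists>c. (\<exists>i\<in>I. c i \<noteq> 0) \<and> (\<forall>l<n. (\<Sum>i\<in>I. A l i * c i) = 0)"
  using assms
proof (induction n arbitrary: I A)
  case 0
  then have "I \<noteq> {}" by auto
  then show ?case by (intro exI[of _ "\<lambda>_. 1"]) auto
next
  case (Suc n)
  show ?case
  proof (cases "\<forall>i\<in>I. A n i = 0")
    case True
    obtain c where "\<exists>i\<in>I. c i \<noteq> 0" "\<forall>l<n. (\<Sum>i\<in>I. A l i * c i) = 0"
      using Suc.IH[of I A] Suc.prems by auto
    then show ?thesis using True by (intro exI[of _ c]) (auto simp: less_Suc_eq)
  next
    case False
    then obtain p where p: "p \<in> I" "A n p \<noteq> 0" by auto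
    let ?I = "I - {p}"
    obtain c where c: "\<exists>i\<in>?I. c i \<noteq> 0" "\<And>l. l < n \<Longrightarrow> (\<Sum>i\<in>?I. (A l i - A l p * A n i / A n p) * c i) = 0"
    proof -
      have "finite ?I" "n < card ?I" using Suc.prems p by auto
      from Suc.IH[OF this, of "\<lambda>l i. A l i - A l p * A n i / A n p"] show ?thesis using that by blast
    qed
    define d where "d = c(p := - (\<Sum>i\<in>?I. A n i * c i) / A n p)"
    have s: "(\<Sum>i\<in>I. A l i * d i) = (\<Sum>i\<in>?I. A l i * c i) - A l p * (\<Sum>i\<in>?I. A n i * c i) / A n p" for l
      using p Suc.prems unfolding d_def by (subst sum.remove[of _ p]) auto
    have "(\<Sum>i\<in>I. A l i * d i) = 0" if "l < Suc n" for l
    proof (cases "l = n")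
      case True
      then show ?thesis using s p by simp
    next
      case False
      then have "l < n" using that by simp
      then show ?thesis using c(2)[of l] unfolding s
        by (simp add: left_diff_distrib right_diff_distrib sum_subtractf sum_distrib_left sum_divide_distrib mult_ac)
    qed
    moreover have "\<exists>i\<in>I. d i \<noteq> 0" using c(1) unfolding d_def by auto
    ultimately show ?thesis by blast
  qed
qed

context L2_space
begin

context
  fixes K :: "real \<Rightarrow> real \<Rightarrow> real" and th :: "nat \<Rightarrow> real" and ps :: "nat \<Rightarrow> real \<Rightarrow> real"
  assumes K: "psd_kernel K" and es: "eigensystem \<mu> K th ps"
begin

lemma eigen_dec: "i \<le> j \<Longrightarrow> th j \<le> th i"
  using es unfolding eigensystem_def by (auto dest: decseqD)

lemma eigen_L2 [simp]: "ps i \<in> L2 \<mu>"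
  using es unfolding eigensystem_def by auto

lemma eigen_orth: "ip (ps i) (ps j) = (if i = j then 1 else 0)"
  using es unfolding eigensystem_def by auto

lemma eigen_AE: "AE x in \<mu>. kop K (ps j) x = th j * ps j x"
  using es unfolding eigensystem_def by auto

lemma eigen_complete:
  assumes "c \<noteq> 0" "f \<in> L2 \<mu>" "AE x in \<mu>. kop K f x = c * f x"
  shows "\<exists>J a. finite J \<and> (\<forall>j\<in>J. th j = c) \<and> (AE x in \<mu>. f x = (\<Sum>j\<in>J. a j * ps j x))"
proof -
  have "\<forall>c. \<forall>f\<in>L2 \<mu>. c \<noteq> 0 \<longrightarrow> (AE x in \<mu>. kop K f x = c * f x) \<longrightarrow>
        (\<exists>J a. finite J \<and> (\<forall>j\<in>J. th j = c) \<and> (AE x in \<mu>. f x = (\<Sum>j\<in>J. a j * ps j x)))"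
    using es unfolding eigensystem_def by (elim conjE) assumption
  then show ?thesis using assms by simp
qed

lemma eigen_op: "g \<in> L2 \<mu> \<Longrightarrow> ip (kop K (ps j)) g = th j * ip (ps j) g"
  using inner_cong_AE_left[OF _ _ _ eigen_AE] psd_imp_bdd[OF K]
  by (metis L2_scale eigen_L2 inner_scale_left kernel_op_L2)

lemma eigen_op': "g \<in> L2 \<mu> \<Longrightarrow> ip (kop K g) (ps j) = th j * ip (ps j) g"
  using eigen_op[of g j] inner_kernel_op_sym[OF K, of g "ps j"] by (simp add: inner_commute)

lemma eigen_nonneg: "0 \<le> th j"
  using psd_nonneg[OF K eigen_L2, of j] eigen_op[of "ps j" j] by (simp add: eigen_orth)

lemma inner_eigen_sum:
  "finite I \<Longrightarrow> ip (ps l) (\<lambda>x. \<Sum>i\<in>I. a i * ps i x) = (if l \<in> I then a l else 0)"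
  by (simp add: inner_sum_right L2_scale inner_scale_right eigen_orth if_distrib cong: if_cong)

lemma inner_eigen_sum':
  "g \<in> L2 \<mu> \<Longrightarrow> ip (\<lambda>x. \<Sum>i\<in>I. a i * ps i x) g = (\<Sum>i\<in>I. a i * ip (ps i) g)"
  by (simp add: inner_sum_left L2_scale inner_scale_left)

lemma op_eigen_sum:
  "g \<in> L2 \<mu> \<Longrightarrow> ip (kop K (\<lambda>x. \<Sum>i\<in>I. a i * ps i x)) g
     = (\<Sum>i\<in>I. a i * th i * ip (ps i) g)"
  using psd_imp_bdd[OF K]
  by (simp add: kernel_op_sum L2_scale kernel_op_scale inner_sum_left kernel_op_L2 inner_scale_left eigen_op mult.assoc)

text \<open>
The half of the minimax principle that needs completeness of the eigensystem: on the orthogonal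
complement of the first \<open>j\<close> eigenfunctions the Rayleigh quotient is at most the eigenvalue with
index \<open>j\<close>.
\<close>

theorem rayleigh_le:
  assumes f: "f \<in> L2 \<mu>" and orth: "\<And>i. i < j \<Longrightarrow> ip (ps i) f = 0"
  shows "ip (kop K f) f \<le> th j * ip f f"
proof -
  note b = psd_imp_bdd[OF K]
  \<comment> \<open>A bounded representative of the eigenfunction, which makes the deflated kernel bounded. It is
    identically zero if the eigenvalue is zero, and then it does not occur in the deflated kernel.\<close>
  define ph where "ph i x = kop K (ps i) x / th i" for i x
  have kL: "kop K (ps i) \<in> L2 \<mu>" for i using b by auto
  have phL: "ph i \<in> L2 \<mu>" for i
    using L2_scale[OF kL, of "inverse (th i)" i] by (simp add: ph_def[abs_def] divide_inverse mult.commute)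
  have phb: "\<exists>C. \<forall>x. \<bar>ph i x\<bar> \<le> C" for i
  proof -
    obtain C where "\<And>x. \<bar>kop K (ps i) x\<bar> \<le> C" using kernel_op_bounded[OF b eigen_L2] by blast
    then have "\<bar>ph i x\<bar> \<le> C / \<bar>th i\<bar>" for x unfolding ph_def abs_divide by (intro divide_right_mono) auto
    then show ?thesis by blast
  qed
  have ph_inner: "th i * ip (ph i) g = th i * ip (ps i) g" if "g \<in> L2 \<mu>" for i g
    using eigen_op[OF that, of i] by (simp add: ph_def[abs_def] inner_divide_left)
  define K' where "K' x y = K x y - (\<Sum>i<j. (th i * ph i x) * ph i y)" for x y
  have bs: "bdd_kernel (\<lambda>x y. (th i * ph i x) * ph i y)" for i
  proof (rule bdd_kernel_tensor)
    obtain C where "\<And>x. \<bar>ph i x\<bar> \<le> C" using phb by blast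
    then have "\<bar>th i * ph i x\<bar> \<le> \<bar>th i\<bar> * C" for x unfolding abs_mult by (intro mult_left_mono) auto
    then show "\<exists>C. \<forall>x. \<bar>th i * ph i x\<bar> \<le> C" by blast
  qed (use phb L2_measurable[OF phL] L2_measurable[OF L2_scale[OF phL]] in auto)
  have b': "bdd_kernel K'" unfolding K'_def[abs_def]
    by (intro bdd_kernel_diff b bdd_kernel_sum bs)
  have op': "kop K' g x = kop K g x - (\<Sum>i<j. (th i * ip (ps i) g) * ph i x)"
    if g: "g \<in> L2 \<mu>" for g x
  proof -
    have "kop K' g x = ip (K x) g - (\<Sum>i<j. th i * ph i x * ip (ph i) g)"
      unfolding kernel_op_eq_inner K'_def[abs_def]
      using g phL bdd_kernel_slice(1)[OF b]
      by (simp add: inner_diff_left inner_sum_left inner_scale_left L2_sum L2_scale)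
    also have "\<dots> = kop K g x - (\<Sum>i<j. (th i * ip (ps i) g) * ph i x)"
    proof -
      have "th i * ph i x * ip (ph i) g = th i * ip (ps i) g * ph i x" for i
        using arg_cong[OF ph_inner[OF g, of i], of "\<lambda>r. r * ph i x"] by (simp only: mult_ac)
      then show ?thesis unfolding kernel_op_eq_inner by (simp only:)
    qed
    finally show ?thesis .
  qed
  have form': "ip (kop K' g) h = ip (kop K g) h
      - (\<Sum>i<j. th i * ip (ps i) g * ip (ps i) h)"
    if g: "g \<in> L2 \<mu>" and h: "h \<in> L2 \<mu>" for g h
  proof -
    have "ip (kop K' g) h = ip (kop K g) h
      - (\<Sum>i<j. th i * ip (ps i) g * ip (ph i) h)"
      unfolding op'[OF g, abs_def] using g h phL b
      by (simp add: inner_diff_left inner_sum_left inner_scale_left L2_sum L2_scale kernel_op_L2)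
    moreover have "th i * ip (ps i) g * ip (ph i) h
        = th i * ip (ps i) g * ip (ps i) h" for i
      using arg_cong[OF ph_inner[OF h, of i], of "\<lambda>r. ip (ps i) g * r"] by (simp only: mult_ac)
    ultimately show ?thesis by (simp only:)
  qed
  have psd': "psd_kernel K'" unfolding psd_kernel_def
  proof (intro conjI ballI allI b')
    fix x y show "K' x y = K' y x" unfolding K'_def using psd_sym[OF K] by (simp add: mult_ac)
  next
    fix g assume g: "g \<in> L2 \<mu>"
    \<comment> \<open>The form of the deflated kernel at \<open>g\<close> is that of \<open>K\<close> at the component of \<open>g\<close> orthogonal to
      the first \<open>j\<close> eigenfunctions.\<close>
    define p where "p = (\<lambda>x. \<Sum>i<j. ip (ps i) g * ps i x)"
    have p: "p \<in> L2 \<mu>" unfolding p_def by (intro L2_sum L2_scale eigen_L2)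
    have pi: "ip (ps i) p = ip (ps i) g" if "i < j" for i
      unfolding p_def using that inner_eigen_sum[of "{..<j}" i "\<lambda>i. ip (ps i) g"] by simp
    have 1: "ip (kop K p) g = (\<Sum>i<j. th i * ip (ps i) g * ip (ps i) g)"
      unfolding p_def op_eigen_sum[OF g] by (simp add: mult_ac)
    have 2: "ip (kop K p) p = (\<Sum>i<j. th i * ip (ps i) g * ip (ps i) g)"
      using op_eigen_sum[OF p, of "\<lambda>i. ip (ps i) g" "{..<j}"] pi
      unfolding p_def[symmetric] by (simp add: mult_ac)
    have 3: "ip (kop K g) p = ip (kop K p) g"
      using inner_kernel_op_sym[OF K g p] by (simp add: inner_commute)
    have "0 \<le> ip (kop K (\<lambda>x. g x - p x)) (\<lambda>x. g x - p x)"
      using g p by (intro psd_nonneg[OF K]) auto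
    also have "\<dots> = ip (kop K' g) g"
      using g p b by (simp add: kernel_op_diff inner_diff_left inner_diff_right L2_diff kernel_op_L2 form'[OF g g] 1 2 3)
    finally show "0 \<le> ip (kop K' g) g" .
  qed
  define S where "S = {ip (kop K' g) g | g. g \<in> L2 \<mu> \<and> ip g g \<le> 1}"
  define lam where "lam = Sup S"
  have ub: "s \<le> hs_norm K'" if sS: "s \<in> S" for s
  proof -
    obtain g where g: "g \<in> L2 \<mu>" "ip g g \<le> 1" "s = ip (kop K' g) g"
      using sS unfolding S_def by blast
    have "s \<le> hs_norm K' * nrm g * nrm g"
      unfolding g(3) using kernel_form_le_hs_norm[OF b' g(1) g(1)] by linarith
    also have "\<dots> = hs_norm K' * ip g g" by (simp add: norm_sq[unfolded power2_eq_square] mult.assoc)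
    also have "\<dots> \<le> hs_norm K'" using g(2) by (intro mult_left_le) auto
    finally show ?thesis .
  qed
  have bdd: "bdd_above S" using ub by (rule bdd_aboveI)
  have 0: "0 \<in> S" unfolding S_def
    by (auto intro!: exI[of _ "\<lambda>_. 0"] simp: L2_inner_def)
  have lam0: "0 \<le> lam" unfolding lam_def by (rule cSup_upper[OF 0 bdd])
  have lam_ub: "ip (kop K' g) g \<le> lam * ip g g" if g: "g \<in> L2 \<mu>" for g
  proof (cases "ip g g = 0")
    case True
    then have "nrm g = 0" by (simp add: L2_norm_def)
    then show ?thesis using kernel_form_le_hs_norm[OF b' g g] True by simp
  next
    case False
    define c where "c = nrm g"
    have c: "0 < c" "c\<^sup>2 = ip g g" using False norm_nonneg[of g] norm_sq[of g]
      unfolding c_def by (auto simp: less_le)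
    have "ip (kop K' (\<lambda>x. inverse c * g x)) (\<lambda>x. inverse c * g x) \<in> S"
    proof -
      have "ip (\<lambda>x. inverse c * g x) (\<lambda>x. inverse c * g x) = 1"
        unfolding inner_scale_left inner_scale_right c(2)[symmetric] using c(1) by (simp add: power2_eq_square field_simps)
      then show ?thesis unfolding S_def using L2_scale[OF g, of "inverse c"] by fastforce
    qed
    then have "ip (kop K' (\<lambda>x. inverse c * g x)) (\<lambda>x. inverse c * g x) \<le> lam"
      unfolding lam_def by (rule cSup_upper[OF _ bdd])
    then have "inverse c * (inverse c * ip (kop K' g) g) \<le> lam"
      by (simp add: kernel_op_scale inner_scale_left inner_scale_right)
    then have "ip (kop K' g) g \<le> lam * c\<^sup>2"
      using c(1) by (simp add: field_simps power2_eq_square)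
    then show ?thesis by (simp add: c)
  qed
  have fK': "ip (kop K f) f = ip (kop K' f) f"
    using form'[OF f f] orth by simp
  show ?thesis
  proof (cases "lam = 0")
    case True
    then have "ip (kop K f) f \<le> 0" using lam_ub[OF f] fK' by simp
    also have "0 \<le> th j * ip f f" using eigen_nonneg by simp
    finally show ?thesis .
  next
    case False
    then have lp: "0 < lam" using lam0 by simp
    have "\<exists>g\<in>L2 \<mu>. ip g g \<le> 1 \<and> r < ip (kop K' g) g" if "r < lam" for r
      using less_cSupD[of S r] 0 that unfolding lam_def S_def by auto
    then obtain h where h: "h \<in> L2 \<mu>" "\<not> (AE x in \<mu>. h x = 0)" and eh: "\<And>x. kop K' h x = lam * h x"
      using top_eigenfunction[OF psd' lp lam_ub] by blast
    have orth_h: "ip (ps l) h = 0" if l: "l < j" for l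
    proof -
      have "lam * ip (ps l) h = ip (kop K' h) (ps l)"
      proof -
        have "kop K' h = (\<lambda>x. lam * h x)" using eh by auto
        then show ?thesis by (simp only: inner_scale_left) (simp only: inner_commute)
      qed
      also have "\<dots> = th l * ip (ps l) h - (\<Sum>i<j. th i * ip (ps i) h * (if i = l then 1 else 0))"
        unfolding form'[OF h(1) eigen_L2] eigen_op'[OF h(1)] eigen_orth ..
      also have "\<dots> = 0" using l by (simp add: if_distrib cong: if_cong)
      finally show ?thesis using lp by simp
    qed
    have eK: "AE x in \<mu>. kop K h x = lam * h x"
      using op'[OF h(1)] orth_h eh by auto
    have "lam \<noteq> 0" using lp by simp
    then obtain J a where J: "finite J" "\<forall>i\<in>J. th i = lam" and ha: "AE x in \<mu>. h x = (\<Sum>i\<in>J. a i * ps i x)"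
      using eigen_complete[OF _ h(1) eK] by blast
    \<comment> \<open>The eigenfunction of the deflated kernel is orthogonal to the first \<open>j\<close> eigenfunctions, so
      its expansion must involve a later one.\<close>
    have "\<exists>i\<in>J. j \<le> i"
    proof (rule ccontr)
      assume n: "\<not> ?thesis"
      have "a i = 0" if "i \<in> J" for i
      proof -
        have "ip (ps i) h = ip (ps i) (\<lambda>x. \<Sum>i\<in>J. a i * ps i x)"
          using h(1) ha by (intro inner_cong_AE_right L2_sum L2_scale eigen_L2)
        then show ?thesis using orth_h[of i] n that J by (auto simp: inner_eigen_sum not_le)
      qed
      then have "AE x in \<mu>. h x = 0" using ha by simp
      then show False using h(2) by simp
    qed
    then have "lam \<le> th j" using J(2) eigen_dec by auto
    then have "lam * ip f f \<le> th j * ip f f" by (intro mult_right_mono) auto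
    then show ?thesis using lam_ub[OF f] fK' by simp
  qed
qed

lemma op_AE_zero:
  assumes f: "f \<in> L2 \<mu>" and orth: "\<And>i. i < j \<Longrightarrow> ip (ps i) f = 0" and "th j = 0"
  shows "AE x in \<mu>. kop K f x = 0"
proof -
  have k: "kop K f \<in> L2 \<mu>" using f psd_imp_bdd[OF K] by auto
  have "ip (kop K f) f = 0"
    using rayleigh_le[OF f orth, where j=j] psd_nonneg[OF K f] assms(3) by simp
  then have "(ip (kop K f) (kop K f))\<^sup>2 \<le> 0"
    using psd_Cauchy_Schwarz[OF K f k] by simp
  then show ?thesis using inner_self_zero_iff[OF k] by simp
qed

end

context
  fixes K K' :: "real \<Rightarrow> real \<Rightarrow> real" and th th' :: "nat \<Rightarrow> real" and ps ps' :: "nat \<Rightarrow> real \<Rightarrow> real"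
    and D :: real
  assumes K: "psd_kernel K" and es: "eigensystem \<mu> K th ps"
    and K': "psd_kernel K'" and es': "eigensystem \<mu> K' th' ps'"
    and D: "\<And>f g. f \<in> L2 \<mu> \<Longrightarrow> g \<in> L2 \<mu> \<Longrightarrow>
      \<bar>ip (kop K' f) g - ip (kop K f) g\<bar> \<le> D * nrm f * nrm g"
begin

section \<open>Perturbation of eigenvalues and eigenfunctions\<close>

text \<open>
Weyl's inequality: compare the two quadratic forms at a nonzero combination of the first \<open>j + 1\<close>
eigenfunctions of \<open>K'\<close> that is orthogonal to the first \<open>j\<close> eigenfunctions of \<open>K\<close>.
\<close>

lemma Weyl_le: "th' j \<le> th j + D"
proof -
  note L [simp] = eigen_L2[OF K es] eigen_L2[OF K' es']
  obtain c where c: "\<exists>i\<in>{..j}. c i \<noteq> 0" "\<And>l. l < j \<Longrightarrow> (\<Sum>i\<in>{..j}. ip (ps l) (ps' i) * c i) = 0"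
    using homogeneous_system_nontrivial[of "{..j}" j "\<lambda>l i. ip (ps l) (ps' i)"] by auto
  define v where "v = (\<lambda>x. \<Sum>i\<le>j. c i * ps' i x)"
  have v: "v \<in> L2 \<mu>" unfolding v_def by (intro L2_sum L2_scale L)
  have o: "ip (ps l) v = 0" if "l < j" for l
    using c(2)[OF that] unfolding v_def by (simp add: inner_sum_right L2_scale inner_scale_right mult.commute)
  have vi: "ip (ps' i) v = c i" if "i \<le> j" for i
    unfolding v_def using inner_eigen_sum[OF K' es', of "{..j}" i c] that by simp
  have vv: "ip v v = (\<Sum>i\<le>j. (c i)\<^sup>2)"
    using inner_eigen_sum'[OF K' es' v, of c "{..j}"] vi unfolding v_def[symmetric]
    by (simp add: power2_eq_square)
  have K'v: "ip (kop K' v) v = (\<Sum>i\<le>j. th' i * (c i)\<^sup>2)"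
    using op_eigen_sum[OF K' es' v, of c "{..j}"] vi unfolding v_def[symmetric]
    by (simp add: power2_eq_square mult_ac)
  have pos: "0 < ip v v"
    unfolding vv using c(1) by (auto intro!: sum_pos2)
  have "th' j * ip v v \<le> ip (kop K' v) v"
    unfolding K'v vv sum_distrib_left
    by (intro sum_mono mult_right_mono) (auto intro: eigen_dec[OF K' es'])
  also have "\<dots> \<le> ip (kop K v) v + D * ip v v"
    using D[OF v v] by (simp add: norm_sq[unfolded power2_eq_square] mult.assoc)
  also have "\<dots> \<le> th j * ip v v + D * ip v v"
    using rayleigh_le[OF K es v o] by simp
  finally have "th' j * ip v v \<le> (th j + D) * ip v v" by (simp add: distrib_right)
  then show ?thesis using pos by simp
qed

end

context
  fixes K K' :: "real \<Rightarrow> real \<Rightarrow> real" and th th' :: "nat \<Rightarrow> real" and ps ps' :: "nat \<Rightarrow> real \<Rightarrow> real"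
    and D :: real
  assumes K: "psd_kernel K" and es: "eigensystem \<mu> K th ps"
    and K': "psd_kernel K'" and es': "eigensystem \<mu> K' th' ps'"
    and D: "\<And>f g. f \<in> L2 \<mu> \<Longrightarrow> g \<in> L2 \<mu> \<Longrightarrow>
      \<bar>ip (kop K' f) g - ip (kop K f) g\<bar> \<le> D * nrm f * nrm g"
begin

lemma Weyl: "\<bar>th' j - th j\<bar> \<le> D"
  using Weyl_le[OF K es K' es' D, of j] Weyl_le[OF K' es' K es, of D j] D
  by (simp add: abs_minus_commute)

lemma eigen_norm: "nrm (ps i) = 1" "nrm (ps' i) = 1"
  unfolding L2_norm_def eigen_orth[OF K es] eigen_orth[OF K' es'] by auto

text \<open>
Let \<open>u\<close> be the component of \<open>ps' j\<close> in the span of the eigenfunctions of \<open>K\<close> with index below \<open>j\<close>, and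
\<open>v\<close> the component orthogonal to those with index at most \<open>j\<close>. The form of \<open>K - th j\<close> is at least
\<open>dl\<close> on the former and at most \<open>-dl\<close> on the latter, so pairing \<open>(K - th j) (ps' j)\<close>, which has size
at most \<open>2 D\<close>, with \<open>u - v\<close> bounds the distance of \<open>ps' j\<close> from the line spanned by \<open>ps j\<close>. The sign
condition turns this into a bound on the distance from \<open>ps j\<close> itself.
\<close>

lemma eigenfunction_perturbation:
  assumes dl: "0 < dl" and gap1: "\<And>i. i < j \<Longrightarrow> dl \<le> th i - th j" and gap2: "dl \<le> th j - th (Suc j)"
    and sgn: "0 \<le> ip (ps j) (ps' j)"
  shows "nrm (\<lambda>x. ps' j x - ps j x) \<le> 3 * D / dl"
proof -
  note L [simp] = eigen_L2[OF K es] eigen_L2[OF K' es']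
  let ?p = "ps' j"
  \<comment> \<open>The function \<open>v\<close> is orthogonal to all eigenfunctions with index at most \<open>j\<close>, hence the sum up
    to and including \<open>j\<close> in \<open>s\<close>.\<close>
  define a where "a i = ip (ps i) ?p" for i
  define u where "u = (\<lambda>x. \<Sum>i<j. a i * ps i x)"
  define s where "s = (\<lambda>x. \<Sum>i\<le>j. a i * ps i x)"
  define v where "v = (\<lambda>x. ?p x - s x)"
  define g where "g = (\<lambda>x. u x - v x)"
  have u: "u \<in> L2 \<mu>" unfolding u_def by (intro L2_sum L2_scale L)
  have s: "s \<in> L2 \<mu>" unfolding s_def by (intro L2_sum L2_scale L)
  have v: "v \<in> L2 \<mu>" unfolding v_def by (intro L2_diff L s)
  have g: "g \<in> L2 \<mu>" unfolding g_def by (intro L2_diff u v)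
  note b = psd_imp_bdd[OF K]
  have pv: "ip (ps i) v = 0" if "i \<le> j" for i
  proof -
    have "ip (ps i) s = a i"
      unfolding s_def using that inner_eigen_sum[OF K es, of "{..j}" i a] by simp
    then show ?thesis unfolding v_def using s by (simp add: inner_diff_right a_def)
  qed
  have sv: "ip s v = 0"
    unfolding s_def inner_eigen_sum'[OF K es v] using pv by simp
  have uv: "ip u v = 0"
    unfolding u_def inner_eigen_sum'[OF K es v] using pv by simp
  have p_eq: "?p = (\<lambda>x. s x + v x)" unfolding v_def by auto
  have p_v: "ip ?p v = ip v v"
    by (subst p_eq) (simp add: inner_add_left s v sv)
  define S where "S = (\<Sum>i<j. (a i)\<^sup>2)"
  have uu: "ip u u = S"
  proof -
    have "ip u u = (\<Sum>i<j. a i * ip (ps i) u)"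
      using inner_eigen_sum'[OF K es u, of a "{..<j}"] unfolding u_def[symmetric] .
    also have "\<dots> = S" unfolding S_def u_def by (intro sum.cong)
      (auto simp: inner_eigen_sum[OF K es] power2_eq_square)
    finally show ?thesis .
  qed
  have p_u: "ip ?p u = S"
    using inner_eigen_sum'[OF K es, of ?p a "{..<j}"] unfolding u_def[symmetric] S_def
    by (simp add: inner_commute[of ?p] a_def power2_eq_square)
  have Kp_u: "ip (kop K ?p) u = (\<Sum>i<j. th i * (a i)\<^sup>2)"
  proof -
    have "ip (kop K ?p) u = ip (kop K u) ?p"
      using inner_kernel_op_sym[OF K _ u, of ?p] by (simp add: inner_commute)
    also have "\<dots> = (\<Sum>i<j. th i * (a i)\<^sup>2)"
      unfolding u_def using op_eigen_sum[OF K es, of ?p a "{..<j}"]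
      by (simp add: a_def power2_eq_square mult_ac)
    finally show ?thesis .
  qed
  have Ks_v: "ip (kop K s) v = 0"
    unfolding s_def using op_eigen_sum[OF K es v, of a "{..j}"] pv by simp
  have Kp_v: "ip (kop K ?p) v = ip (kop K v) v"
    by (subst p_eq) (simp add: kernel_op_add[OF b] s v inner_add_left kernel_op_L2[OF b] Ks_v)
  define q where "q = ip v v"
  have Kvv: "ip (kop K v) v \<le> th (Suc j) * q"
    unfolding q_def using pv by (intro rayleigh_le[OF K es v]) auto
  have q0: "0 \<le> q" unfolding q_def by simp
  have gg: "ip g g = S + q"
    unfolding g_def q_def using u v uv by (simp add: inner_diff_left inner_diff_right L2_diff uu inner_commute[of v u])
  define N where "N = nrm g"
  have N: "N\<^sup>2 = S + q" "0 \<le> N" unfolding N_def norm_sq gg by auto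
  have pg: "ip ?p g = S - q"
    unfolding g_def using u v by (simp add: inner_diff_right p_u p_v q_def)
  have Kp_g: "ip (kop K ?p) g = (\<Sum>i<j. th i * (a i)\<^sup>2) - ip (kop K v) v"
    unfolding g_def using u v by (simp add: inner_diff_right kernel_op_L2[OF b] Kp_u Kp_v)
  have "dl * N\<^sup>2 = (\<Sum>i<j. dl * (a i)\<^sup>2) + dl * q"
    unfolding N S_def by (simp add: distrib_left sum_distrib_left)
  also have "\<dots> \<le> (\<Sum>i<j. (th i - th j) * (a i)\<^sup>2) + (th j - th (Suc j)) * q"
    using gap1 gap2 q0 by (intro add_mono sum_mono mult_right_mono) auto
  also have "\<dots> \<le> (\<Sum>i<j. th i * (a i)\<^sup>2) - th j * S + (th j * q - ip (kop K v) v)"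
    using Kvv unfolding S_def by (simp add: left_diff_distrib sum_subtractf sum_distrib_left)
  also have "\<dots> = ip (kop K ?p) g - th j * ip ?p g"
    unfolding Kp_g pg by (simp add: algebra_simps)
  also have "\<dots> = (ip (kop K ?p) g - ip (kop K' ?p) g)
      + (th' j - th j) * ip ?p g"
    using eigen_op[OF K' es' g, of j] by (simp add: left_diff_distrib)
  also have "\<dots> \<le> D * N + D * N"
  proof (rule add_mono)
    show "ip (kop K ?p) g - ip (kop K' ?p) g \<le> D * N"
      using D[of ?p g] g by (simp add: eigen_norm N_def)
    have "(th' j - th j) * ip ?p g \<le> \<bar>th' j - th j\<bar> * \<bar>ip ?p g\<bar>"
      by (simp flip: abs_mult)
    also have "\<dots> \<le> D * N"
      using inner_abs_le[of ?p g] g Weyl[of j]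
      by (intro mult_mono) (auto simp: eigen_norm N_def)
    finally show "(th' j - th j) * ip ?p g \<le> D * N" .
  qed
  finally have "N * (dl * N) \<le> N * (2 * D)" by (simp add: power2_eq_square mult_ac)
  moreover have "0 \<le> D" using Weyl[of j] by linarith
  ultimately have dN: "dl * N \<le> 2 * D" using N(2) by (cases "N = 0") auto
  have pp: "ip ?p ?p = 1" by (simp add: eigen_orth[OF K' es'])
  have "q = ip ?p ?p - ip ?p s"
    unfolding q_def p_v[symmetric] unfolding v_def by (simp add: inner_diff_right s)
  moreover have "ip ?p s = S + (a j)\<^sup>2"
    using inner_eigen_sum'[OF K es, of ?p a "{..j}"] unfolding s_def[symmetric] S_def
    by (simp add: inner_commute[of ?p] a_def power2_eq_square lessThan_Suc_atMost[symmetric])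
  ultimately have Na: "N\<^sup>2 = 1 - (a j)\<^sup>2" using N pp by simp
  have a0: "0 \<le> a j" using sgn unfolding a_def .
  have a1: "a j \<le> 1" using inner_abs_le[of "ps j" ?p] unfolding a_def by (simp add: eigen_norm)
  have "ip (\<lambda>x. ?p x - ps j x) (\<lambda>x. ?p x - ps j x) = 2 - 2 * a j"
    by (simp add: inner_diff_left inner_diff_right L2_diff eigen_orth[OF K es] eigen_orth[OF K' es'] a_def inner_commute[of ?p])
  also have "\<dots> \<le> 2 * N\<^sup>2"
  proof -
    have "a j * a j \<le> a j" using a0 a1 by (rule mult_left_le[rotated])
    then show ?thesis unfolding Na by (simp add: power2_eq_square)
  qed
  also have "\<dots> \<le> (3 / 2 * N)\<^sup>2" by (simp add: power2_eq_square)
  finally have "nrm (\<lambda>x. ?p x - ps j x) \<le> 3 / 2 * N"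
    unfolding L2_norm_def using N(2) by (intro real_le_lsqrt) auto
  also have "\<dots> \<le> 3 / 2 * (2 * D / dl)" using dN dl by (intro mult_left_mono) (auto simp: field_simps)
  finally show ?thesis by simp
qed

lemma cross_inner_le:
  assumes "th j = 0" "th i \<noteq> 0"
  shows "\<bar>ip (ps i) (ps' j)\<bar> \<le> 2 * D / th i"
proof -
  note L [simp] = eigen_L2[OF K es] eigen_L2[OF K' es']
  let ?c = "ip (ps i) (ps' j)"
  have pos: "0 < th i" using eigen_nonneg[OF K es, of i] assms by simp
  have "th i * \<bar>?c\<bar> = \<bar>ip (kop K (ps i)) (ps' j)\<bar>"
    using eigen_op[OF K es, of "ps' j" i] pos by (simp add: abs_mult)
  also have "\<dots> \<le> \<bar>ip (kop K' (ps i)) (ps' j)\<bar> + D"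
    using D[of "ps i" "ps' j"] by (simp add: eigen_norm)
  also have "\<bar>ip (kop K' (ps i)) (ps' j)\<bar> = \<bar>th' j\<bar> * \<bar>?c\<bar>"
    using eigen_op'[OF K' es', of "ps i" j] by (simp add: abs_mult inner_commute)
  also have "\<dots> \<le> D * 1"
    using Weyl[of j] assms inner_abs_le[of "ps i" "ps' j"] by (intro mult_mono) (auto simp: eigen_norm)
  finally show ?thesis using pos by (simp add: field_simps)
qed

end

end

context L2_space
begin

section \<open>Sums of Gram kernels\<close>

text \<open>
The kernel of the composition of an operator with its transpose.
\<close>

lemma gram_kernel:
  assumes C: "bdd_kernel C"
  defines "G \<equiv> \<lambda>x y. \<integral>z. C x z * C y z \<partial>\<mu>"
  shows "bdd_kernel G"
    and "\<And>f. f \<in> L2 \<mu> \<Longrightarrow> kop G f = kop C (kop (\<lambda>x y. C y x) f)"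
    and "\<And>f g. f \<in> L2 \<mu> \<Longrightarrow> g \<in> L2 \<mu> \<Longrightarrow> ip (kop G f) g =
           ip (kop (\<lambda>x y. C y x) f) (kop (\<lambda>x y. C y x) g)"
proof -
  obtain B where B: "\<And>x y. \<bar>C x y\<bar> \<le> B" using C by (auto simp: bdd_kernel_def)
  note [measurable] = bdd_kernel_measurable[OF C]
  have "(\<lambda>(y, x). C x y) \<in> borel_measurable (\<mu> \<Otimes>\<^sub>M \<mu>)" by measurable
  then have CT: "bdd_kernel (\<lambda>x y. C y x)" unfolding bdd_kernel_def using B by blast
  have B0: "0 \<le> B" using order_trans[OF abs_ge_zero B] .
  have "\<bar>G x y\<bar> \<le> (\<integral>z. B * B \<partial>\<mu>)" for x y
  proof -
    have "\<bar>G x y\<bar> \<le> (\<integral>z. \<bar>C x z * C y z\<bar> \<partial>\<mu>)" unfolding G_def by (rule integral_abs_bound)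
    also have "\<dots> \<le> (\<integral>z. B * B \<partial>\<mu>)"
    proof (rule integral_mono)
      show "integrable \<mu> (\<lambda>z. \<bar>C x z * C y z\<bar>)"
        by (intro integrable_abs L2_integrable_mult bdd_kernel_slice C)
      show "\<bar>C x z * C y z\<bar> \<le> B * B" for z
        unfolding abs_mult using B0 by (intro mult_mono B) auto
    qed simp
    finally show ?thesis .
  qed
  moreover have "(\<lambda>(x, y). G x y) \<in> borel_measurable (\<mu> \<Otimes>\<^sub>M \<mu>)" unfolding G_def by measurable
  ultimately show "bdd_kernel G" unfolding bdd_kernel_def by blast
  show op: "kop G f = kop C (kop (\<lambda>x y. C y x) f)" if f: "f \<in> L2 \<mu>" for f
  proof
    fix x
    have "G x = kop C (C x)" unfolding G_def kernel_op_def by (simp add: mult.commute)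
    then have "kop G f x = ip (kop C (C x)) f"
      by (simp add: kernel_op_eq_inner[of G])
    also have "\<dots> = kop C (kop (\<lambda>x y. C y x) f) x"
      unfolding inner_kernel_op_transpose[OF C bdd_kernel_slice(1)[OF C] f] kernel_op_eq_inner[of C] ..
    finally show "kop G f x = kop C (kop (\<lambda>x y. C y x) f) x" .
  qed
  show "ip (kop G f) g =
           ip (kop (\<lambda>x y. C y x) f) (kop (\<lambda>x y. C y x) g)"
    if f: "f \<in> L2 \<mu>" and g: "g \<in> L2 \<mu>" for f g
    unfolding op[OF f] using CT f g by (intro inner_kernel_op_transpose C) auto
qed

lemma bdd_kernel_transpose: "bdd_kernel C \<Longrightarrow> bdd_kernel (\<lambda>x y. C y x)"
proof -
  assume C: "bdd_kernel C"
  note [measurable] = bdd_kernel_measurable[OF C]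
  have "(\<lambda>(y, x). C x y) \<in> borel_measurable (\<mu> \<Otimes>\<^sub>M \<mu>)" by measurable
  then show "bdd_kernel (\<lambda>x y. C y x)" using C unfolding bdd_kernel_def by blast
qed

lemma hs_norm_transpose:
  assumes C: "bdd_kernel C"
  shows "hs_norm (\<lambda>x y. C y x) = hs_norm C"
proof -
  note [measurable] = bdd_kernel_measurable[OF C]
  have m: "(\<lambda>(x, y). (C x y)\<^sup>2) \<in> borel_measurable (\<mu> \<Otimes>\<^sub>M \<mu>)" by measurable
  show ?thesis unfolding hs_norm_def
    using pair_finite.integral_product_swap[OF m] by (simp add: case_prod_beta)
qed

lemma hs_norm_le:
  assumes C: "bdd_kernel C" and B: "\<And>x y. \<bar>C x y\<bar> \<le> 1"
  shows "hs_norm C \<le> mass"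
proof -
  have i: "integrable (\<mu> \<Otimes>\<^sub>M \<mu>) (\<lambda>(x, y). (C x y)\<^sup>2)"
    using bdd_kernel_prod_integrable[OF bdd_kernel_mult[OF C C]] by (simp add: power2_eq_square)
  have i1: "integrable (\<mu> \<Otimes>\<^sub>M \<mu>) (\<lambda>(x, y). 1::real)"
    by (rule bdd_kernel_prod_integrable[OF bdd_kernel_const])
  have "(C x y)\<^sup>2 \<le> 1" for x y using B[of x y] by (simp add: abs_square_le_1)
  then have "(\<integral>z. (case z of (x, y) \<Rightarrow> (C x y)\<^sup>2) \<partial>(\<mu> \<Otimes>\<^sub>M \<mu>)) \<le> (\<integral>z. (case z of (x, y) \<Rightarrow> (1::real)) \<partial>(\<mu> \<Otimes>\<^sub>M \<mu>))"
    by (intro integral_mono i i1) auto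
  also have "\<dots> = (mass)\<^sup>2"
  proof -
    have "(\<integral>z. (case z of (x, y) \<Rightarrow> (1::real)) \<partial>(\<mu> \<Otimes>\<^sub>M \<mu>)) = (\<integral>x. \<integral>y. 1 \<partial>\<mu> \<partial>\<mu>)"
      using pair_finite.integral_fst'[OF i1] by (simp only: prod.case)
    then show ?thesis by (simp add: power2_eq_square)
  qed
  finally show ?thesis unfolding hs_norm_def by (intro real_le_lsqrt) auto
qed

lemma gram_sum_psd:
  assumes "\<And>k. k \<in> I \<Longrightarrow> bdd_kernel (C k)"
  shows "psd_kernel (\<lambda>x y. \<Sum>k\<in>I. \<integral>z. C k x z * C k y z \<partial>\<mu>)"
    and "\<And>f g. f \<in> L2 \<mu> \<Longrightarrow> g \<in> L2 \<mu> \<Longrightarrow>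
      ip (kop (\<lambda>x y. \<Sum>k\<in>I. \<integral>z. C k x z * C k y z \<partial>\<mu>) f) g =
      (\<Sum>k\<in>I. ip (kop (\<lambda>x y. C k y x) f) (kop (\<lambda>x y. C k y x) g))"
proof -
  let ?G = "\<lambda>k x y. \<integral>z. C k x z * C k y z \<partial>\<mu>"
  let ?K = "\<lambda>x y. \<Sum>k\<in>I. ?G k x y"
  have b: "bdd_kernel ?K" by (intro bdd_kernel_sum gram_kernel(1) assms)
  show form: "ip (kop ?K f) g =
      (\<Sum>k\<in>I. ip (kop (\<lambda>x y. C k y x) f) (kop (\<lambda>x y. C k y x) g))"
    if f: "f \<in> L2 \<mu>" and g: "g \<in> L2 \<mu>" for f g
  proof -
    have "kop ?K f = (\<lambda>x. \<Sum>k\<in>I. kop (?G k) f x)"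
      using bdd_kernel_slice(1)[OF gram_kernel(1)[OF assms]] f
      by (intro ext) (simp add: kernel_op_eq_inner inner_sum_left)
    then show ?thesis
      using kernel_op_L2[OF gram_kernel(1)[OF assms] f] g f
      by (simp add: inner_sum_left gram_kernel(3)[OF assms])
  qed
  show "psd_kernel ?K" unfolding psd_kernel_def
    using b form by (auto simp: mult.commute intro!: sum_nonneg)
qed

text \<open>
The difference of two operators of this form is bounded linearly in the differences of the factors,
because factors bounded by one have Hilbert--Schmidt norm at most \<^term>\<open>mass\<close>.
\<close>

lemma gram_sum_diff_le:
  assumes C: "\<And>k. k \<in> I \<Longrightarrow> bdd_kernel (C k)" and C': "\<And>k. k \<in> I \<Longrightarrow> bdd_kernel (C' k)"
    and B: "\<And>k x y. k \<in> I \<Longrightarrow> \<bar>C k x y\<bar> \<le> 1" and B': "\<And>k x y. k \<in> I \<Longrightarrow> \<bar>C' k x y\<bar> \<le> 1"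
    and f: "f \<in> L2 \<mu>" and g: "g \<in> L2 \<mu>"
  shows "\<bar>ip (kop (\<lambda>x y. \<Sum>k\<in>I. \<integral>z. C' k x z * C' k y z \<partial>\<mu>) f) g
         - ip (kop (\<lambda>x y. \<Sum>k\<in>I. \<integral>z. C k x z * C k y z \<partial>\<mu>) f) g\<bar>
     \<le> (2 * mass * (\<Sum>k\<in>I. hs_norm (\<lambda>x y. C' k x y - C k x y))) * nrm f * nrm g"
proof -
  let ?T = "\<lambda>C. kop (\<lambda>x y. C y x)"
  have le: "\<bar>ip (?T (C' k) f) (?T (C' k) g) - ip (?T (C k) f) (?T (C k) g)\<bar>
      \<le> 2 * mass * hs_norm (\<lambda>x y. C' k x y - C k x y) * nrm f * nrm g" if k: "k \<in> I" for k
  proof -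
    note b = C[OF k] C'[OF k]
    let ?E = "\<lambda>x y. C' k x y - C k x y"
    let ?m = "mass"
    have bE: "bdd_kernel ?E" by (intro bdd_kernel_diff b)
    have opn: "nrm (?T A h) \<le> hs_norm A * nrm h" if A: "bdd_kernel A" and h: "h \<in> L2 \<mu>" for A h
    proof (cases "nrm (?T A h) = 0")
      case False
      let ?n = "nrm (?T A h)"
      have Th: "?T A h \<in> L2 \<mu>" using bdd_kernel_transpose[OF A] h by auto
      have "?n * ?n \<le> (hs_norm A * nrm h) * ?n"
        using kernel_form_le_hs_norm[OF bdd_kernel_transpose[OF A] h Th]
        by (simp add: hs_norm_transpose[OF A] norm_sq[unfolded power2_eq_square])
      moreover have "0 < ?n" using False norm_nonneg[of "?T A h"] by linarith
      ultimately show ?thesis by simp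
    qed simp
    have TE: "?T ?E h = (\<lambda>x. ?T (C' k) h x - ?T (C k) h x)" if "h \<in> L2 \<mu>" for h
      by (rule ext) (simp add: kernel_op_eq_inner inner_diff_left bdd_kernel_slice(2)[OF b(1)] bdd_kernel_slice(2)[OF b(2)] that)
    have L: "?T A h \<in> L2 \<mu>" if "bdd_kernel A" "h \<in> L2 \<mu>" for A h
      using that bdd_kernel_transpose by blast
    have eq: "ip (?T (C' k) f) (?T (C' k) g) - ip (?T (C k) f) (?T (C k) g)
       = ip (?T ?E f) (?T (C' k) g) + ip (?T (C k) f) (?T ?E g)"
      unfolding TE[OF f] TE[OF g] using b f g by (simp add: inner_diff_left inner_diff_right L)
    have "\<bar>ip (?T (C' k) f) (?T (C' k) g) - ip (?T (C k) f) (?T (C k) g)\<bar>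
        \<le> \<bar>ip (?T ?E f) (?T (C' k) g)\<bar> + \<bar>ip (?T (C k) f) (?T ?E g)\<bar>"
      unfolding eq by (rule abs_triangle_ineq)
    also have "\<dots> \<le> (hs_norm ?E * nrm f) * (?m * nrm g) + (?m * nrm f) * (hs_norm ?E * nrm g)"
    proof (rule add_mono)
      have "\<bar>ip (?T ?E f) (?T (C' k) g)\<bar> \<le> nrm (?T ?E f) * nrm (?T (C' k) g)"
        using b bE f g by (intro inner_abs_le L) auto
      also have "\<dots> \<le> (hs_norm ?E * nrm f) * (hs_norm (C' k) * nrm g)"
        using b bE f g by (intro mult_mono opn) auto
      also have "\<dots> \<le> (hs_norm ?E * nrm f) * (?m * nrm g)"
        by (intro mult_left_mono mult_right_mono hs_norm_le b B' k) auto
      finally show "\<bar>ip (?T ?E f) (?T (C' k) g)\<bar> \<le> (hs_norm ?E * nrm f) * (?m * nrm g)" .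
      have "\<bar>ip (?T (C k) f) (?T ?E g)\<bar> \<le> nrm (?T (C k) f) * nrm (?T ?E g)"
        using b bE f g by (intro inner_abs_le L) auto
      also have "\<dots> \<le> (hs_norm (C k) * nrm f) * (hs_norm ?E * nrm g)"
        using b bE f g by (intro mult_mono opn) auto
      also have "\<dots> \<le> (?m * nrm f) * (hs_norm ?E * nrm g)"
        by (intro mult_right_mono hs_norm_le b B k) auto
      finally show "\<bar>ip (?T (C k) f) (?T ?E g)\<bar> \<le> (?m * nrm f) * (hs_norm ?E * nrm g)" .
    qed
    finally show ?thesis by (simp add: mult_ac)
  qed
  have "\<bar>(\<Sum>k\<in>I. ip (?T (C' k) f) (?T (C' k) g)) - (\<Sum>k\<in>I. ip (?T (C k) f) (?T (C k) g))\<bar>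
     \<le> (\<Sum>k\<in>I. 2 * mass * hs_norm (\<lambda>x y. C' k x y - C k x y) * nrm f * nrm g)"
    unfolding sum_subtractf[symmetric] by (intro order_trans[OF sum_abs] sum_mono le)
  moreover have "ip (kop (\<lambda>x y. \<Sum>k\<in>I. \<integral>z. C k x z * C k y z \<partial>\<mu>) f) g
      = (\<Sum>k\<in>I. ip (?T (C k) f) (?T (C k) g))"
    using C f g by (rule gram_sum_psd(2))
  moreover have "ip (kop (\<lambda>x y. \<Sum>k\<in>I. \<integral>z. C' k x z * C' k y z \<partial>\<mu>) f) g
      = (\<Sum>k\<in>I. ip (?T (C' k) f) (?T (C' k) g))"
    using C' f g by (rule gram_sum_psd(2))
  ultimately show ?thesis
    by (simp add: sum_distrib_left sum_distrib_right mult_ac)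
qed

end

text \<open>
A uniform bound on the mean squares of a random field bounds the expectation of its norm in
\<open>L\<^sup>2\<close>, by the Cauchy--Schwarz inequality and Fubini's theorem.
\<close>

lemma (in prob_space) expectation_sqrt_integral_le:
  assumes N: "finite_measure N"
    and hm[measurable]: "(\<lambda>(w, z). h w z) \<in> borel_measurable (M \<Otimes>\<^sub>M N)"
    and hb: "\<And>w z. w \<in> space M \<Longrightarrow> z \<in> space N \<Longrightarrow> \<bar>h w z\<bar> \<le> C"
    and hr: "\<And>z. z \<in> space N \<Longrightarrow> expectation (\<lambda>w. (h w z :: real)\<^sup>2) \<le> r"
  shows "integrable M (\<lambda>w. sqrt (\<integral>z. (h w z)\<^sup>2 \<partial>N))"
    and "expectation (\<lambda>w. sqrt (\<integral>z. (h w z)\<^sup>2 \<partial>N)) \<le> sqrt (r * measure N (space N))"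
proof -
  interpret N: finite_measure N by fact
  interpret P: pair_sigma_finite M N ..
  interpret MN: finite_measure "M \<Otimes>\<^sub>M N"
    by (intro finite_measure_pair_measure) unfold_locales
  let ?s = "\<lambda>w. \<integral>z. (h w z)\<^sup>2 \<partial>N"
  have hb2: "\<bar>(h w z)\<^sup>2\<bar> \<le> C\<^sup>2" if "w \<in> space M" "z \<in> space N" for w z
    using power_mono[OF hb[OF that], of 2] by simp
  have sm[measurable]: "?s \<in> borel_measurable M" by measurable
  have i2: "integrable (M \<Otimes>\<^sub>M N) (\<lambda>(w, z). (h w z)\<^sup>2)"
    by (rule MN.integrable_const_bound[where B="C\<^sup>2"]) (use hb2 in \<open>auto simp: space_pair_measure\<close>)
  have sb: "\<bar>?s w\<bar> \<le> C\<^sup>2 * measure N (space N)" if w: "w \<in> space M" for w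
  proof -
    have [measurable]: "(\<lambda>z. h w z) \<in> borel_measurable N"
      using measurable_compose[OF measurable_Pair1'[OF w] hm] by simp
    have "?s w \<le> (\<integral>z. C\<^sup>2 \<partial>N)"
      using hb2[OF w] by (intro integral_mono N.integrable_const_bound[where B="C\<^sup>2"]) auto
    then show ?thesis by (simp add: mult.commute)
  qed
  have int_s: "integrable M ?s"
    by (rule integrable_const_bound[where B="C\<^sup>2 * measure N (space N)"]) (use sb in auto)
  show isq: "integrable M (\<lambda>w. sqrt (?s w))"
    by (rule integrable_const_bound[where B="sqrt (C\<^sup>2 * measure N (space N))"]) (use sb in auto)
  have "(expectation (\<lambda>w. sqrt (?s w)))\<^sup>2 \<le> expectation (\<lambda>w. (sqrt (?s w))\<^sup>2) * expectation (\<lambda>w. 1\<^sup>2)"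
    using integral_Cauchy_Schwarz(2)[of "\<lambda>w. sqrt (?s w)" M "\<lambda>_. 1"] int_s by simp
  also have "\<dots> = expectation ?s" by (simp add: prob_space)
  also have "\<dots> = (\<integral>z. expectation (\<lambda>w. (h w z)\<^sup>2) \<partial>N)"
    using P.Fubini_integral[of "\<lambda>w z. (h w z)\<^sup>2"] i2 by simp
  also have "\<dots> \<le> (\<integral>z. r \<partial>N)"
    using P.integrable_snd[of "\<lambda>w z. (h w z)\<^sup>2"] i2 hr by (intro integral_mono) auto
  also have "\<dots> = r * measure N (space N)" by (simp add: mult.commute)
  finally show "expectation (\<lambda>w. sqrt (?s w)) \<le> sqrt (r * measure N (space N))"
    by (rule real_le_rsqrt)
qed

section \<open>Averages of psi-mixing sequences\<close>

text \<open>
The sigma-algebra \<^const>\<open>sigma_fun\<close> as a measurable space, so that measurability with respect to it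
can be expressed.
\<close>

definition sigma_fun_space :: "'a measure \<Rightarrow> (nat \<Rightarrow> 'a \<Rightarrow> real \<Rightarrow> real) \<Rightarrow> nat set \<Rightarrow> 'a measure" where
  "sigma_fun_space M G T = sigma (space M)
     {(\<lambda>\<omega>. G s \<omega> x) -` B \<inter> space M | s x B. s \<in> T \<and> B \<in> sets borel}"

lemma space_sigma_fun_space [simp]: "space (sigma_fun_space M G T) = space M"
  unfolding sigma_fun_space_def by (intro space_measure_of) auto

lemma sets_sigma_fun_space: "sets (sigma_fun_space M G T) = sigma_fun M G T"
  unfolding sigma_fun_space_def sigma_fun_def by (intro sets_measure_of) auto

lemma sigma_fun_space_measurable:
  "s \<in> T \<Longrightarrow> (\<lambda>w. G s w x) \<in> borel_measurable (sigma_fun_space M G T)"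
  by (intro measurableI) (auto simp: sets_sigma_fun_space sigma_fun_def intro!: sigma_sets.Basic)

lemma sigma_fun_mono: "T \<subseteq> T' \<Longrightarrow> sigma_fun M G T \<subseteq> sigma_fun M G T'"
  unfolding sigma_fun_def by (intro sigma_sets_mono') auto

lemma sigma_fun_space_measurable_mono:
  "f \<in> borel_measurable (sigma_fun_space M G T) \<Longrightarrow> T \<subseteq> T' \<Longrightarrow> f \<in> borel_measurable (sigma_fun_space M G T')"
  using sigma_fun_mono[of T T' M G] unfolding measurable_def sets_sigma_fun_space by auto

locale mixing = prob_space M for M :: "'a measure" +
  fixes G :: "nat \<Rightarrow> 'a \<Rightarrow> real \<Rightarrow> real"
  assumes G_meas: "\<And>t x. t \<ge> 1 \<Longrightarrow> (\<lambda>w. G t w x) \<in> borel_measurable M"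
    and psi_sum: "psi_summable M G"
begin

text \<open>
The mixing coefficients as real numbers. The value is meaningful for positive \<open>k\<close>, for which
\<^const>\<open>psi_summable\<close> makes the coefficients finite.
\<close>

definition Psi :: "nat \<Rightarrow> real" where "Psi k = enn2real (psi_coeff M G k)"

lemma Psi_nonneg [simp]: "0 \<le> Psi k" by (simp add: Psi_def)

lemma sigma_fun_sets: "T \<subseteq> {1..} \<Longrightarrow> sigma_fun M G T \<subseteq> sets M"
  unfolding sigma_fun_def using measurable_sets[OF G_meas]
  by (intro sets.sigma_sets_subset) auto

lemma measurable_from_sigma_fun:
  "f \<in> borel_measurable (sigma_fun_space M G T) \<Longrightarrow> T \<subseteq> {1..} \<Longrightarrow> f \<in> borel_measurable M"
  using sigma_fun_sets[of T] unfolding measurable_def sets_sigma_fun_space by auto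

lemma Psi_ge:
  assumes k: "k \<ge> 1" and m: "m \<ge> 1" and A: "A \<in> sigma_fun M G {1..m}" and B: "B \<in> sigma_fun M G {m + k..}"
  shows "\<bar>prob (A \<inter> B) - prob A * prob B\<bar> \<le> Psi k * (prob A * prob B)"
proof -
  have As: "A \<in> sets M" and Bs: "B \<in> sets M"
    using A B k sigma_fun_sets[of "{1..m}"] sigma_fun_sets[of "{m+k..}"] by auto
  show ?thesis
  proof (cases "prob A * prob B > 0")
    case True
    have "ennreal \<bar>1 - prob (A \<inter> B) / (prob A * prob B)\<bar> \<le> psi_coeff M G k"
      unfolding psi_coeff_def using m A B True by (intro Sup_upper) blast
    moreover have "psi_coeff M G k < \<infinity>" using psi_sum k unfolding psi_summable_def by auto
    ultimately have "\<bar>1 - prob (A \<inter> B) / (prob A * prob B)\<bar> \<le> Psi k"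
      unfolding Psi_def by (metis abs_ge_zero enn2real_ennreal enn2real_mono infinity_ennreal_def)
    then have "\<bar>1 - prob (A \<inter> B) / (prob A * prob B)\<bar> * (prob A * prob B) \<le> Psi k * (prob A * prob B)"
      using True by (intro mult_right_mono) auto
    also have "\<bar>1 - prob (A \<inter> B) / (prob A * prob B)\<bar> * (prob A * prob B)
        = \<bar>(1 - prob (A \<inter> B) / (prob A * prob B)) * (prob A * prob B)\<bar>"
      using True by (simp add: abs_mult)
    also have "(1 - prob (A \<inter> B) / (prob A * prob B)) * (prob A * prob B) = prob A * prob B - prob (A \<inter> B)"
    proof -
      have "prob A * prob B \<noteq> 0" using True by (metis less_irrefl)
      then have "prob A \<noteq> 0" "prob B \<noteq> 0" by auto
      then show ?thesis by (simp add: left_diff_distrib)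
    qed
    finally show ?thesis by (simp add: abs_minus_commute)
  next
    case False
    then have z: "prob A * prob B = 0" using measure_nonneg[of M A] measure_nonneg[of M B] by (metis less_le mult_nonneg_nonneg)
    have "prob (A \<inter> B) \<le> prob A" "prob (A \<inter> B) \<le> prob B" using As Bs by (auto intro!: finite_measure_mono)
    then have "prob (A \<inter> B) = 0" using z by (auto intro!: antisym measure_nonneg)
    then show ?thesis unfolding z by simp
  qed
qed

text \<open>
Eventually \<open>k sqrt (\<Psi> k) < 1\<close>, hence \<open>\<Psi> k \<le> sqrt (\<Psi> k) \<le> k sqrt (\<Psi> k)\<close>.
\<close>

lemma Psi_summable: "summable (\<lambda>k. Psi (Suc k))"
proof -
  have s: "summable (\<lambda>k. real k * sqrt (Psi k))" using psi_sum unfolding psi_summable_def Psi_def by auto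
  then have "(\<lambda>k. real k * sqrt (Psi k)) \<longlonglongrightarrow> 0" by (rule summable_LIMSEQ_zero)
  then have "\<forall>\<^sub>F k in sequentially. real k * sqrt (Psi k) < 1" by (rule order_tendstoD(2)) simp
  then have "\<forall>\<^sub>F k in sequentially. norm (Psi k) \<le> real k * sqrt (Psi k)"
    using eventually_ge_at_top[of 1]
  proof eventually_elim
    case (elim k)
    have "sqrt (Psi k) \<le> real k * sqrt (Psi k)"
      using mult_right_mono[of 1 "real k" "sqrt (Psi k)"] elim by simp
    then have "sqrt (Psi k) \<le> 1" using elim by linarith
    then have "sqrt (Psi k) \<le> real k" using elim by linarith
    then have "sqrt (Psi k) * sqrt (Psi k) \<le> real k * sqrt (Psi k)" by (intro mult_right_mono) auto
    then show ?case by simp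
  qed
  then have "summable Psi" using s by (rule summable_comparison_test_ev)
  then show ?thesis by (simp add: summable_Suc_iff)
qed

lemma finite_range_decomp:
  fixes Y :: "'a \<Rightarrow> real"
  assumes w: "w \<in> S" and fin: "finite (Y ` S)"
  shows "Y w = (\<Sum>v\<in>Y ` S. v * indicator (Y -` {v} \<inter> S) w)"
proof -
  have "(\<Sum>v\<in>Y ` S. v * indicator (Y -` {v} \<inter> S) w) = (\<Sum>v\<in>Y ` S. if v = Y w then v else 0)"
    using w by (intro sum.cong refl) (simp add: indicator_def)
  also have "\<dots> = Y w" using w fin by simp
  finally show ?thesis by simp
qed

lemma expectation_finite_range:
  assumes [measurable]: "Y \<in> borel_measurable M" and fY: "finite (Y ` space M)"
  shows "expectation Y = (\<Sum>v\<in>Y ` space M. v * prob (Y -` {v} \<inter> space M))"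
proof -
  have "expectation Y = expectation (\<lambda>w. \<Sum>v\<in>Y ` space M. v * indicator (Y -` {v} \<inter> space M) w)"
    by (intro Bochner_Integration.integral_cong refl finite_range_decomp fY)
  also have "\<dots> = (\<Sum>v\<in>Y ` space M. v * prob (Y -` {v} \<inter> space M))"
    by (subst Bochner_Integration.integral_sum) (auto simp: less_top[symmetric])
  finally show ?thesis .
qed

text \<open>
The covariance inequality for psi-mixing variables. Variables with finitely many values are sums of
multiples of indicators, so the definition of the coefficients applies term by term.
\<close>

lemma covariance_le_Psi:
  assumes k: "k \<ge> 1" and m: "m \<ge> 1"
    and Y: "Y \<in> borel_measurable (sigma_fun_space M G {1..m})"
    and Z: "Z \<in> borel_measurable (sigma_fun_space M G {m + k..})"
    and fY: "finite (Y ` space M)" and fZ: "finite (Z ` space M)"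
    and rY: "\<And>w. w \<in> space M \<Longrightarrow> 0 \<le> Y w \<and> Y w \<le> 1" and rZ: "\<And>w. w \<in> space M \<Longrightarrow> 0 \<le> Z w \<and> Z w \<le> (1::real)"
  shows "\<bar>expectation (\<lambda>w. Y w * Z w) - expectation Y * expectation Z\<bar> \<le> Psi k"
proof -
  let ?A = "\<lambda>v. Y -` {v} \<inter> space M" and ?B = "\<lambda>v. Z -` {v} \<inter> space M"
  let ?VY = "Y ` space M" and ?VZ = "Z ` space M"
  have A: "?A v \<in> sigma_fun M G {1..m}" for v
    using measurable_sets[OF Y, of "{v}"] by (simp add: sets_sigma_fun_space)
  have B: "?B v \<in> sigma_fun M G {m + k..}" for v
    using measurable_sets[OF Z, of "{v}"] by (simp add: sets_sigma_fun_space)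
  have T: "{1..m} \<subseteq> {1..}" "{m + k..} \<subseteq> {1..}" using k by auto
  have [measurable]: "Y \<in> borel_measurable M" "Z \<in> borel_measurable M"
    using measurable_from_sigma_fun[OF Y T(1)] measurable_from_sigma_fun[OF Z T(2)] by auto
  have As[measurable]: "?A v \<in> sets M" and Bs[measurable]: "?B v \<in> sets M" for v
    by auto
  note Yeq = finite_range_decomp[OF _ fY] and Zeq = finite_range_decomp[OF _ fZ]
  have EY: "expectation Y = (\<Sum>v\<in>?VY. v * prob (?A v))" and EZ: "expectation Z = (\<Sum>v\<in>?VZ. v * prob (?B v))"
    using fY fZ by (simp_all add: expectation_finite_range)
  have EYZ: "expectation (\<lambda>w. Y w * Z w) = (\<Sum>v\<in>?VY. \<Sum>u\<in>?VZ. v * u * prob (?A v \<inter> ?B u))"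
  proof -
    have "expectation (\<lambda>w. Y w * Z w) = expectation (\<lambda>w. \<Sum>v\<in>?VY. \<Sum>u\<in>?VZ. v * u * indicator (?A v \<inter> ?B u) w)"
    proof (intro Bochner_Integration.integral_cong refl)
      fix w assume w: "w \<in> space M"
      have "Y w * Z w = (\<Sum>v\<in>?VY. v * indicator (?A v) w) * (\<Sum>v\<in>?VZ. v * indicator (?B v) w)"
        by (intro arg_cong2[where f="(*)"] Yeq[OF w] Zeq[OF w])
      also have "\<dots> = (\<Sum>v\<in>?VY. \<Sum>u\<in>?VZ. v * u * indicator (?A v \<inter> ?B u) w)"
        by (simp add: sum_product indicator_inter_arith mult_ac)
      finally show "Y w * Z w = (\<Sum>v\<in>?VY. \<Sum>u\<in>?VZ. v * u * indicator (?A v \<inter> ?B u) w)" .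
    qed
    also have "\<dots> = (\<Sum>v\<in>?VY. \<Sum>u\<in>?VZ. expectation (\<lambda>w. v * u * indicator (?A v \<inter> ?B u) w))"
      by (subst Bochner_Integration.integral_sum | intro sum.cong refl Bochner_Integration.integrable_sum
          integrable_mult_right integrable_real_indicator | auto simp: less_top[symmetric])+
    also have "\<dots> = (\<Sum>v\<in>?VY. \<Sum>u\<in>?VZ. v * u * prob (?A v \<inter> ?B u))"
      by (intro sum.cong refl) (simp add: Int_absorb2 sets.sets_into_space)
    finally show ?thesis .
  qed
  have eq: "expectation (\<lambda>w. Y w * Z w) - expectation Y * expectation Z
      = (\<Sum>v\<in>?VY. \<Sum>u\<in>?VZ. v * u * (prob (?A v \<inter> ?B u) - prob (?A v) * prob (?B u)))"
    unfolding EYZ EY EZ sum_product by (simp add: sum_subtractf right_diff_distrib mult_ac)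
  have "\<bar>expectation (\<lambda>w. Y w * Z w) - expectation Y * expectation Z\<bar>
      \<le> (\<Sum>v\<in>?VY. \<Sum>u\<in>?VZ. \<bar>v * u * (prob (?A v \<inter> ?B u) - prob (?A v) * prob (?B u))\<bar>)"
    unfolding eq by (intro order_trans[OF sum_abs] sum_mono sum_abs)
  also have "\<dots> \<le> (\<Sum>v\<in>?VY. \<Sum>u\<in>?VZ. v * u * (Psi k * (prob (?A v) * prob (?B u))))"
    using rY rZ Psi_ge[OF k m A B]
    by (intro sum_mono) (auto simp: abs_mult intro!: mult_left_mono)
  also have "\<dots> = Psi k * (expectation Y * expectation Z)"
    unfolding EY EZ sum_product by (simp add: sum_distrib_left mult_ac)
  also have "\<dots> \<le> Psi k"
  proof -
    have e: "0 \<le> expectation Y" "expectation Y \<le> 1" "0 \<le> expectation Z" "expectation Z \<le> 1"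
      using rY rZ
      by (auto intro!: integral_nonneg_AE AE_I2 integral_le_const integrable_const_bound[where B=1])
    show ?thesis using e by (intro mult_left_le mult_le_one) auto
  qed
  finally show ?thesis .
qed

text \<open>
A bound for the covariance of two variables at distance \<open>d\<close>, each of which depends on a window of
length \<open>k\<close>: overlapping windows are only bounded by one.
\<close>

definition gap_bound :: "nat \<Rightarrow> nat \<Rightarrow> real" where
  "gap_bound k d = (if d \<le> k then 1 else Psi (d - k))"

lemma gap_bound_nonneg: "0 \<le> gap_bound k d"
  by (simp add: gap_bound_def)

lemma gap_bound_summable: "summable (gap_bound k)"
proof -
  have "summable (\<lambda>d. gap_bound k (d + Suc k))"
    using Psi_summable by (simp add: gap_bound_def Suc_diff_le)
  then show ?thesis by (subst (asm) summable_iff_shift)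
qed

text \<open>
The constant in the bound \<open>mix_const k / N\<close> of the mean square of an average of \<open>N\<close> centred
variables with windows of length \<open>k\<close>. The factor two accounts for the indices on both sides of a given one.
\<close>

definition mix_const :: "nat \<Rightarrow> real" where "mix_const k = 2 * (\<Sum>d. gap_bound k d)"

lemma mix_const_nonneg: "0 \<le> mix_const k"
  unfolding mix_const_def by (simp add: suminf_nonneg gap_bound_summable gap_bound_nonneg)

lemma sum_gap_bound_le:
  assumes s: "s \<in> {1..N}"
  shows "(\<Sum>t=1..N. gap_bound k (if s \<le> t then t - s else s - t)) \<le> mix_const k"
proof -
  let ?a = "gap_bound k"
  have le: "(\<Sum>i\<in>I. ?a (f i)) \<le> (\<Sum>d. ?a d)" if f: "inj_on f I" and fin: "finite I" for f and I :: "nat set"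
  proof -
    have "(\<Sum>i\<in>I. ?a (f i)) = (\<Sum>d\<in>f ` I. ?a d)" using f by (simp add: sum.reindex)
    also have "\<dots> \<le> (\<Sum>d. ?a d)"
      using fin by (intro sum_le_suminf gap_bound_summable) (auto simp: gap_bound_nonneg)
    finally show ?thesis .
  qed
  have "(\<Sum>t=1..N. ?a (if s \<le> t then t - s else s - t))
      = (\<Sum>t\<in>{1..<s} \<union> {s..N}. ?a (if s \<le> t then t - s else s - t))"
    using s by (intro sum.cong) auto
  also have "\<dots> = (\<Sum>t\<in>{1..<s}. ?a (if s \<le> t then t - s else s - t)) + (\<Sum>t\<in>{s..N}. ?a (if s \<le> t then t - s else s - t))"
    by (intro sum.union_disjoint) auto
  also have "\<dots> = (\<Sum>t\<in>{1..<s}. ?a (s - t)) + (\<Sum>t\<in>{s..N}. ?a (t - s))"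
    by (intro arg_cong2[where f="(+)"] sum.cong) auto
  also have "\<dots> \<le> (\<Sum>d. ?a d) + (\<Sum>d. ?a d)"
    by (intro add_mono le) (auto simp: inj_on_def)
  finally show ?thesis unfolding mix_const_def by simp
qed

theorem average_mean_square_le:
  fixes Y :: "nat \<Rightarrow> 'a \<Rightarrow> real"
  assumes Ym: "\<And>t. t \<ge> 1 \<Longrightarrow> Y t \<in> borel_measurable (sigma_fun_space M G {t..t + k})"
    and fin: "\<And>t. t \<ge> 1 \<Longrightarrow> finite (Y t ` space M)"
    and rng: "\<And>t w. t \<ge> 1 \<Longrightarrow> w \<in> space M \<Longrightarrow> 0 \<le> Y t w \<and> Y t w \<le> 1"
    and mean: "\<And>t. t \<ge> 1 \<Longrightarrow> expectation (Y t) = m"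
    and N: "N \<ge> 1"
  shows "expectation (\<lambda>w. ((\<Sum>t=1..N. Y t w) / real N - m)\<^sup>2) \<le> mix_const k / real N"
proof -
  have YM[measurable]: "Y t \<in> borel_measurable M" if "t \<ge> 1" for t
    using measurable_from_sigma_fun[OF Ym[OF that]] that by auto
  have Yi: "integrable M (Y t)" if "t \<ge> 1" for t
    using rng[OF that] YM[OF that] by (intro integrable_const_bound[where B=1]) auto
  have Yb: "\<bar>Y s w * Y t w\<bar> \<le> 1" if "s \<ge> 1" "t \<ge> 1" "w \<in> space M" for s t w
    using rng[OF that(1,3)] rng[OF that(2,3)] by (auto simp: abs_mult intro!: mult_le_one)
  have YYi: "integrable M (\<lambda>w. Y s w * Y t w)" if "s \<ge> 1" "t \<ge> 1" for s t
    using Yb[OF that] YM[OF that(1)] YM[OF that(2)] by (intro integrable_const_bound[where B=1]) auto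
  have m01: "0 \<le> m" "m \<le> 1"
    using rng[of 1] Yi[of 1] mean[of 1]
    by (auto intro!: integral_nonneg_AE AE_I2 integral_le_const simp flip: mean[of 1])
  have far: "\<bar>expectation (\<lambda>w. Y s w * Y t w) - m * m\<bar> \<le> gap_bound k (t - s)" if s: "s \<ge> 1" and st: "s \<le> t" for s t
  proof (cases "t - s \<le> k")
    case True
    have "expectation (\<lambda>w. Y s w * Y t w) \<le> 1" "0 \<le> expectation (\<lambda>w. Y s w * Y t w)"
      using s st Yb[of s t] rng[of s] rng[of t] YYi[of s t]
      by (auto intro!: integral_le_const integral_nonneg_AE AE_I2 dest: abs_le_D1)
    moreover have "0 \<le> m * m" "m * m \<le> 1" using m01 by (auto intro: mult_le_one)
    ultimately have "\<bar>expectation (\<lambda>w. Y s w * Y t w) - m * m\<bar> \<le> 1" by linarith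
    then show ?thesis using True by (simp add: gap_bound_def)
  next
    case False
    have t: "t = (s + k) + (t - s - k)" using False by linarith
    have "Y s \<in> borel_measurable (sigma_fun_space M G {1..s + k})"
      using Ym[OF s] by (rule sigma_fun_space_measurable_mono) (use s in auto)
    moreover have "Y t \<in> borel_measurable (sigma_fun_space M G {(s + k) + (t - s - k)..})"
      using Ym[of t] by (rule sigma_fun_space_measurable_mono) (use s st t in auto)
    ultimately have "\<bar>expectation (\<lambda>w. Y s w * Y t w) - expectation (Y s) * expectation (Y t)\<bar> \<le> Psi (t - s - k)"
      using s st False fin rng by (intro covariance_le_Psi[where m="s + k"]) auto
    then show ?thesis using s st False mean by (simp add: gap_bound_def)
  qed
  have cov: "\<bar>expectation (\<lambda>w. (Y s w - m) * (Y t w - m))\<bar> \<le> gap_bound k (if s \<le> t then t - s else s - t)"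
    if s: "s \<ge> 1" and t: "t \<ge> 1" for s t
  proof -
    have "expectation (\<lambda>w. (Y s w - m) * (Y t w - m)) = expectation (\<lambda>w. Y s w * Y t w - m * Y s w - m * Y t w + m * m)"
      by (intro Bochner_Integration.integral_cong) (auto simp: algebra_simps)
    also have "\<dots> = expectation (\<lambda>w. Y s w * Y t w) - m * m"
      using YYi[OF s t] Yi[OF s] Yi[OF t] mean s t by (simp add: prob_space)
    finally show ?thesis using far[OF s, of t] far[OF t, of s] by (auto simp: mult.commute)
  qed
  have "expectation (\<lambda>w. ((\<Sum>t=1..N. Y t w) / real N - m)\<^sup>2)
      = expectation (\<lambda>w. (\<Sum>s=1..N. \<Sum>t=1..N. (Y s w - m) * (Y t w - m)) / (real N)\<^sup>2)"
  proof (intro Bochner_Integration.integral_cong refl)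
    fix w
    have "(\<Sum>t=1..N. Y t w) / real N - m = (\<Sum>t=1..N. Y t w - m) / real N"
      using N by (simp add: sum_subtractf field_simps)
    then show "((\<Sum>t=1..N. Y t w) / real N - m)\<^sup>2 = (\<Sum>s=1..N. \<Sum>t=1..N. (Y s w - m) * (Y t w - m)) / (real N)\<^sup>2"
      by (simp add: power_divide power2_eq_square sum_product)
  qed
  also have "\<dots> = (\<Sum>s=1..N. \<Sum>t=1..N. expectation (\<lambda>w. (Y s w - m) * (Y t w - m))) / (real N)\<^sup>2"
  proof -
    have i: "integrable M (\<lambda>w. (Y s w - m) * (Y t w - m))" if "s \<in> {1..N}" "t \<in> {1..N}" for s t
    proof -
      have "integrable M (\<lambda>w. Y s w * Y t w - m * Y s w - m * Y t w + m * m)"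
        using YYi[of s t] Yi[of s] Yi[of t] that by auto
      then show ?thesis by (simp add: algebra_simps)
    qed
    have "expectation (\<lambda>w. \<Sum>s=1..N. \<Sum>t=1..N. (Y s w - m) * (Y t w - m))
       = (\<Sum>s=1..N. expectation (\<lambda>w. \<Sum>t=1..N. (Y s w - m) * (Y t w - m)))"
      using i by (intro Bochner_Integration.integral_sum Bochner_Integration.integrable_sum) auto
    also have "\<dots> = (\<Sum>s=1..N. \<Sum>t=1..N. expectation (\<lambda>w. (Y s w - m) * (Y t w - m)))"
      using i by (intro sum.cong refl Bochner_Integration.integral_sum) auto
    finally show ?thesis by simp
  qed
  also have "\<dots> \<le> (\<Sum>s=1..N. \<Sum>t=1..N. gap_bound k (if s \<le> t then t - s else s - t)) / (real N)\<^sup>2"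
    by (intro divide_right_mono sum_mono order_trans[OF abs_ge_self cov]) auto
  also have "\<dots> \<le> (\<Sum>s=1..N. mix_const k) / (real N)\<^sup>2"
    by (intro divide_right_mono sum_mono sum_gap_bound_le) auto
  also have "\<dots> = mix_const k / real N" using N by (simp add: power2_eq_square)
  finally show ?thesis .
qed

end

section \<open>Conjugate processes observed in cycles\<close>

text \<open>
Uniqueness of the baricenter: a distribution is determined by the integrals of bounded continuous
functions.
\<close>

lemma real_distribution_eqI_continuous:
  assumes N1: "real_distribution N1" and N2: "real_distribution N2"
    and eq: "\<And>f :: real \<Rightarrow> real. continuous_on UNIV f \<Longrightarrow> bounded (range f) \<Longrightarrow> (\<integral>x. f x \<partial>N1) = (\<integral>x. f x \<partial>N2)"
  shows "N1 = N2"
proof -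
  have le: "cdf A x \<le> cdf B x"
    if A: "real_distribution A" and B: "real_distribution B"
      and eq: "\<And>f :: real \<Rightarrow> real. continuous_on UNIV f \<Longrightarrow> bounded (range f) \<Longrightarrow> (\<integral>x. f x \<partial>A) = (\<integral>x. f x \<partial>B)"
    for A B x
  proof -
    interpret A: real_distribution A by fact
    interpret B: real_distribution B by fact
    have "cdf A x \<le> cdf B y" if "x < y" for y
    proof -
      have "cdf A x \<le> integral\<^sup>L A (cts_step x y)" by (rule A.cdf_cts_step[OF that])
      also have "\<dots> = integral\<^sup>L B (cts_step x y)"
        using that by (intro eq uniformly_continuous_imp_continuous cts_step_uniformly_continuous)
          (auto simp: cts_step_def bounded_iff intro!: exI[of _ 1])
      also have "\<dots> \<le> cdf B y" by (rule B.cdf_cts_step[OF that])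
      finally show ?thesis .
    qed
    then have "eventually (\<lambda>y. cdf A x \<le> cdf B y) (at_right x)"
      by (auto simp: eventually_at_right_field intro!: exI[of _ "x + 1"])
    moreover have "(cdf B \<longlongrightarrow> cdf B x) (at_right x)"
      using B.cdf_is_right_cont[of x] by (simp add: continuous_within)
    ultimately show ?thesis by (intro tendsto_lowerbound[of "cdf B" _ "at_right x"]) auto
  qed
  show ?thesis
    by (rule cdf_unique[OF N1 N2]) (auto intro!: ext antisym le N1 N2 eq simp: eq)
qed

lemma cdf_joint_measurable:
  assumes K: "K \<in> N \<rightarrow>\<^sub>M prob_algebra borel"
  shows "(\<lambda>(w, x). cdf (K w) x) \<in> borel_measurable (N \<Otimes>\<^sub>M borel)"
proof -
  have "(\<lambda>z. measure (K (fst z)) {..snd z}) \<in> borel_measurable (N \<Otimes>\<^sub>M borel)"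
  proof (rule measure_measurable_prob_algebra2)
    have "{z \<in> space ((N \<Otimes>\<^sub>M borel) \<Otimes>\<^sub>M borel). snd z \<le> snd (fst z)} \<in> sets ((N \<Otimes>\<^sub>M borel) \<Otimes>\<^sub>M (borel :: real measure))"
      by measurable
    also have "{z \<in> space ((N \<Otimes>\<^sub>M borel) \<Otimes>\<^sub>M borel). snd z \<le> snd (fst z)}
        = (SIGMA z:space (N \<Otimes>\<^sub>M borel). {..snd z :: real})"
      by (auto simp: space_pair_measure)
    finally show "(SIGMA z:space (N \<Otimes>\<^sub>M borel). {..snd z :: real}) \<in> sets ((N \<Otimes>\<^sub>M borel) \<Otimes>\<^sub>M borel)" .
    show "(\<lambda>z. K (fst z)) \<in> N \<Otimes>\<^sub>M borel \<rightarrow>\<^sub>M prob_algebra borel"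
      using K by measurable
  qed
  then show ?thesis by (simp add: cdf_def case_prod_beta)
qed

text \<open>
A cyclic-independent conjugate process of a stationary sequence of random distributions, observed
at finitely many times in each cycle with a summably psi-mixing sequence of empirical distribution
functions, together with the finite measure \<open>\<mu>\<close> defining the Hilbert space.
\<close>

locale conjugate_sample = prob_space M + L2: L2_space \<mu>
  for M :: "'a measure" and \<mu> :: "real measure" +
  fixes \<xi> :: "nat \<Rightarrow> 'a \<Rightarrow> real measure" and X :: "real \<Rightarrow> 'a \<Rightarrow> real"
    and q :: "nat \<Rightarrow> nat" and \<tau> :: "nat \<Rightarrow> nat \<Rightarrow> real"
  assumes stat: "stationary M \<xi>" and conj: "conjugate_process M \<xi> X" and cyc: "cyclic_independent M \<xi> X"
    and q_pos: "\<And>t. t \<ge> 1 \<Longrightarrow> q t \<ge> 1"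
    and tau: "\<And>t i. t \<ge> 1 \<Longrightarrow> i \<in> {1..q t} \<Longrightarrow> \<tau> t i \<in> {real t..<real t + 1}"
    and psi: "psi_summable M (Fcdf_hat X q \<tau>)"
begin

abbreviation "ip \<equiv> L2_inner \<mu>"
abbreviation "nrm \<equiv> L2_norm \<mu>"
abbreviation "kop \<equiv> kernel_op \<mu>"
abbreviation "mass \<equiv> measure \<mu> UNIV"
text \<open>
\<open>Fh\<close> and \<open>EFh\<close> are the empirical distribution functions and the estimated mean; \<open>Fc\<close> and \<open>Fhc\<close>
are \<open>F\<close> and \<open>Fh\<close> centred at the true mean \<open>EF\<close>.
\<close>

abbreviation "F \<equiv> Fcdf \<xi>"
abbreviation "EF \<equiv> EFcdf M \<xi>"
abbreviation "Fh \<equiv> Fcdf_hat X q \<tau>"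
abbreviation "EFh \<equiv> EFcdf_hat X q \<tau>"
abbreviation "Xi \<equiv> sigma_xi M \<xi>"
abbreviation "Fc t w \<equiv> (\<lambda>x. F t w x - EF x)"
abbreviation "Fhc t w \<equiv> (\<lambda>x. Fh t w x - EF x)"

lemma xi_meas [measurable]: "\<xi> t \<in> M \<rightarrow>\<^sub>M prob_algebra borel"
  using stat by (simp add: stationary_def)

lemma xi_path_meas: "(\<lambda>\<omega> t. \<xi> (t + k) \<omega>) \<in> M \<rightarrow>\<^sub>M (\<Pi>\<^sub>M t\<in>UNIV. prob_algebra borel)"
  by (rule measurable_PiM_single') (auto simp: space_PiM PiE_def intro!: measurable_space[OF xi_meas])

lemma subalg: "subalgebra M Xi"
  unfolding subalgebra_def sigma_xi_def
  using sets_image_in_sets[OF _ xi_path_meas[of 0]] by auto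

sublocale Xi: finite_measure_subalgebra M Xi
  by standard (rule subalg)

lemma xi_meas_Xi [measurable]: "\<xi> t \<in> Xi \<rightarrow>\<^sub>M prob_algebra borel"
proof -
  have "(\<lambda>\<omega> t. \<xi> t \<omega>) \<in> Xi \<rightarrow>\<^sub>M (\<Pi>\<^sub>M t\<in>UNIV. prob_algebra borel)"
    unfolding sigma_xi_def
    using measurable_space[OF xi_path_meas[of 0]] by (intro measurable_vimage_algebra1) auto
  from measurable_compose[OF this measurable_component_singleton[of t]] show ?thesis by simp
qed

lemma F_meas [measurable]: "(\<lambda>(w, x). F t w x) \<in> borel_measurable (M \<Otimes>\<^sub>M \<mu>)"
  using cdf_joint_measurable[OF xi_meas] unfolding Fcdf_def[abs_def] by measurable

lemma F_meas_Xi [measurable]: "(\<lambda>(w, x). F t w x) \<in> borel_measurable (Xi \<Otimes>\<^sub>M \<mu>)"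
  using cdf_joint_measurable[OF xi_meas_Xi] unfolding Fcdf_def[abs_def] by measurable

lemma F_meas1 [measurable]: "(\<lambda>w. F t w x) \<in> borel_measurable M"
  using measurable_compose[OF measurable_Pair2'[of x \<mu> M] F_meas] by simp

lemma F_meas1_Xi [measurable]: "(\<lambda>w. F t w x) \<in> borel_measurable Xi"
  using measurable_compose[OF measurable_Pair2'[of x \<mu> Xi] F_meas_Xi] by simp

lemma xi_prob: "w \<in> space M \<Longrightarrow> prob_space (\<xi> t w) \<and> sets (\<xi> t w) = sets borel"
  using measurable_space[OF xi_meas] by (simp add: space_prob_algebra)

lemma F_range: "w \<in> space M \<Longrightarrow> 0 \<le> F t w x \<and> F t w x \<le> 1"
  using xi_prob[of w t] by (auto simp: Fcdf_def cdf_def prob_space.prob_le_1)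

lemma F_integrable: "integrable M (\<lambda>w. F t w x)"
  by (rule integrable_const_bound[where B=1]) (use F_range in auto)

lemma coordinate_cdf_meas:
  "(\<lambda>z. measure (z i) {..x}) \<in> borel_measurable (\<Pi>\<^sub>M t\<in>(UNIV :: nat set). prob_algebra (borel :: real measure))"
proof -
  have "(\<lambda>z. z i) \<in> (\<Pi>\<^sub>M t\<in>(UNIV :: nat set). prob_algebra (borel :: real measure)) \<rightarrow>\<^sub>M prob_algebra borel"
    by (rule measurable_component_singleton) simp
  moreover have "(\<lambda>M. measure M {..x}) \<in> borel_measurable (prob_algebra (borel :: real measure))"
    by (rule measurable_measure_prob_algebra) simp
  ultimately show ?thesis by (rule measurable_compose)
qed

text \<open>
The baricenter is the mixture of the random distributions, by uniqueness, so its distribution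
function is the expectation of the random ones at every time.
\<close>

lemma expectation_F: "expectation (\<lambda>w. F t w x) = EF x"
proof -
  have "expectation (\<lambda>w. F t w x) = expectation (\<lambda>w. F 0 w x)"
  proof -
    let ?P = "\<Pi>\<^sub>M t\<in>UNIV. prob_algebra (borel :: real measure)"
    note m = coordinate_cdf_meas[of 0 x]
    have "expectation (\<lambda>w. F t w x) = (\<integral>z. measure (z 0) {..x} \<partial>distr M ?P (\<lambda>\<omega> s. \<xi> (s + t) \<omega>))"
      by (subst integral_distr[OF xi_path_meas m]) (simp add: Fcdf_def cdf_def)
    also have "distr M ?P (\<lambda>\<omega> s. \<xi> (s + t) \<omega>) = distr M ?P (\<lambda>\<omega> s. \<xi> (s + 0) \<omega>)"
      using stat by (simp add: stationary_def)
    also have "(\<integral>z. measure (z 0) {..x} \<partial>distr M ?P (\<lambda>\<omega> s. \<xi> (s + 0) \<omega>)) = expectation (\<lambda>w. F 0 w x)"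
      by (subst integral_distr[OF xi_path_meas m]) (simp add: Fcdf_def cdf_def)
    finally show ?thesis .
  qed
  also have "expectation (\<lambda>w. F 0 w x) = EF x"
  proof -
    \<comment> \<open>The mixture of the distributions \<open>\<xi> 0\<close>, for which the description of the baricenter is
      verified.\<close>
    let ?B = "M \<bind> \<xi> 0"
    have sm: "\<xi> 0 \<in> M \<rightarrow>\<^sub>M subprob_algebra borel" by (rule measurable_prob_algebraD[OF xi_meas])
    have sB: "sets ?B = sets borel" by (intro sets_bind not_empty) (use xi_prob in auto)
    interpret B: prob_space ?B
      by (rule prob_space_bind[OF _ sm]) (use xi_prob in auto)
    have rB: "real_distribution ?B"
      using sB by (auto intro!: real_distribution.intro B.prob_space_axioms real_distribution_axioms.intro)
    have iB: "(\<integral>\<omega>. (\<integral>x. f x \<partial>\<xi> 0 \<omega>) \<partial>M) = (\<integral>x. f x \<partial>?B)"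
      if cf: "continuous_on UNIV f" and bf: "bounded (range f)" for f :: "real \<Rightarrow> real"
    proof -
      obtain C where "\<And>x. \<bar>f x\<bar> \<le> C" using bf by (auto simp: bounded_iff)
      moreover have "f \<in> borel_measurable borel" using cf by (rule borel_measurable_continuous_onI)
      moreover have "AE x in M. emeasure (\<xi> 0 x) (space (\<xi> 0 x)) \<le> ennreal 1"
        using xi_prob by (auto simp: prob_space.emeasure_space_1)
      ultimately show ?thesis
        using integral_bind[OF _ _ sm finite_measure_axioms, of f C 1] by simp
    qed
    have "baricenter M (\<xi> 0) = ?B"
      unfolding baricenter_def
    proof (rule the_equality)
      show "real_distribution ?B \<and> (\<forall>f :: real \<Rightarrow> real. continuous_on UNIV f \<and> bounded (range f) \<longrightarrow>
        (\<integral>\<omega>. (\<integral>x. f x \<partial>\<xi> 0 \<omega>) \<partial>M) = (\<integral>x. f x \<partial>?B))"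
        using rB iB by auto
      fix \<nu> assume nu: "real_distribution \<nu> \<and> (\<forall>f :: real \<Rightarrow> real. continuous_on UNIV f \<and> bounded (range f) \<longrightarrow>
        (\<integral>\<omega>. (\<integral>x. f x \<partial>\<xi> 0 \<omega>) \<partial>M) = (\<integral>x. f x \<partial>\<nu>))"
      then show "\<nu> = ?B"
        using iB by (intro real_distribution_eqI_continuous rB) auto
    qed
    then have "EF x = measure ?B {..x}" by (simp add: EFcdf_def cdf_def)
    also have "\<dots> = expectation (\<lambda>w. measure (\<xi> 0 w) {..x})"
      by (rule subprob_space.measure_bind[OF prob_space_imp_subprob_space[OF prob_space_axioms] sm]) simp
    finally show ?thesis by (simp add: Fcdf_def cdf_def)
  qed
  finally show ?thesis .
qed

lemma expectation_FF: "expectation (\<lambda>w. F t w x * F (t + k) w y) = expectation (\<lambda>w. F 0 w x * F k w y)"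
proof -
  let ?P = "\<Pi>\<^sub>M t\<in>UNIV. prob_algebra (borel :: real measure)"
  have m: "(\<lambda>z. measure (z 0) {..x} * measure (z k) {..y}) \<in> borel_measurable ?P"
    by (intro borel_measurable_times coordinate_cdf_meas)
  have "expectation (\<lambda>w. F t w x * F (t + k) w y)
      = (\<integral>z. measure (z 0) {..x} * measure (z k) {..y} \<partial>distr M ?P (\<lambda>\<omega> s. \<xi> (s + t) \<omega>))"
    by (subst integral_distr[OF xi_path_meas m]) (simp add: Fcdf_def cdf_def add.commute)
  also have "distr M ?P (\<lambda>\<omega> s. \<xi> (s + t) \<omega>) = distr M ?P (\<lambda>\<omega> s. \<xi> (s + 0) \<omega>)"
    using stat by (simp add: stationary_def)
  also have "(\<integral>z. measure (z 0) {..x} * measure (z k) {..y} \<partial>distr M ?P (\<lambda>\<omega> s. \<xi> (s + 0) \<omega>))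
      = expectation (\<lambda>w. F 0 w x * F k w y)"
    by (subst integral_distr[OF xi_path_meas m]) (simp add: Fcdf_def cdf_def)
  finally show ?thesis .
qed

lemma EF_range: "0 \<le> EF x" "EF x \<le> 1"
  unfolding expectation_F[of 0, symmetric]
  using F_range F_integrable by (auto intro!: integral_nonneg_AE AE_I2 integral_le_const)

lemma EF_meas [measurable]: "EF \<in> borel_measurable \<mu>"
proof -
  have "(\<lambda>x. \<integral>w. F 0 w x \<partial>M) \<in> borel_measurable \<mu>" by measurable
  then show ?thesis by (simp add: expectation_F)
qed

lemma FF_integrable: "integrable M (\<lambda>w. F s w x * F t w y)"
proof (rule integrable_const_bound[where B=1])
  show "AE w in M. norm (F s w x * F t w y) \<le> 1"
    using F_range by (auto simp: abs_mult intro!: mult_le_one)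
qed simp

lemma Ckernel_eq: "Ckernel M \<xi> k x y = expectation (\<lambda>w. F 0 w x * F k w y) - EF x * EF y"
proof -
  have "Ckernel M \<xi> k x y = expectation (\<lambda>w. (F 0 w x - EF x) * (F k w y - EF y))"
    by (simp add: Ckernel_def covariance_def expectation_F)
  also have "\<dots> = expectation (\<lambda>w. F 0 w x * F k w y - EF y * F 0 w x - EF x * F k w y + EF x * EF y)"
    by (intro Bochner_Integration.integral_cong) (auto simp: algebra_simps)
  also have "\<dots> = expectation (\<lambda>w. F 0 w x * F k w y) - EF x * EF y"
    using FF_integrable F_integrable by (simp add: expectation_F prob_space mult.commute)
  finally show ?thesis .
qed

lemma Ckernel_abs_le: "\<bar>Ckernel M \<xi> k x y\<bar> \<le> 1"
proof -
  have "0 \<le> expectation (\<lambda>w. F 0 w x * F k w y)" "expectation (\<lambda>w. F 0 w x * F k w y) \<le> 1"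
    using F_range FF_integrable by (auto intro!: integral_nonneg_AE AE_I2 integral_le_const mult_le_one)
  moreover have "0 \<le> EF x * EF y" "EF x * EF y \<le> 1" using EF_range by (auto intro!: mult_le_one)
  ultimately show ?thesis unfolding Ckernel_eq by linarith
qed

lemma Ckernel_bdd: "L2.bdd_kernel (Ckernel M \<xi> k)"
proof -
  have "(\<lambda>(x, y). Ckernel M \<xi> k x y) \<in> borel_measurable (\<mu> \<Otimes>\<^sub>M \<mu>)"
    unfolding Ckernel_eq by measurable
  then show ?thesis unfolding L2.bdd_kernel_def using Ckernel_abs_le by blast
qed

lemma X_meas: "t \<ge> 1 \<Longrightarrow> i \<in> {1..q t} \<Longrightarrow> X (\<tau> t i) \<in> borel_measurable M"
proof -
  assume a: "t \<ge> 1" "i \<in> {1..q t}"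
  have "0 \<le> \<tau> t i" using tau[OF a] by simp
  then show ?thesis using conj unfolding conjugate_process_def by auto
qed

lemma Fh_meas [measurable]: "t \<ge> 1 \<Longrightarrow> (\<lambda>(w, x). Fh t w x) \<in> borel_measurable (M \<Otimes>\<^sub>M \<mu>)"
proof -
  assume t: "t \<ge> 1"
  have "(\<lambda>z. indicat_real {..snd z} (X (\<tau> t i) (fst z))) \<in> borel_measurable (M \<Otimes>\<^sub>M \<mu>)" if "i \<in> {1..q t}" for i
  proof -
    note [measurable] = X_meas[OF t that]
    have "(\<lambda>z. if X (\<tau> t i) (fst z) \<le> snd z then 1 else 0 :: real) \<in> borel_measurable (M \<Otimes>\<^sub>M \<mu>)" by measurable
    then show ?thesis by (simp add: indicator_def)
  qed
  then show ?thesis unfolding Fcdf_hat_def case_prod_beta by (intro borel_measurable_divide borel_measurable_sum) auto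
qed

lemma Fh_meas1 [measurable]: "t \<ge> 1 \<Longrightarrow> (\<lambda>w. Fh t w x) \<in> borel_measurable M"
  using measurable_compose[OF measurable_Pair2'[of x \<mu> M] Fh_meas[of t]] by simp

lemma Fh_range: "t \<ge> 1 \<Longrightarrow> 0 \<le> Fh t w x \<and> Fh t w x \<le> 1"
proof -
  assume t: "t \<ge> 1"
  have "(\<Sum>i=1..q t. indicat_real {..x} (X (\<tau> t i) w)) \<le> (\<Sum>i=1..q t. 1)"
    by (intro sum_mono) (auto simp: indicator_def)
  then show ?thesis using q_pos[OF t] unfolding Fcdf_hat_def
    by (auto intro!: divide_nonneg_nonneg sum_nonneg simp: divide_le_eq_1)
qed

lemma Fh_finite: "finite ((\<lambda>w. Fh t w x) ` S)"
proof (rule finite_subset)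
  show "(\<lambda>w. Fh t w x) ` S \<subseteq> (\<lambda>n. real n / real (q t)) ` {..q t}"
  proof (rule image_subsetI)
    fix w
    have "(\<Sum>i=1..q t. indicat_real {..x} (X (\<tau> t i) w)) = real (card {i \<in> {1..q t}. X (\<tau> t i) w \<le> x})"
      by (simp add: indicator_def sum.If_cases Int_def)
    moreover have "card {i \<in> {1..q t}. X (\<tau> t i) w \<le> x} \<le> card {1..q t}"
      by (intro card_mono) auto
    ultimately show "Fh t w x \<in> (\<lambda>n. real n / real (q t)) ` {..q t}"
      unfolding Fcdf_hat_def by auto
  qed
qed simp

sublocale mix: mixing M Fh
  by standard (use Fh_meas1 psi in auto)

text \<open>
Given \<open>\<Xi>\<close>, the empirical distribution function has conditional expectation \<open>F\<^sub>t\<close>.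
\<close>

lemma expectation_mult_Fh:
  assumes t: "t \<ge> 1" and g: "g \<in> borel_measurable Xi" and gb: "\<And>w. w \<in> space M \<Longrightarrow> \<bar>g w\<bar> \<le> C"
  shows "expectation (\<lambda>w. g w * Fh t w x) = expectation (\<lambda>w. g w * F t w x)"
proof -
  have [measurable]: "g \<in> borel_measurable M" by (rule measurable_from_subalg[OF subalg g])
  have gi: "integrable M (\<lambda>w. g w * indicat_real {..x} (X (\<tau> t i) w))" if "i \<in> {1..q t}" for i
  proof (rule integrable_const_bound[where B=C])
    show "AE w in M. norm (g w * indicat_real {..x} (X (\<tau> t i) w)) \<le> C"
      using gb order_trans[OF abs_ge_zero gb] by (auto simp: indicator_def)
  qed (use X_meas[OF t that] in measurable)
  have one: "expectation (\<lambda>w. g w * indicat_real {..x} (X (\<tau> t i) w)) = expectation (\<lambda>w. g w * F t w x)"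
    if i: "i \<in> {1..q t}" for i
  proof -
    have [measurable]: "(\<lambda>w. indicat_real {..x} (X (\<tau> t i) w)) \<in> borel_measurable M"
      using X_meas[OF t i] by measurable
    have ae: "AE w in M. real_cond_exp M Xi (\<lambda>w. indicat_real {..x} (X (\<tau> t i) w)) w = F t w x"
      using conj tau[OF t i] unfolding conjugate_process_def Fcdf_def cdf_def by auto
    have "expectation (\<lambda>w. g w * indicat_real {..x} (X (\<tau> t i) w))
        = expectation (\<lambda>w. g w * real_cond_exp M Xi (\<lambda>w. indicat_real {..x} (X (\<tau> t i) w)) w)"
      using gi[OF i] g by (intro Xi.real_cond_exp_intg(2)[symmetric]) auto
    also have "\<dots> = expectation (\<lambda>w. g w * F t w x)"
      using ae by (intro integral_cong_AE) auto
    finally show ?thesis .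
  qed
  have "expectation (\<lambda>w. g w * Fh t w x)
      = expectation (\<lambda>w. (\<Sum>i=1..q t. g w * indicat_real {..x} (X (\<tau> t i) w)) / real (q t))"
    by (simp add: Fcdf_hat_def sum_distrib_left)
  also have "\<dots> = (\<Sum>i=1..q t. expectation (\<lambda>w. g w * F t w x)) / real (q t)"
    by (simp only: integral_divide_zero Bochner_Integration.integral_sum[OF gi] one cong: sum.cong)
  also have "\<dots> = expectation (\<lambda>w. g w * F t w x)" using q_pos[OF t] by simp
  finally show ?thesis .
qed

lemma expectation_Fh: "t \<ge> 1 \<Longrightarrow> expectation (\<lambda>w. Fh t w x) = EF x"
  using expectation_mult_Fh[of t "\<lambda>_. 1" 1 x] by (simp add: expectation_F)

text \<open>
Different cycles are conditionally independent, which is where \<open>k \<ge> 1\<close> is needed; stationarity of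
\<open>\<xi>\<close> removes the dependence on \<open>t\<close>.
\<close>

lemma expectation_FhFh:
  assumes t: "t \<ge> 1" and k: "k \<ge> 1"
  shows "expectation (\<lambda>w. Fh t w x * Fh (t + k) w y) = expectation (\<lambda>w. F 0 w x * F k w y)"
proof -
  let ?s = "t + k"
  have s: "?s \<ge> 1" using t by simp
  let ?I = "\<lambda>t i x w. indicat_real {..x} (X (\<tau> t i) w)"
  have one: "expectation (\<lambda>w. ?I t i x w * ?I ?s j y w) = expectation (\<lambda>w. F t w x * F ?s w y)"
    if i: "i \<in> {1..q t}" and j: "j \<in> {1..q ?s}" for i j
  proof -
    note [measurable] = X_meas[OF t i] X_meas[OF s j]
    let ?At = "X (\<tau> t i) -` {..x} \<inter> space M" and ?As = "X (\<tau> ?s j) -` {..y} \<inter> space M"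
    define A where "A = (\<lambda>u. if u = t then ?At else ?As)"
    have A_t: "?At \<in> cycle_events M X t"
      unfolding cycle_events_def using tau[OF t i]
      by (intro sigma_sets.Basic CollectI exI[of _ "\<tau> t i"] exI[of _ "{..x}"]) simp
    have A_s: "?As \<in> cycle_events M X ?s"
      unfolding cycle_events_def using tau[OF s j]
      by (intro sigma_sets.Basic CollectI exI[of _ "\<tau> ?s j"] exI[of _ "{..y}"]) simp
    have "\<forall>u\<in>{t, ?s}. A u \<in> cycle_events M X u"
      using A_t A_s k by (simp add: A_def)
    then have ce: "AE w in M. real_cond_exp M Xi (indicat_real (\<Inter>u\<in>{t, ?s}. A u)) w =
           (\<Prod>u\<in>{t, ?s}. real_cond_exp M Xi (indicat_real (A u)) w)"
      using cyc[unfolded cyclic_independent_def, rule_format, of "{t, ?s}" A] by blast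
    have Int: "(\<Inter>u\<in>{t, ?s}. A u) = ?At \<inter> ?As" using k by (auto simp: A_def)
    have prod: "(\<Prod>u\<in>{t, ?s}. real_cond_exp M Xi (indicat_real (A u)) w)
        = real_cond_exp M Xi (indicat_real ?At) w * real_cond_exp M Xi (indicat_real ?As) w" for w
      using k by (simp add: A_def)
    have ct: "AE w in M. real_cond_exp M Xi (indicat_real ?At) w = F t w x"
    proof -
      have "AE w in M. real_cond_exp M Xi (indicat_real ?At) w = real_cond_exp M Xi (?I t i x) w"
        by (intro Xi.real_cond_exp_cong AE_I2) (auto simp: indicator_def)
      moreover have "AE w in M. real_cond_exp M Xi (?I t i x) w = F t w x"
        using conj tau[OF t i] unfolding conjugate_process_def Fcdf_def cdf_def by auto
      ultimately show ?thesis by eventually_elim simp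
    qed
    have cs: "AE w in M. real_cond_exp M Xi (indicat_real ?As) w = F ?s w y"
    proof -
      have "AE w in M. real_cond_exp M Xi (indicat_real ?As) w = real_cond_exp M Xi (?I ?s j y) w"
        by (intro Xi.real_cond_exp_cong AE_I2) (auto simp: indicator_def)
      moreover have "AE w in M. real_cond_exp M Xi (?I ?s j y) w = F ?s w y"
        using conj tau[OF s j] unfolding conjugate_process_def Fcdf_def cdf_def by auto
      ultimately show ?thesis by eventually_elim simp
    qed
    have "expectation (\<lambda>w. ?I t i x w * ?I ?s j y w) = expectation (indicat_real (?At \<inter> ?As))"
      by (intro Bochner_Integration.integral_cong) (auto simp: indicator_def)
    also have "\<dots> = expectation (real_cond_exp M Xi (indicat_real (?At \<inter> ?As)))"
      by (rule Xi.real_cond_exp_int(2)[symmetric]) (auto intro!: integrable_real_indicator simp: less_top[symmetric])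
    also have "\<dots> = expectation (\<lambda>w. F t w x * F ?s w y)"
    proof (rule integral_cong_AE)
      show "AE w in M. real_cond_exp M Xi (indicat_real (?At \<inter> ?As)) w = F t w x * F ?s w y"
        using ce ct cs unfolding Int prod by eventually_elim simp
    qed auto
    finally show ?thesis .
  qed
  have ii: "integrable M (\<lambda>w. ?I t i x w * ?I ?s j y w)" if "i \<in> {1..q t}" "j \<in> {1..q ?s}" for i j
  proof (rule integrable_const_bound[where B=1])
    show "(\<lambda>w. ?I t i x w * ?I ?s j y w) \<in> borel_measurable M"
      using X_meas[OF t that(1)] X_meas[OF s that(2)] by measurable
  qed (auto simp: indicator_def)
  have "expectation (\<lambda>w. Fh t w x * Fh ?s w y)
      = expectation (\<lambda>w. (\<Sum>i=1..q t. \<Sum>j=1..q ?s. ?I t i x w * ?I ?s j y w) / (real (q t) * real (q ?s)))"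
    by (simp add: Fcdf_hat_def sum_product)
  also have "\<dots> = (\<Sum>i=1..q t. expectation (\<lambda>w. \<Sum>j=1..q ?s. ?I t i x w * ?I ?s j y w)) / (real (q t) * real (q ?s))"
  proof -
    have "integrable M (\<lambda>w. \<Sum>j=1..q ?s. ?I t i x w * ?I ?s j y w)" if "i \<in> {1..q t}" for i
      by (rule Bochner_Integration.integrable_sum) (rule ii[OF that])
    note s = Bochner_Integration.integral_sum[OF this]
    show ?thesis by (simp only: integral_divide_zero s)
  qed
  also have "\<dots> = (\<Sum>i=1..q t. \<Sum>j=1..q ?s. expectation (\<lambda>w. F t w x * F ?s w y)) / (real (q t) * real (q ?s))"
    by (simp only: Bochner_Integration.integral_sum[OF ii] one cong: sum.cong)
  also have "\<dots> = expectation (\<lambda>w. F t w x * F ?s w y)"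
    using q_pos[OF t] q_pos[OF s] by simp
  also have "\<dots> = expectation (\<lambda>w. F 0 w x * F k w y)" by (rule expectation_FF)
  finally show ?thesis .
qed

end

section \<open>Root-n consistency of the empirical kernels\<close>

text \<open>
By Markov's inequality, a bound on the first absolute moments gives a rate in probability.
\<close>

lemma O_prob_if_L1:
  assumes M: "prob_space M"
    and Z: "\<forall>\<^sub>F n in sequentially. integrable M (Z n) \<and> (\<integral>w. \<bar>Z n w\<bar> \<partial>M) \<le> c * real n powr (- 1 / 2)"
  shows "O_prob M Z (\<lambda>n. real n powr (- 1 / 2))"
  unfolding O_prob_def
proof (intro conjI allI impI)
  interpret prob_space M by fact
  show "\<forall>\<^sub>F n in sequentially. Z n \<in> borel_measurable M"
    using Z by eventually_elim auto
  fix e :: real assume e: "e > 0"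
  define C where "C = (2 * (\<bar>c\<bar> + 1)) / e"
  have C: "C > 0" using e by (simp add: C_def)
  have "\<forall>\<^sub>F n in sequentially. prob {w \<in> space M. C * real n powr (- 1 / 2) < \<bar>Z n w\<bar>} < e"
    using Z eventually_gt_at_top[of 0]
  proof eventually_elim
    case (elim n)
    let ?a = "real n powr (- 1 / 2)"
    have a: "?a > 0" using elim by simp
    have i: "integrable M (\<lambda>w. \<bar>Z n w\<bar>)" using elim by auto
    have [measurable]: "Z n \<in> borel_measurable M" using elim by auto
    have "prob {w \<in> space M. C * ?a < \<bar>Z n w\<bar>} \<le> prob {w \<in> space M. C * ?a \<le> \<bar>Z n w\<bar>}"
      by (intro finite_measure_mono) auto
    also have "\<dots> \<le> (\<integral>w. \<bar>Z n w\<bar> \<partial>M) / (C * ?a)"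
      using integral_Markov_inequality_measure[OF i, of "space M" "C * ?a"] C a
      by (simp add: Collect_conj_eq)
    also have "\<dots> \<le> (\<bar>c\<bar> * ?a) / (C * ?a)"
      using elim C a by (intro divide_right_mono) (auto intro: order_trans mult_right_mono)
    also have "\<dots> = \<bar>c\<bar> / C" using a by simp
    also have "\<dots> < e"
    proof -
      have "\<bar>c\<bar> * e < e * (2 * (\<bar>c\<bar> + 1))" using e by (simp add: algebra_simps add_nonneg_pos)
      then show ?thesis using e by (simp add: C_def field_simps)
    qed
    finally show ?case .
  qed
  then show "\<exists>C>0. \<forall>\<^sub>F n in sequentially. prob {w \<in> space M. C * real n powr (- 1 / 2) < \<bar>Z n w\<bar>} < e"
    using C by blast
qed

lemma square_sum5_le: "(a + b + c + d + e)\<^sup>2 \<le> 5 * (a\<^sup>2 + b\<^sup>2 + c\<^sup>2 + d\<^sup>2 + (e::real)\<^sup>2)"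
proof -
  have "0 \<le> (a - b)\<^sup>2 + (a - c)\<^sup>2 + (a - d)\<^sup>2 + (a - e)\<^sup>2 + (b - c)\<^sup>2 + (b - d)\<^sup>2 + (b - e)\<^sup>2
      + (c - d)\<^sup>2 + (c - e)\<^sup>2 + (d - e)\<^sup>2" by simp
  then show ?thesis by (simp add: power2_eq_square algebra_simps)
qed

lemma product_error_le:
  fixes a b m k :: real
  assumes "0 \<le> a" "a \<le> 1" "0 \<le> k" "k \<le> 1"
  shows "\<bar>b * a - k * m\<bar> \<le> \<bar>b - k\<bar> + \<bar>a - m\<bar>"
proof -
  have "b * a - k * m = (b - k) * a + k * (a - m)" by (simp add: algebra_simps)
  then have "\<bar>b * a - k * m\<bar> \<le> \<bar>b - k\<bar> * a + k * \<bar>a - m\<bar>"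
    using abs_triangle_ineq[of "(b - k) * a" "k * (a - m)"] assms by (simp add: abs_mult)
  also have "\<dots> \<le> \<bar>b - k\<bar> * 1 + 1 * \<bar>a - m\<bar>"
    using assms by (intro add_mono mult_left_mono mult_right_mono) auto
  finally show ?thesis by simp
qed

context conjugate_sample
begin

lemma Fh_meas_comp [measurable (raw)]:
  assumes t: "t \<ge> 1" and [measurable]: "f \<in> N \<rightarrow>\<^sub>M M" "g \<in> N \<rightarrow>\<^sub>M \<mu>"
  shows "(\<lambda>z. Fh t (f z) (g z)) \<in> borel_measurable N"
proof -
  have "(\<lambda>z. (f z, g z)) \<in> N \<rightarrow>\<^sub>M M \<Otimes>\<^sub>M \<mu>" by measurable
  from measurable_compose[OF this Fh_meas[OF t]] show ?thesis by simp
qed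

lemma F_meas_comp [measurable (raw)]:
  assumes [measurable]: "f \<in> N \<rightarrow>\<^sub>M M" "g \<in> N \<rightarrow>\<^sub>M \<mu>"
  shows "(\<lambda>z. F t (f z) (g z)) \<in> borel_measurable N"
proof -
  have "(\<lambda>z. (f z, g z)) \<in> N \<rightarrow>\<^sub>M M \<Otimes>\<^sub>M \<mu>" by measurable
  from measurable_compose[OF this F_meas] show ?thesis by simp
qed

lemma EFh_meas_comp [measurable (raw)]:
  assumes [measurable]: "f \<in> N \<rightarrow>\<^sub>M M" "g \<in> N \<rightarrow>\<^sub>M \<mu>"
  shows "(\<lambda>z. EFh n (f z) (g z)) \<in> borel_measurable N"
  unfolding EFcdf_hat_def
  by (intro borel_measurable_divide borel_measurable_sum Fh_meas_comp) auto

lemma average_range: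
  fixes f :: "nat \<Rightarrow> real"
  assumes "\<And>t. t \<in> {1..n} \<Longrightarrow> 0 \<le> f t \<and> f t \<le> 1"
  shows "0 \<le> (\<Sum>t=1..n. f t) / real n" "(\<Sum>t=1..n. f t) / real n \<le> 1"
proof -
  have "(\<Sum>t=1..n. f t) \<le> (\<Sum>t=1..n. 1)" using assms by (intro sum_mono) auto
  then show "(\<Sum>t=1..n. f t) / real n \<le> 1" by (cases "n = 0") (auto simp: divide_le_eq_1)
  show "0 \<le> (\<Sum>t=1..n. f t) / real n" using assms by (intro divide_nonneg_nonneg sum_nonneg) auto
qed

lemma EFh_range: "0 \<le> EFh n w x" "EFh n w x \<le> 1"
  unfolding EFcdf_hat_def by (rule average_range; use Fh_range in force)+

lemma bounded_square_integrable:
  assumes "f \<in> borel_measurable M" "\<And>w. \<bar>f w\<bar> \<le> (C::real)"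
  shows "integrable M (\<lambda>w. (f w)\<^sup>2)"
proof (rule integrable_const_bound[where B="C\<^sup>2"])
  have "(f w)\<^sup>2 \<le> C\<^sup>2" for w using power_mono[OF assms(2), of w 2] by simp
  then show "AE w in M. norm ((f w)\<^sup>2) \<le> C\<^sup>2" by simp
qed (use assms(1) in measurable)

lemma Fh_sigma_meas: "t \<in> T \<Longrightarrow> (\<lambda>w. Fh t w x) \<in> borel_measurable (sigma_fun_space M Fh T)"
  by (rule sigma_fun_space_measurable)

lemma EFh_mean_square:
  assumes "n \<ge> 1"
  shows "expectation (\<lambda>w. (EFh n w x - EF x)\<^sup>2) \<le> mix.mix_const 0 / real n"
  unfolding EFcdf_hat_def
  by (rule mix.average_mean_square_le)
    (use assms Fh_range expectation_Fh in \<open>auto intro!: Fh_sigma_meas Fh_finite\<close>)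

abbreviation "Chat \<equiv> Ckernel_hat X q \<tau>"

lemma Chat_meas_comp [measurable (raw)]:
  assumes [measurable]: "f \<in> N \<rightarrow>\<^sub>M M" "g \<in> N \<rightarrow>\<^sub>M \<mu>" "h \<in> N \<rightarrow>\<^sub>M \<mu>"
  shows "(\<lambda>z. Chat p n k (f z) (g z) (h z)) \<in> borel_measurable N"
  unfolding Ckernel_hat_def
  by (intro borel_measurable_divide borel_measurable_sum borel_measurable_times borel_measurable_diff
      Fh_meas_comp EFh_meas_comp) auto

lemma Chat_abs_le: "\<bar>Chat p n k w x y\<bar> \<le> 1"
proof -
  have 1: "\<bar>Fh t w x - EFh n w x\<bar> \<le> 1" if "t \<ge> 1" for t x
    using Fh_range[OF that, of w x] EFh_range[of n w x] by (auto simp: abs_le_iff)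
  have "\<bar>\<Sum>t=1..n - p. (Fh t w x - EFh n w x) * (Fh (t + k) w y - EFh n w y)\<bar> \<le> (\<Sum>t=1..n - p. 1)"
    by (intro order_trans[OF sum_abs] sum_mono) (auto simp: abs_mult intro!: mult_le_one 1)
  then show ?thesis unfolding Ckernel_hat_def by (cases "n - p = 0") (auto simp: abs_mult divide_le_eq_1)
qed

lemma Chat_bdd:
  assumes [simp]: "w \<in> space M"
  shows "L2.bdd_kernel (Chat p n k w)"
proof -
  have "(\<lambda>z. Chat p n k w (fst z) (snd z)) \<in> borel_measurable (\<mu> \<Otimes>\<^sub>M \<mu>)" by measurable
  moreover have "\<exists>B. \<forall>x y. \<bar>Chat p n k w x y\<bar> \<le> B" using Chat_abs_le by blast
  ultimately show ?thesis unfolding L2.bdd_kernel_def by (simp add: case_prod_unfold)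
qed

text \<open>
The constant of the mean square error of the empirical covariances of lag \<open>k\<close>.
\<close>

definition Cconst :: "nat \<Rightarrow> real" where
  "Cconst k = 30 * mix.mix_const k + 40 * mix.mix_const 0"

lemma Cconst_nonneg: "0 \<le> Cconst k"
  by (simp add: Cconst_def mix.mix_const_nonneg)

text \<open>
The empirical covariance is a polynomial in averages of \<open>F'\<^sub>t(x) F'\<^sub>t\<^sub>+\<^sub>k(y)\<close>, \<open>F'\<^sub>t(x)\<close> and
\<open>F'\<^sub>t\<^sub>+\<^sub>k(y)\<close> with values in the unit interval, each of which has mean square error of order \<open>1 / n\<close>.
The condition \<open>n \<ge> 2 * p\<close> makes \<open>n - p\<close> comparable to \<open>n\<close>.
\<close>

lemma Chat_mean_square:
  assumes k: "k \<ge> 1" and np: "n > p" "n \<ge> 2 * p"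
  shows "expectation (\<lambda>w. (Chat p n k w x y - Ckernel M \<xi> k x y)\<^sup>2) \<le> Cconst k / real n"
proof -
  define N where "N = n - p"
  have N: "N \<ge> 1" "real n \<le> 2 * real N" using np by (auto simp: N_def of_nat_diff)
  define e where "e = expectation (\<lambda>w. F 0 w x * F k w y)"
  define A' where "A' w = (\<Sum>t=1..N. Fh t w x * Fh (t + k) w y) / real N" for w
  define a1 where "a1 w = (\<Sum>t=1..N. Fh t w x) / real N" for w
  define b1 where "b1 w = (\<Sum>t=1..N. Fh (t + k) w y) / real N" for w
  define a where "a w = EFh n w x" for w
  define b where "b w = EFh n w y" for w
  note rng = Fh_range
  have prng: "0 \<le> Fh t w x * Fh (t + k) w y \<and> Fh t w x * Fh (t + k) w y \<le> 1" if "t \<ge> 1" for t w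
    using rng[of t w x] rng[of "t + k" w y] that by (auto intro!: mult_le_one)
  have r1: "0 \<le> A' w" "A' w \<le> 1" "0 \<le> a1 w" "a1 w \<le> 1" "0 \<le> b1 w" "b1 w \<le> 1" for w
    unfolding A'_def a1_def b1_def
    by (rule average_range; use prng rng in force)+
  have r2: "0 \<le> a w" "a w \<le> 1" "0 \<le> b w" "b w \<le> 1" for w
    unfolding a_def b_def by (rule EFh_range)+
  note r = r1 r2
  have e01: "0 \<le> e" "e \<le> 1" unfolding e_def
    using F_range FF_integrable by (auto intro!: integral_nonneg_AE AE_I2 integral_le_const mult_le_one)
  have m: "A' \<in> borel_measurable M" "a1 \<in> borel_measurable M" "b1 \<in> borel_measurable M"
      "a \<in> borel_measurable M" "b \<in> borel_measurable M"
    unfolding A'_def[abs_def] a1_def[abs_def] b1_def[abs_def] a_def[abs_def] b_def[abs_def] EFcdf_hat_def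
    by (intro borel_measurable_divide borel_measurable_sum borel_measurable_times Fh_meas1; simp)+
  note [measurable] = m
  have prodfin: "finite ((\<lambda>w. Fh t w x * Fh (t + k) w y) ` space M)" for t
  proof (rule finite_subset)
    show "(\<lambda>w. Fh t w x * Fh (t + k) w y) ` space M
      \<subseteq> (\<lambda>(u, v). u * v) ` ((\<lambda>w. Fh t w x) ` space M \<times> (\<lambda>w. Fh (t + k) w y) ` space M)" by auto
  qed (use Fh_finite in auto)
  have sA: "expectation (\<lambda>w. (A' w - e)\<^sup>2) \<le> mix.mix_const k / real N"
    unfolding A'_def using prodfin prng k N
    by (intro mix.average_mean_square_le)
      (auto intro!: borel_measurable_times Fh_sigma_meas expectation_FhFh simp: e_def)
  have sa1: "expectation (\<lambda>w. (a1 w - EF x)\<^sup>2) \<le> mix.mix_const k / real N"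
    unfolding a1_def using rng N
    by (intro mix.average_mean_square_le) (auto intro!: Fh_sigma_meas expectation_Fh Fh_finite)
  have sb1: "expectation (\<lambda>w. (b1 w - EF y)\<^sup>2) \<le> mix.mix_const k / real N"
    unfolding b1_def using rng N
    by (intro mix.average_mean_square_le) (auto intro!: Fh_sigma_meas expectation_Fh Fh_finite)
  have sa: "expectation (\<lambda>w. (a w - EF x)\<^sup>2) \<le> mix.mix_const 0 / real n"
    and sb: "expectation (\<lambda>w. (b w - EF y)\<^sup>2) \<le> mix.mix_const 0 / real n"
    unfolding a_def b_def using np by (auto intro!: EFh_mean_square)
  have pw: "(Chat p n k w x y - Ckernel M \<xi> k x y)\<^sup>2
      \<le> 5 * ((A' w - e)\<^sup>2 + (a1 w - EF x)\<^sup>2 + (b1 w - EF y)\<^sup>2 + 4 * (a w - EF x)\<^sup>2 + 4 * (b w - EF y)\<^sup>2)" for w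
  proof -
    have "Chat p n k w x y = (\<Sum>t=1..N. Fh t w x * Fh (t + k) w y - b w * Fh t w x - a w * Fh (t + k) w y + a w * b w) / real N"
      unfolding Ckernel_hat_def N_def[symmetric] a_def b_def by (simp add: algebra_simps)
    also have "\<dots> = A' w - b w * a1 w - a w * b1 w + a w * b w"
      using N unfolding A'_def a1_def b1_def
      by (simp add: sum.distrib sum_subtractf sum_distrib_left add_divide_distrib diff_divide_distrib)
    finally have "Chat p n k w x y - Ckernel M \<xi> k x y
       = (A' w - e) - (b w * a1 w - EF y * EF x) - (a w * b1 w - EF x * EF y) + (a w * b w - EF x * EF y)"
      unfolding Ckernel_eq e_def by simp
    then have "\<bar>Chat p n k w x y - Ckernel M \<xi> k x y\<bar>
       \<le> \<bar>A' w - e\<bar> + \<bar>b w * a1 w - EF y * EF x\<bar> + \<bar>a w * b1 w - EF x * EF y\<bar> + \<bar>a w * b w - EF x * EF y\<bar>"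
      by linarith
    also have "\<dots> \<le> \<bar>A' w - e\<bar> + (\<bar>b w - EF y\<bar> + \<bar>a1 w - EF x\<bar>) + (\<bar>a w - EF x\<bar> + \<bar>b1 w - EF y\<bar>)
        + (\<bar>a w - EF x\<bar> + \<bar>b w - EF y\<bar>)"
      using r[of w] EF_range by (intro add_mono product_error_le order_refl) auto
    also have "\<dots> = \<bar>A' w - e\<bar> + \<bar>a1 w - EF x\<bar> + \<bar>b1 w - EF y\<bar> + 2 * \<bar>a w - EF x\<bar> + 2 * \<bar>b w - EF y\<bar>" by simp
    finally have "\<bar>Chat p n k w x y - Ckernel M \<xi> k x y\<bar>\<^sup>2
      \<le> (\<bar>A' w - e\<bar> + \<bar>a1 w - EF x\<bar> + \<bar>b1 w - EF y\<bar> + 2 * \<bar>a w - EF x\<bar> + 2 * \<bar>b w - EF y\<bar>)\<^sup>2"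
      by (rule power_mono) simp
    also have "\<dots> \<le> 5 * (\<bar>A' w - e\<bar>\<^sup>2 + \<bar>a1 w - EF x\<bar>\<^sup>2 + \<bar>b1 w - EF y\<bar>\<^sup>2 + (2 * \<bar>a w - EF x\<bar>)\<^sup>2 + (2 * \<bar>b w - EF y\<bar>)\<^sup>2)"
      by (rule square_sum5_le)
    finally show ?thesis by (simp add: power_mult_distrib)
  qed
  have bd: "\<bar>A' w - e\<bar> \<le> 1" "\<bar>a1 w - EF x\<bar> \<le> 1" "\<bar>b1 w - EF y\<bar> \<le> 1" "\<bar>a w - EF x\<bar> \<le> 1" "\<bar>b w - EF y\<bar> \<le> 1" for w
    using r[of w] e01 EF_range[of x] EF_range[of y] by (auto simp: abs_le_iff)
  have i: "integrable M (\<lambda>w. (A' w - e)\<^sup>2)" "integrable M (\<lambda>w. (a1 w - EF x)\<^sup>2)" "integrable M (\<lambda>w. (b1 w - EF y)\<^sup>2)"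
      "integrable M (\<lambda>w. (a w - EF x)\<^sup>2)" "integrable M (\<lambda>w. (b w - EF y)\<^sup>2)"
    by (rule bounded_square_integrable[OF _ bd(1)] bounded_square_integrable[OF _ bd(2)]
        bounded_square_integrable[OF _ bd(3)] bounded_square_integrable[OF _ bd(4)]
        bounded_square_integrable[OF _ bd(5)]; measurable)+
  have Cb: "\<bar>Chat p n k w x y - Ckernel M \<xi> k x y\<bar> \<le> 2" for w
    using Chat_abs_le[of p n k w x y] Ckernel_abs_le[of k x y] by linarith
  have Ci: "integrable M (\<lambda>w. (Chat p n k w x y - Ckernel M \<xi> k x y)\<^sup>2)"
    by (rule bounded_square_integrable[OF _ Cb]) measurable
  have "expectation (\<lambda>w. (Chat p n k w x y - Ckernel M \<xi> k x y)\<^sup>2)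
      \<le> expectation (\<lambda>w. 5 * ((A' w - e)\<^sup>2 + (a1 w - EF x)\<^sup>2 + (b1 w - EF y)\<^sup>2 + 4 * (a w - EF x)\<^sup>2 + 4 * (b w - EF y)\<^sup>2))"
    using Ci i by (intro integral_mono pw) auto
  also have "\<dots> = 5 * (expectation (\<lambda>w. (A' w - e)\<^sup>2) + expectation (\<lambda>w. (a1 w - EF x)\<^sup>2) + expectation (\<lambda>w. (b1 w - EF y)\<^sup>2)
      + 4 * expectation (\<lambda>w. (a w - EF x)\<^sup>2) + 4 * expectation (\<lambda>w. (b w - EF y)\<^sup>2))"
    using i by simp
  also have "\<dots> \<le> 5 * (mix.mix_const k / real N + mix.mix_const k / real N + mix.mix_const k / real N
      + 4 * (mix.mix_const 0 / real n) + 4 * (mix.mix_const 0 / real n))"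
    by (intro mult_left_mono add_mono sA sa1 sb1 sa sb) auto
  also have "\<dots> = 15 * (mix.mix_const k / real N) + 40 * mix.mix_const 0 / real n" by simp
  also have "\<dots> \<le> 15 * (mix.mix_const k * 2 / real n) + 40 * mix.mix_const 0 / real n"
  proof -
    have "mix.mix_const k * real n \<le> mix.mix_const k * (2 * real N)"
      using N(2) mix.mix_const_nonneg by (intro mult_left_mono) auto
    then show ?thesis using N np by (simp add: field_simps)
  qed
  also have "\<dots> = Cconst k / real n" by (simp add: Cconst_def add_divide_distrib)
  finally show ?thesis .
qed

text \<open>
The error of the empirical covariance of lag \<open>k\<close> in the Hilbert--Schmidt norm.
\<close>

definition kernel_error :: "nat \<Rightarrow> nat \<Rightarrow> nat \<Rightarrow> 'a \<Rightarrow> real" where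
  "kernel_error p n k w = L2.hs_norm (\<lambda>x y. Chat p n k w x y - Ckernel M \<xi> k x y)"

lemma kernel_error_L1:
  assumes k: "k \<ge> 1" and np: "n > p" "n \<ge> 2 * p"
  shows "integrable M (kernel_error p n k)"
    and "expectation (kernel_error p n k) \<le> sqrt (Cconst k * measure (\<mu> \<Otimes>\<^sub>M \<mu>) (space (\<mu> \<Otimes>\<^sub>M \<mu>))) * real n powr (- 1 / 2)"
proof -
  let ?N = "\<mu> \<Otimes>\<^sub>M \<mu>"
  let ?h = "\<lambda>w z. Chat p n k w (fst z) (snd z) - Ckernel M \<xi> k (fst z) (snd z)"
  have eq: "kernel_error p n k = (\<lambda>w. sqrt (\<integral>z. (?h w z)\<^sup>2 \<partial>?N))"
    unfolding kernel_error_def[abs_def] L2.hs_norm_def by (simp add: case_prod_unfold)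
  have fN: "finite_measure ?N"
    by (intro finite_measure_pair_measure L2.finite_measure_axioms)
  have [measurable]: "(\<lambda>z. Ckernel M \<xi> k (fst z) (snd z)) \<in> borel_measurable ?N"
    using L2.bdd_kernel_measurable[OF Ckernel_bdd, of k] by (simp add: case_prod_unfold)
  have mm: "(\<lambda>(w, z). ?h w z) \<in> borel_measurable (M \<Otimes>\<^sub>M ?N)" by measurable
  have b: "\<bar>?h w z\<bar> \<le> 2" for w z
    using Chat_abs_le[of p n k w "fst z" "snd z"] Ckernel_abs_le[of k "fst z" "snd z"] by linarith
  note * = expectation_sqrt_integral_le[OF fN mm b Chat_mean_square[OF assms]]
  show "integrable M (kernel_error p n k)" unfolding eq by (rule *(1))
  have "expectation (kernel_error p n k) \<le> sqrt (Cconst k / real n * measure ?N (space ?N))"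
    unfolding eq by (rule *(2))
  also have "\<dots> = sqrt (Cconst k * measure ?N (space ?N)) * real n powr (- 1 / 2)"
    using np by (simp add: real_sqrt_divide real_sqrt_mult powr_minus_divide powr_half_sqrt[symmetric] field_simps)
  finally show "expectation (kernel_error p n k) \<le> sqrt (Cconst k * measure ?N (space ?N)) * real n powr (- 1 / 2)" .
qed

text \<open>
The error of the estimated mean distribution function in the Hilbert space.
\<close>

definition mean_error :: "nat \<Rightarrow> 'a \<Rightarrow> real" where
  "mean_error n w = nrm (\<lambda>x. EFh n w x - EF x)"

lemma mean_error_L1:
  assumes n: "n \<ge> 1"
  shows "integrable M (mean_error n)"
    and "expectation (mean_error n) \<le> sqrt (mix.mix_const 0 * mass) * real n powr (- 1 / 2)"
proof -
  have eq: "mean_error n = (\<lambda>w. sqrt (\<integral>z. (EFh n w z - EF z)\<^sup>2 \<partial>\<mu>))"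
    unfolding mean_error_def[abs_def] L2_norm_def L2_inner_def by (simp add: power2_eq_square)
  have mm: "(\<lambda>(w, z). EFh n w z - EF z) \<in> borel_measurable (M \<Otimes>\<^sub>M \<mu>)" by measurable
  have b: "\<bar>EFh n w z - EF z\<bar> \<le> 1" for w z
    using EFh_range[of n w z] EF_range[of z] by (auto simp: abs_le_iff)
  note * = expectation_sqrt_integral_le[OF L2.finite_measure_axioms mm b EFh_mean_square[OF n]]
  show "integrable M (mean_error n)" unfolding eq by (rule *(1))
  have "expectation (mean_error n) \<le> sqrt (mix.mix_const 0 / real n * measure \<mu> (space \<mu>))"
    unfolding eq by (rule *(2))
  also have "\<dots> = sqrt (mix.mix_const 0 * mass) * real n powr (- 1 / 2)"
    using n by (simp add: real_sqrt_divide real_sqrt_mult powr_minus_divide powr_half_sqrt[symmetric] field_simps)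
  finally show "expectation (mean_error n) \<le> sqrt (mix.mix_const 0 * mass) * real n powr (- 1 / 2)" .
qed

text \<open>
The random variable that controls the errors of all estimated scores.
\<close>

definition total_error :: "nat \<Rightarrow> nat \<Rightarrow> 'a \<Rightarrow> real" where
  "total_error p n w = (\<Sum>k=1..p. kernel_error p n k w) + mean_error n w"

lemma kernel_error_nonneg [simp]: "0 \<le> kernel_error p n k w"
  by (simp add: kernel_error_def L2.hs_norm_nonneg)

lemma mean_error_nonneg [simp]: "0 \<le> mean_error n w"
  by (simp add: mean_error_def L2.norm_nonneg)

lemma total_error_nonneg [simp]: "0 \<le> total_error p n w"
  by (simp add: total_error_def sum_nonneg)

lemma total_error_L1:
  obtains c where "c \<ge> 0" "\<And>n. n > p \<Longrightarrow> n \<ge> 2 * p \<Longrightarrow> integrable M (total_error p n)"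
    "\<And>n. n > p \<Longrightarrow> n \<ge> 2 * p \<Longrightarrow> expectation (total_error p n) \<le> c * real n powr (- 1 / 2)"
proof
  let ?s = "\<lambda>k. sqrt (Cconst k * measure (\<mu> \<Otimes>\<^sub>M \<mu>) (space (\<mu> \<Otimes>\<^sub>M \<mu>)))"
  let ?c = "(\<Sum>k=1..p. ?s k) + sqrt (mix.mix_const 0 * mass)"
  show "?c \<ge> 0" by (intro add_nonneg_nonneg sum_nonneg) (auto simp: Cconst_nonneg mix.mix_const_nonneg)
  fix n assume np: "n > p" "n \<ge> 2 * p"
  have i: "integrable M (\<lambda>w. \<Sum>k=1..p. kernel_error p n k w)" "integrable M (mean_error n)"
    using kernel_error_L1(1)[OF _ np] mean_error_L1(1)[of n] np by auto
  then show "integrable M (total_error p n)" unfolding total_error_def[abs_def] by auto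
  have "expectation (total_error p n) = (\<Sum>k=1..p. expectation (kernel_error p n k)) + expectation (mean_error n)"
    unfolding total_error_def[abs_def] using i kernel_error_L1(1)[OF _ np] by simp
  also have "\<dots> \<le> (\<Sum>k=1..p. ?s k * real n powr (- 1 / 2)) + sqrt (mix.mix_const 0 * mass) * real n powr (- 1 / 2)"
    using kernel_error_L1(2)[OF _ np] mean_error_L1(2)[of n] np by (intro add_mono sum_mono) auto
  also have "\<dots> = ?c * real n powr (- 1 / 2)" by (simp add: distrib_right sum_distrib_right)
  finally show "expectation (total_error p n) \<le> ?c * real n powr (- 1 / 2)" .
qed

end

context L2_space
begin

lemma indicator_L2 [simp]: "A \<in> sets borel \<Longrightarrow> indicat_real A \<in> L2 \<mu>"
  by (rule L2_bounded[where B=1]) (auto simp: indicator_def sets_mu)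

section \<open>Moments and measurability of the scores\<close>

text \<open>
Countably many functionals determine an element of the space almost everywhere. The positive and
negative parts of \<open>f\<close> are densities of two measures whose distribution functions agree at the
rationals, hence everywhere by right-continuity.
\<close>

lemma AE_zero_if_orthogonal_half_lines:
  assumes f: "f \<in> L2 \<mu>" and z: "\<And>r. r \<in> \<rat> \<Longrightarrow> ip f (indicat_real {..r}) = 0"
  shows "AE x in \<mu>. f x = 0"
proof -
  have [measurable]: "f \<in> borel_measurable \<mu>" using f by (rule L2_measurable)
  have fi: "integrable \<mu> f" using f by (rule L2_integrable)
  define N where "N s = density \<mu> (\<lambda>x. ennreal (s * f x))" for s :: real
  have fin: "finite_borel_measure (N s)" if s: "\<bar>s\<bar> = 1" for s
  proof -
    have "emeasure (N s) (space (N s)) = (\<integral>\<^sup>+x. ennreal (s * f x) \<partial>\<mu>)"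
      unfolding N_def by (subst emeasure_density) (auto intro!: nn_integral_cong)
    also have "\<dots> \<le> (\<integral>\<^sup>+x. ennreal (norm (f x)) \<partial>\<mu>)"
    proof (intro nn_integral_mono ennreal_leI)
      fix x have "s * f x \<le> \<bar>s * f x\<bar>" by simp
      then show "s * f x \<le> norm (f x)" using s by (simp add: abs_mult)
    qed
    also have "\<dots> < \<infinity>" using fi by (simp add: integrable_iff_bounded)
    finally have "finite_measure (N s)" by (intro finite_measureI) simp
    then show ?thesis
      by (intro finite_borel_measure.intro finite_borel_measure_axioms.intro) (auto simp: N_def sets_mu)
  qed
  have mN: "measure (N s) {..r} = (\<integral>x. max 0 (s * f x) * indicator {..r} x \<partial>\<mu>)" for s r
  proof -
    have "emeasure (N s) {..r} = (\<integral>\<^sup>+x. ennreal (max 0 (s * f x) * indicator {..r} x) \<partial>\<mu>)"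
      unfolding N_def by (subst emeasure_density)
        (auto intro!: nn_integral_cong simp: sets_mu max_def indicator_def ennreal_neg)
    moreover have "integrable \<mu> (\<lambda>x. max 0 (s * f x) * indicator {..r} x)"
      using fi by (intro integrable_real_mult_indicator integrable_max) (auto simp: sets_mu)
    ultimately have "emeasure (N s) {..r} = ennreal (\<integral>x. max 0 (s * f x) * indicator {..r} x \<partial>\<mu>)"
      by (subst nn_integral_eq_integral[symmetric]) auto
    then show ?thesis by (simp add: measure_def)
  qed
  have cdf_rat: "cdf (N 1) r = cdf (N (-1)) r" if "r \<in> \<rat>" for r
  proof -
    have i: "integrable \<mu> (\<lambda>x. max 0 (s * f x) * indicator {..r} x)" for s
      using fi by (intro integrable_real_mult_indicator integrable_max) (auto simp: sets_mu)
    have "cdf (N 1) r - cdf (N (-1)) r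
        = (\<integral>x. max 0 (1 * f x) * indicator {..r} x - max 0 ((-1) * f x) * indicator {..r} x \<partial>\<mu>)"
      unfolding cdf_def mN by (rule Bochner_Integration.integral_diff[OF i i, symmetric])
    also have "\<dots> = ip f (indicat_real {..r})"
      unfolding L2_inner_def by (intro Bochner_Integration.integral_cong) (auto simp: max_def indicator_def)
    finally show ?thesis using z[OF that] by simp
  qed
  have "cdf (N 1) = cdf (N (-1))"
  proof
    fix x
    have rc: "((\<lambda>y. cdf (N s) y) \<longlongrightarrow> cdf (N s) x) (at_right x)" if "\<bar>s\<bar> = 1" for s
      using finite_borel_measure.cdf_is_right_cont[OF fin[OF that], of x] by (simp add: continuous_within)
    have "\<exists>y. x < y \<and> y < x + 1 / real (Suc n) \<and> y \<in> \<rat>" for n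
      using Rats_dense_in_real[of x "x + 1 / real (Suc n)"] by auto
    then obtain y where y: "\<And>n. x < y n" "\<And>n. y n < x + 1 / real (Suc n)" "\<And>n. y n \<in> \<rat>" by metis
    have "y \<longlonglongrightarrow> x"
    proof (rule tendsto_sandwich)
      show "\<forall>\<^sub>F n in sequentially. x \<le> y n" using y(1) by (intro always_eventually allI less_imp_le)
      show "\<forall>\<^sub>F n in sequentially. y n \<le> x + 1 / real (Suc n)" using y(2) by (intro always_eventually allI less_imp_le)
      show "(\<lambda>n. x + 1 / real (Suc n)) \<longlonglongrightarrow> x"
        using tendsto_add[OF tendsto_const LIMSEQ_inverse_real_of_nat, of x] by (simp add: inverse_eq_divide)
    qed simp
    then have "filterlim y (at_right x) sequentially"
      using y(1) by (auto simp: filterlim_at intro!: always_eventually)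
    then have lim: "(\<lambda>n. cdf (N s) (y n)) \<longlonglongrightarrow> cdf (N s) x" if "\<bar>s\<bar> = 1" for s
      using rc[OF that] by (rule filterlim_compose[rotated])
    have "(\<lambda>n. cdf (N 1) (y n)) \<longlonglongrightarrow> cdf (N (-1)) x"
      using lim[of "-1"] cdf_rat[OF y(3)] by simp
    then show "cdf (N 1) x = cdf (N (-1)) x" using lim[of 1] LIMSEQ_unique by auto
  qed
  then have "N 1 = N (-1)" by (intro cdf_unique' fin) auto
  then have "AE x in \<mu>. ennreal (1 * f x) = ennreal ((-1) * f x)"
    unfolding N_def by (intro density_unique) auto
  then show ?thesis
  proof eventually_elim
    case (elim x)
    then show ?case by (cases "f x \<ge> 0") (auto simp: ennreal_neg ennreal_eq_0_iff dest!: sym)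
  qed
qed

text \<open>
Here both arguments of the inner product are random. Rounding \<open>Y\<close> down to multiples of
\<open>1 / (m + 1)\<close> leaves countably many half-lines, to each of which weak measurability of \<open>\<phi>\<close> applies;
since the half-lines contain their left end points, the indicators converge pointwise.
\<close>

lemma random_half_line_inner_measurable:
  assumes Y [measurable]: "Y \<in> borel_measurable M" and phi: "random_L2 M \<mu> \<phi>"
  shows "(\<lambda>w. ip (\<lambda>x. indicat_real {..x} (Y w)) (\<phi> w)) \<in> borel_measurable M"
proof (rule borel_measurable_LIMSEQ_real)
  let ?Y = "\<lambda>m w. real_of_int \<lfloor>real (Suc m) * Y w\<rfloor> / real (Suc m)"
  have P: "\<phi> w \<in> L2 \<mu>" if "w \<in> space M" for w using phi that by (simp add: random_L2_def)
  have Pm: "(\<lambda>w. ip (indicat_real {a..}) (\<phi> w)) \<in> borel_measurable M" for a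
  proof -
    have "(\<lambda>w. ip (\<phi> w) (indicat_real {a..})) \<in> borel_measurable M"
      using phi indicator_L2[of "{a..}"] unfolding random_L2_def by auto
    then show ?thesis by (subst inner_commute)
  qed
  show "(\<lambda>w. ip (indicat_real {?Y m w..}) (\<phi> w)) \<in> borel_measurable M" for m
  proof (rule measurable_compose_countable[where g="\<lambda>w. \<lfloor>real (Suc m) * Y w\<rfloor>"])
    show "(\<lambda>w. ip (indicat_real {real_of_int i / real (Suc m)..}) (\<phi> w)) \<in> borel_measurable M" for i
      by (rule Pm)
  qed measurable
  fix w assume w: "w \<in> space M"
  have [measurable]: "\<phi> w \<in> borel_measurable \<mu>" using P[OF w] by (rule L2_measurable)
  show "(\<lambda>m. ip (indicat_real {?Y m w..}) (\<phi> w)) \<longlonglongrightarrow> ip (\<lambda>x. indicat_real {..x} (Y w)) (\<phi> w)"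
    unfolding L2_inner_def
  proof (rule integral_dominated_convergence)
    show "integrable \<mu> (\<lambda>x. \<bar>\<phi> w x\<bar>)" using L2_integrable[OF P[OF w]] by simp
    show "AE x in \<mu>. norm (indicat_real {?Y m w..} x * \<phi> w x) \<le> \<bar>\<phi> w x\<bar>" for m
      by (auto simp: indicator_def)
    have le: "?Y m w \<le> Y w" for m
    proof -
      have "real_of_int \<lfloor>real (Suc m) * Y w\<rfloor> \<le> real (Suc m) * Y w" by (rule of_int_floor_le)
      then show ?thesis by (simp add: divide_le_eq mult.commute)
    qed
    have ge: "Y w - 1 / real (Suc m) < ?Y m w" for m
    proof -
      have "real (Suc m) * Y w - 1 < real_of_int \<lfloor>real (Suc m) * Y w\<rfloor>" by linarith
      then have "(real (Suc m) * Y w - 1) / real (Suc m) < ?Y m w" by (intro divide_strict_right_mono) auto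
      then show ?thesis by (simp add: diff_divide_distrib)
    qed
    have lim: "(\<lambda>m. ?Y m w) \<longlonglongrightarrow> Y w"
    proof (rule tendsto_sandwich)
      show "\<forall>\<^sub>F m in sequentially. ?Y m w \<le> Y w" using le by (intro always_eventually allI)
      show "\<forall>\<^sub>F m in sequentially. Y w - 1 / real (Suc m) \<le> ?Y m w" using ge by (intro always_eventually allI less_imp_le)
      show "(\<lambda>m. Y w - 1 / real (Suc m)) \<longlonglongrightarrow> Y w"
        using tendsto_diff[OF tendsto_const LIMSEQ_inverse_real_of_nat, of "Y w"] by (simp add: inverse_eq_divide)
    qed simp
    show "AE x in \<mu>. (\<lambda>m. indicat_real {?Y m w..} x * \<phi> w x) \<longlonglongrightarrow> indicat_real {..x} (Y w) * \<phi> w x"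
    proof (rule AE_I2)
      fix x
      have "eventually (\<lambda>m. indicat_real {?Y m w..} x = indicat_real {..x} (Y w)) sequentially"
      proof (cases "Y w \<le> x")
        case True
        then show ?thesis using order_trans[OF le True] by (intro always_eventually) (auto simp: indicator_def)
      next
        case False
        then have "eventually (\<lambda>m. x < ?Y m w) sequentially" using lim by (intro order_tendstoD(1)) auto
        then show ?thesis by eventually_elim (use False in \<open>auto simp: indicator_def\<close>)
      qed
      then have "(\<lambda>m. indicat_real {?Y m w..} x) \<longlonglongrightarrow> indicat_real {..x} (Y w)"
        by (rule tendsto_eventually)
      then show "(\<lambda>m. indicat_real {?Y m w..} x * \<phi> w x) \<longlonglongrightarrow> indicat_real {..x} (Y w) * \<phi> w x"
        by (intro tendsto_intros)
    qed
  qed (measurable, auto simp: sets_mu)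
qed

end

context conjugate_sample
begin

lemma Fh_L2: "w \<in> space M \<Longrightarrow> t \<ge> 1 \<Longrightarrow> Fh t w \<in> L2 \<mu>"
  using Fh_range by (intro L2.L2_bounded[where B=1]) auto

lemma F_L2: "w \<in> space M \<Longrightarrow> F t w \<in> L2 \<mu>"
proof (rule L2.L2_bounded[where B=1])
  assume w: "w \<in> space M"
  then show "F t w \<in> borel_measurable \<mu>" by measurable
  show "\<bar>F t w x\<bar> \<le> 1" for x using F_range[OF w, of t x] by simp
qed

lemma EF_L2: "EF \<in> L2 \<mu>"
  using EF_range by (intro L2.L2_bounded[where B=1]) auto

lemma EFh_L2: "w \<in> space M \<Longrightarrow> EFh n w \<in> L2 \<mu>"
  using EFh_range by (intro L2.L2_bounded[where B=1]) auto

lemma expectation_mult_inner: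
  assumes hm [measurable]: "(\<lambda>(w, x). h w x) \<in> borel_measurable (M \<Otimes>\<^sub>M \<mu>)"
    and hb: "\<And>w x. w \<in> space M \<Longrightarrow> \<bar>h w x\<bar> \<le> 1"
    and g [measurable]: "g \<in> borel_measurable M" and gb: "\<And>w. w \<in> space M \<Longrightarrow> \<bar>g w\<bar> \<le> 1"
    and f: "f \<in> L2 \<mu>"
  shows "expectation (\<lambda>w. g w * ip (h w) f) = (\<integral>x. expectation (\<lambda>w. g w * h w x) * f x \<partial>\<mu>)"
proof -
  interpret P: pair_sigma_finite M \<mu> ..
  have fm [measurable]: "f \<in> borel_measurable \<mu>" using f by (rule L2.L2_measurable)
  have fi: "integrable \<mu> f" using f by (rule L2.L2_integrable)
  have "integrable (M \<Otimes>\<^sub>M \<mu>) (\<lambda>(w, x). f x)"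
    using fi by (intro P.Fubini_integrable) auto
  then have i: "integrable (M \<Otimes>\<^sub>M \<mu>) (\<lambda>(w, x). g w * h w x * f x)"
  proof (rule Bochner_Integration.integrable_bound)
    show "AE z in M \<Otimes>\<^sub>M \<mu>. norm (case z of (w, x) \<Rightarrow> g w * h w x * f x) \<le> norm (case z of (w, x) \<Rightarrow> f x)"
    proof (rule AE_I2)
      fix z assume "z \<in> space (M \<Otimes>\<^sub>M \<mu>)"
      then obtain w x where z: "z = (w, x)" "w \<in> space M" by (auto simp: space_pair_measure)
      have "\<bar>g w * h w x\<bar> \<le> 1" unfolding abs_mult using z hb gb by (intro mult_le_one) auto
      then have "\<bar>g w * h w x\<bar> * \<bar>f x\<bar> \<le> 1 * \<bar>f x\<bar>" by (rule mult_right_mono) simp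
      then show "norm (case z of (w, x) \<Rightarrow> g w * h w x * f x) \<le> norm (case z of (w, x) \<Rightarrow> f x)"
        using z by (simp add: abs_mult)
    qed
  qed measurable
  have "expectation (\<lambda>w. g w * ip (h w) f) = expectation (\<lambda>w. \<integral>x. g w * h w x * f x \<partial>\<mu>)"
    by (simp add: L2_inner_def mult.assoc)
  also have "\<dots> = (\<integral>x. expectation (\<lambda>w. g w * h w x * f x) \<partial>\<mu>)"
    by (rule P.Fubini_integral[OF i, symmetric])
  finally show ?thesis by simp
qed

lemma W_measurable_Xi: "f \<in> L2 \<mu> \<Longrightarrow> (\<lambda>w. ip (Fc t w) f) \<in> borel_measurable Xi"
proof -
  assume "f \<in> L2 \<mu>"
  note [measurable] = L2.L2_measurable[OF this] F_meas_Xi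
  show ?thesis unfolding L2_inner_def by measurable
qed

lemma W_measurable: "f \<in> L2 \<mu> \<Longrightarrow> (\<lambda>w. ip (Fc t w) f) \<in> borel_measurable M"
  by (rule measurable_from_subalg[OF subalg W_measurable_Xi])

lemma W_abs_le:
  assumes w: "w \<in> space M" and f: "f \<in> L2 \<mu>"
  shows "\<bar>ip (Fc t w) f\<bar> \<le> sqrt (mass) * nrm f"
    and "t \<ge> 1 \<Longrightarrow> \<bar>ip (Fhc t w) f\<bar> \<le> sqrt (mass) * nrm f"
    and "t \<ge> 1 \<Longrightarrow> \<bar>ip (\<lambda>x. Fh t w x - EFh n w x) f\<bar> \<le> sqrt (mass) * nrm f"
proof -
  note L = L2.L2_measurable[OF L2.L2_diff]
  have "\<bar>F t w x - EF x\<bar> \<le> 1" for x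
    using F_range[OF w, of t x] EF_range[of x] by (auto simp: abs_le_iff)
  then show "\<bar>ip (Fc t w) f\<bar> \<le> sqrt (mass) * nrm f"
    by (intro L2.inner_bounded_abs_le L F_L2 EF_L2 w f)
  assume t: "t \<ge> 1"
  have "\<bar>Fh t w x - EF x\<bar> \<le> 1" for x
    using Fh_range[OF t, of w x] EF_range[of x] by (auto simp: abs_le_iff)
  then show "\<bar>ip (Fhc t w) f\<bar> \<le> sqrt (mass) * nrm f"
    by (intro L2.inner_bounded_abs_le L Fh_L2 EF_L2 w t f)
  have "\<bar>Fh t w x - EFh n w x\<bar> \<le> 1" for x
    using Fh_range[OF t, of w x] EFh_range[of n w x] by (auto simp: abs_le_iff)
  then show "\<bar>ip (\<lambda>x. Fh t w x - EFh n w x) f\<bar> \<le> sqrt (mass) * nrm f"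
    by (intro L2.inner_bounded_abs_le L Fh_L2 EFh_L2 w t f)
qed

text \<open>
Conditional expectation given \<open>\<Xi>\<close> commutes with the inner product with a fixed function.
\<close>

lemma cond_exp_score:
  assumes t: "t \<ge> 1" and f: "f \<in> L2 \<mu>"
  shows "AE w in M. real_cond_exp M Xi (\<lambda>w. ip (Fhc t w) f) w
    = ip (Fc t w) f"
proof (rule Xi.real_cond_exp_charact)
  have fm [measurable]: "f \<in> borel_measurable \<mu>" using f by (rule L2.L2_measurable)
  let ?V = "\<lambda>w. ip (Fhc t w) f" and ?W = "\<lambda>w. ip (Fc t w) f"
  have Vm: "?V \<in> borel_measurable M" unfolding L2_inner_def using t by measurable
  show "integrable M ?V"
    using W_abs_le(2)[OF _ f t] by (intro integrable_const_bound[where B="sqrt (mass) * nrm f"] Vm) auto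
  show "integrable M ?W"
    using W_abs_le(1)[OF _ f] by (intro integrable_const_bound[where B="sqrt (mass) * nrm f"] W_measurable f) auto
  show "?W \<in> borel_measurable Xi" by (rule W_measurable_Xi[OF f])
  fix A assume A: "A \<in> sets Xi"
  let ?g = "indicat_real A"
  have gX [measurable]: "?g \<in> borel_measurable Xi" using A by simp
  have gM [measurable]: "?g \<in> borel_measurable M" by (rule measurable_from_subalg[OF subalg gX])
  have g1: "\<bar>?g w\<bar> \<le> 1" for w by (simp add: indicator_def)
  have b1: "\<bar>Fh t w x - EF x\<bar> \<le> 1" for w x
    using Fh_range[OF t, of w x] EF_range[of x] by (auto simp: abs_le_iff)
  have b2: "\<bar>F t w x - EF x\<bar> \<le> 1" if "w \<in> space M" for w x
    using F_range[OF that, of t x] EF_range[of x] by (auto simp: abs_le_iff)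
  have m1: "(\<lambda>(w, x). Fh t w x - EF x) \<in> borel_measurable (M \<Otimes>\<^sub>M \<mu>)" using t by measurable
  have m2: "(\<lambda>(w, x). F t w x - EF x) \<in> borel_measurable (M \<Otimes>\<^sub>M \<mu>)" by measurable
  have gi: "integrable M ?g" by (rule integrable_const_bound[where B=1]) (auto simp: indicator_def)
  have i1: "integrable M (\<lambda>w. ?g w * Fh t w x)" for x
  proof (rule integrable_const_bound[where B=1])
    show "(\<lambda>w. ?g w * Fh t w x) \<in> borel_measurable M" using t by measurable
  qed (use Fh_range[OF t] in \<open>auto simp: indicator_def\<close>)
  have i2: "integrable M (\<lambda>w. ?g w * F t w x)" for x
  proof (rule integrable_const_bound[where B=1])
    show "(\<lambda>w. ?g w * F t w x) \<in> borel_measurable M" by measurable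
  qed (use F_range in \<open>auto simp: indicator_def\<close>)
  have e: "expectation (\<lambda>w. ?g w * (Fh t w x - EF x)) = expectation (\<lambda>w. ?g w * (F t w x - EF x))" for x
    using i1[of x] i2[of x] gi expectation_mult_Fh[OF t gX g1, of x] by (simp add: right_diff_distrib)
  have "(\<integral>w\<in>A. ?V w \<partial>M) = expectation (\<lambda>w. ?g w * ?V w)"
    by (simp add: set_lebesgue_integral_def)
  also have "\<dots> = (\<integral>x. expectation (\<lambda>w. ?g w * (Fh t w x - EF x)) * f x \<partial>\<mu>)"
    by (rule expectation_mult_inner[OF m1 b1 gM g1 f])
  also have "\<dots> = expectation (\<lambda>w. ?g w * ?W w)"
    unfolding e by (rule expectation_mult_inner[OF m2 b2 gM g1 f, symmetric])
  also have "\<dots> = (\<integral>w\<in>A. ?W w \<partial>M)" by (simp add: set_lebesgue_integral_def)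
  finally show "(\<integral>w\<in>A. ?V w \<partial>M) = (\<integral>w\<in>A. ?W w \<partial>M)" .
qed

text \<open>
The operator with kernel \<open>C\<^sub>0\<close> is the covariance operator of \<open>F\<^sub>t\<close> in the Hilbert space.
\<close>

lemma second_moment_score:
  assumes g: "g \<in> L2 \<mu>"
  shows "expectation (\<lambda>w. (ip (Fc t w) g)\<^sup>2)
    = ip (kop (Ckernel M \<xi> 0) g) g"
proof -
  let ?N = "\<mu> \<Otimes>\<^sub>M \<mu>"
  interpret N: finite_measure ?N by (intro finite_measure_pair_measure L2.finite_measure_axioms)
  interpret P: pair_sigma_finite M ?N ..
  have gm [measurable]: "g \<in> borel_measurable \<mu>" using g by (rule L2.L2_measurable)
  have gi: "integrable \<mu> g" using g by (rule L2.L2_integrable)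
  let ?h = "\<lambda>w x. F t w x - EF x"
  have hb: "\<bar>?h w x\<bar> \<le> 1" if "w \<in> space M" for w x
    using F_range[OF that, of t x] EF_range[of x] by (auto simp: abs_le_iff)
  have gg: "integrable ?N (\<lambda>z. g (fst z) * g (snd z))"
    using gi by (intro L2.pair_finite.Fubini_integrable) (auto simp: abs_mult)
  let ?H = "\<lambda>w z. (?h w (fst z) * ?h w (snd z)) * (g (fst z) * g (snd z))"
  have "integrable (M \<Otimes>\<^sub>M ?N) (\<lambda>(w, z). g (fst z) * g (snd z))"
    using gg by (intro P.Fubini_integrable) auto
  then have i: "integrable (M \<Otimes>\<^sub>M ?N) (\<lambda>(w, z). ?H w z)"
  proof (rule Bochner_Integration.integrable_bound)
    show "AE u in M \<Otimes>\<^sub>M ?N. norm (case u of (w, z) \<Rightarrow> ?H w z) \<le> norm (case u of (w, z) \<Rightarrow> g (fst z) * g (snd z))"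
    proof (rule AE_I2)
      fix u assume "u \<in> space (M \<Otimes>\<^sub>M ?N)"
      then obtain w z where u: "u = (w, z)" "w \<in> space M" by (auto simp: space_pair_measure)
      have "\<bar>?h w (fst z) * ?h w (snd z)\<bar> \<le> 1" unfolding abs_mult using hb[OF u(2)] by (intro mult_le_one) auto
      then have "\<bar>?h w (fst z) * ?h w (snd z)\<bar> * \<bar>g (fst z) * g (snd z)\<bar> \<le> 1 * \<bar>g (fst z) * g (snd z)\<bar>"
        by (rule mult_right_mono) simp
      then show "norm (case u of (w, z) \<Rightarrow> ?H w z) \<le> norm (case u of (w, z) \<Rightarrow> g (fst z) * g (snd z))"
        using u by (simp add: abs_mult)
    qed
  qed measurable
  have cov: "expectation (\<lambda>w. ?h w x * ?h w y) = Ckernel M \<xi> 0 x y" for x y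
  proof -
    have "expectation (\<lambda>w. ?h w x * ?h w y) = expectation (\<lambda>w. F t w x * F t w y - EF y * F t w x - EF x * F t w y + EF x * EF y)"
      by (intro Bochner_Integration.integral_cong) (auto simp: algebra_simps)
    also have "\<dots> = expectation (\<lambda>w. F t w x * F t w y) - EF x * EF y"
      using FF_integrable F_integrable by (simp add: expectation_F prob_space mult.commute)
    finally show ?thesis using expectation_FF[of t x 0 y] by (simp add: Ckernel_eq)
  qed
  have "expectation (\<lambda>w. (ip (?h w) g)\<^sup>2) = expectation (\<lambda>w. \<integral>z. ?H w z \<partial>?N)"
  proof (intro Bochner_Integration.integral_cong refl)
    fix w assume w: "w \<in> space M"
    let ?f = "\<lambda>x. ?h w x * g x"
    have fi: "integrable \<mu> ?f" using F_L2[OF w] EF_L2 g by (intro L2.L2_integrable_mult) auto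
    have [measurable]: "?f \<in> borel_measurable \<mu>" using fi by auto
    have ff: "integrable ?N (\<lambda>z. ?f (fst z) * ?f (snd z))"
      using fi integrable_abs[OF fi] by (intro L2.pair_finite.Fubini_integrable) (auto simp: abs_mult)
    have "(ip (?h w) g)\<^sup>2 = (\<integral>x. (\<integral>y. ?f x * ?f y \<partial>\<mu>) \<partial>\<mu>)"
      by (simp add: L2_inner_def power2_eq_square)
    also have "\<dots> = (\<integral>z. ?f (fst z) * ?f (snd z) \<partial>?N)"
      using L2.pair_finite.integral_fst'[OF ff] by simp
    finally show "(ip (?h w) g)\<^sup>2 = (\<integral>z. ?H w z \<partial>?N)" by (simp add: mult_ac)
  qed
  also have "\<dots> = (\<integral>z. expectation (\<lambda>w. ?H w z) \<partial>?N)"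
    by (rule P.Fubini_integral[OF i, symmetric])
  also have "\<dots> = (\<integral>z. (case z of (x, y) \<Rightarrow> Ckernel M \<xi> 0 x y * g y * g x) \<partial>?N)"
    by (simp add: cov case_prod_unfold mult_ac)
  also have "\<dots> = ip (kop (Ckernel M \<xi> 0) g) g"
    by (rule L2.inner_kernel_op[OF Ckernel_bdd g g, symmetric])
  finally show ?thesis .
qed

lemma score_hat_measurable:
  assumes t: "t \<ge> 1" and phi: "random_L2 M \<mu> \<phi>"
  shows "(\<lambda>w. ip (\<lambda>x. Fh t w x - EFh n w x) (\<phi> w)) \<in> borel_measurable M"
proof -
  have P: "\<phi> w \<in> L2 \<mu>" if "w \<in> space M" for w using phi that by (simp add: random_L2_def)
  have ind: "(\<lambda>x. indicat_real {..x} a) \<in> L2 \<mu>" for a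
  proof -
    have "(\<lambda>x. indicat_real {..x} a) = indicat_real {a..}" by (auto simp: indicator_def)
    then show ?thesis by simp
  qed
  have Fh: "(\<lambda>w. ip (Fh s w) (\<phi> w)) \<in> borel_measurable M" if s: "s \<ge> 1" for s
  proof -
    have "(\<lambda>w. (\<Sum>i=1..q s. ip (\<lambda>x. indicat_real {..x} (X (\<tau> s i) w)) (\<phi> w)) / real (q s)) \<in> borel_measurable M"
      by (intro borel_measurable_divide borel_measurable_sum L2.random_half_line_inner_measurable X_meas s phi) auto
    moreover have "ip (Fh s w) (\<phi> w) = (\<Sum>i=1..q s. ip (\<lambda>x. indicat_real {..x} (X (\<tau> s i) w)) (\<phi> w)) / real (q s)"
      if "w \<in> space M" for w
      unfolding Fcdf_hat_def[abs_def] L2.inner_divide_left by (subst L2.inner_sum_left[OF ind P[OF that]]) simp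
    ultimately show ?thesis by (subst measurable_cong) auto
  qed
  have "(\<lambda>w. ip (Fh t w) (\<phi> w) - (\<Sum>s=1..n. ip (Fh s w) (\<phi> w)) / real n) \<in> borel_measurable M"
    using Fh t by (intro borel_measurable_diff borel_measurable_divide borel_measurable_sum) auto
  moreover have "ip (\<lambda>x. Fh t w x - EFh n w x) (\<phi> w)
      = ip (Fh t w) (\<phi> w) - (\<Sum>s=1..n. ip (Fh s w) (\<phi> w)) / real n" if w: "w \<in> space M" for w
  proof -
    have "ip (EFh n w) (\<phi> w) = (\<Sum>s=1..n. ip (Fh s w) (\<phi> w)) / real n"
      unfolding EFcdf_hat_def[abs_def] L2.inner_divide_left using Fh_L2[OF w] P[OF w]
      by (subst L2.inner_sum_left) auto
    then show ?thesis using Fh_L2[OF w t] EFh_L2[OF w] P[OF w] by (simp add: L2.inner_diff_left)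
  qed
  ultimately show ?thesis by (subst measurable_cong) auto
qed

end

section \<open>Rates for the estimated scores\<close>

text \<open>
The spectral data of the population and of the sample. The estimated eigenfunctions are random
elements with signs matched to the population, and nonzero population eigenvalues are simple.
\<close>

locale score_estimation = conjugate_sample M \<mu> \<xi> X q \<tau>
  for M :: "'a measure" and \<mu> :: "real measure" and \<xi> :: "nat \<Rightarrow> 'a \<Rightarrow> real measure"
    and X :: "real \<Rightarrow> 'a \<Rightarrow> real" and q :: "nat \<Rightarrow> nat" and \<tau> :: "nat \<Rightarrow> nat \<Rightarrow> real" +
  fixes p :: nat and \<theta> :: "nat \<Rightarrow> real" and \<psi> :: "nat \<Rightarrow> real \<Rightarrow> real"
    and \<theta>' :: "nat \<Rightarrow> 'a \<Rightarrow> nat \<Rightarrow> real" and \<psi>' :: "nat \<Rightarrow> 'a \<Rightarrow> nat \<Rightarrow> real \<Rightarrow> real"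
  assumes es: "eigensystem \<mu> (Rkernel M \<xi> \<mu> p) \<theta> \<psi>"
    and ran: "L2_closure \<mu> (kernel_op \<mu> (Rkernel M \<xi> \<mu> p) ` L2 \<mu>) =
         L2_closure \<mu> (kernel_op \<mu> (Ckernel M \<xi> 0) ` L2 \<mu>)"
    and es': "\<And>n \<omega>. n > p \<Longrightarrow> \<omega> \<in> space M \<Longrightarrow>
           eigensystem \<mu> (Rkernel_hat X q \<tau> \<mu> p n \<omega>) (\<theta>' n \<omega>) (\<psi>' n \<omega>)"
    and rnd: "\<And>n j. n > p \<Longrightarrow> random_L2 M \<mu> (\<lambda>\<omega>. \<psi>' n \<omega> j)"
    and sgn: "\<And>n j \<omega>. n > p \<Longrightarrow> \<omega> \<in> space M \<Longrightarrow> L2_inner \<mu> (\<psi> j) (\<psi>' n \<omega> j) \<ge> 0"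
    and inj: "inj_on \<theta> {j. \<theta> j \<noteq> 0}"
begin

text \<open>
\<open>W\<close> and \<open>Wh\<close> are the true and the estimated scores.
\<close>

abbreviation "R \<equiv> Rkernel M \<xi> \<mu> p"
abbreviation "Rh \<equiv> Rkernel_hat X q \<tau> \<mu> p"
abbreviation "W t j w \<equiv> ip (Fc t w) (\<psi> j)"

lemma R_eq: "R = (\<lambda>x y. \<Sum>k\<in>{1..p}. \<integral>z. Ckernel M \<xi> k x z * Ckernel M \<xi> k y z \<partial>\<mu>)"
  by (intro ext) (simp add: Rkernel_def)

lemma Rh_eq: "Rh n w = (\<lambda>x y. \<Sum>k\<in>{1..p}. \<integral>z. Chat p n k w x z * Chat p n k w y z \<partial>\<mu>)"
  by (intro ext) (simp add: Rkernel_hat_def)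

lemma psd_R: "L2.psd_kernel R"
  unfolding R_eq by (rule L2.gram_sum_psd(1)) (rule Ckernel_bdd)

lemma psd_Rh: "w \<in> space M \<Longrightarrow> L2.psd_kernel (Rh n w)"
  unfolding Rh_eq by (rule L2.gram_sum_psd(1)) (rule Chat_bdd)

text \<open>
A bound for the operator norm of the difference of the empirical and the population operator.
\<close>

definition D :: "nat \<Rightarrow> 'a \<Rightarrow> real" where
  "D n w = 2 * mass * (\<Sum>k=1..p. kernel_error p n k w)"

lemma operator_error_le:
  assumes w: "w \<in> space M" and f: "f \<in> L2 \<mu>" and g: "g \<in> L2 \<mu>"
  shows "\<bar>ip (kop (Rh n w) f) g - ip (kop R f) g\<bar>
    \<le> D n w * nrm f * nrm g"
  unfolding R_eq Rh_eq D_def kernel_error_def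
  by (rule L2.gram_sum_diff_le[OF Ckernel_bdd Chat_bdd[OF w] Ckernel_abs_le Chat_abs_le f g])

lemma D_le: "D n w \<le> 2 * mass * total_error p n w"
  unfolding D_def total_error_def by (intro mult_left_mono) auto

lemma psi_L2 [simp]: "\<psi> j \<in> L2 \<mu>"
  by (rule L2.eigen_L2[OF psd_R es])

lemma psi'_L2: "n > p \<Longrightarrow> w \<in> space M \<Longrightarrow> \<psi>' n w j \<in> L2 \<mu>"
  by (rule L2.eigen_L2[OF psd_Rh es'])

lemma psi_norm: "nrm (\<psi> j) = 1"
  unfolding L2_norm_def by (simp add: L2.eigen_orth[OF psd_R es])

lemma psi'_norm: "n > p \<Longrightarrow> w \<in> space M \<Longrightarrow> nrm (\<psi>' n w j) = 1"
  unfolding L2_norm_def by (simp add: L2.eigen_orth[OF psd_Rh es'])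

lemma spectral_gap:
  assumes j: "\<theta> j \<noteq> 0"
  obtains dl where "dl > 0" "\<And>i. i < j \<Longrightarrow> dl \<le> \<theta> i - \<theta> j" "dl \<le> \<theta> j - \<theta> (Suc j)"
proof -
  note dec = L2.eigen_dec[OF psd_R es]
  have pos: "\<theta> j > 0" using L2.eigen_nonneg[OF psd_R es, of j] j by simp
  have g1: "\<theta> (Suc j) < \<theta> j"
  proof -
    have "\<theta> (Suc j) \<noteq> \<theta> j" using inj_onD[OF inj, of "Suc j" j] j by auto
    then show ?thesis using dec[of j "Suc j"] by simp
  qed
  have g2: "\<theta> j < \<theta> i" if "i < j" for i
  proof -
    have "\<theta> j \<le> \<theta> i" using dec[of i j] that by simp
    moreover have "\<theta> i \<noteq> \<theta> j" using inj_onD[OF inj, of i j] j that by auto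
    ultimately show ?thesis by simp
  qed
  define dl where "dl = min (\<theta> j - \<theta> (Suc j)) (if j = 0 then 1 else \<theta> (j - 1) - \<theta> j)"
  have "dl > 0" unfolding dl_def using g1 g2[of "j - 1"] by auto
  moreover have "dl \<le> \<theta> i - \<theta> j" if i: "i < j" for i
  proof -
    have "\<theta> (j - 1) \<le> \<theta> i" using i dec[of i "j - 1"] by simp
    then show ?thesis using i unfolding dl_def by (simp add: min_def)
  qed
  moreover have "dl \<le> \<theta> j - \<theta> (Suc j)" unfolding dl_def by simp
  ultimately show thesis using that by blast
qed

lemma eigenfunction_error:
  assumes j: "\<theta> j \<noteq> 0"
  obtains C where "C \<ge> 0" "\<And>n w. n > p \<Longrightarrow> w \<in> space M \<Longrightarrow>
    nrm (\<lambda>x. \<psi>' n w j x - \<psi> j x) \<le> C * total_error p n w"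
proof -
  obtain dl where dl: "dl > 0" "\<And>i. i < j \<Longrightarrow> dl \<le> \<theta> i - \<theta> j" "dl \<le> \<theta> j - \<theta> (Suc j)"
    using spectral_gap[OF j] by blast
  have "nrm (\<lambda>x. \<psi>' n w j x - \<psi> j x) \<le> (3 * (2 * mass) / dl) * total_error p n w"
    if n: "n > p" and w: "w \<in> space M" for n w
  proof -
    have "nrm (\<lambda>x. \<psi>' n w j x - \<psi> j x) \<le> 3 * D n w / dl"
      by (rule L2.eigenfunction_perturbation[OF psd_R es psd_Rh[OF w] es'[OF n w]
            operator_error_le[OF w] dl sgn[OF n w]])
    also have "\<dots> \<le> 3 * (2 * mass * total_error p n w) / dl"
      using D_le[of n w] dl(1) by (intro divide_right_mono mult_left_mono) auto
    finally show ?thesis by simp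
  qed
  moreover have "3 * (2 * mass) / dl \<ge> 0" using dl(1) by simp
  ultimately show thesis using that by blast
qed

text \<open>
This is how the equality of the closed ranges enters: in the case of finite rank, a function
in the kernel of \<open>R\<close> is orthogonal to the range of \<open>R\<close>, hence to the range of \<open>C\<^sub>0\<close>.
\<close>

lemma Ckernel_form_zero:
  assumes g: "g \<in> L2 \<mu>" and orth: "\<And>i. i < d \<Longrightarrow> ip (\<psi> i) g = 0" and d: "\<theta> d = 0"
  shows "ip (kop (Ckernel M \<xi> 0) g) g = 0"
proof (rule ccontr)
  let ?Cg = "kop (Ckernel M \<xi> 0) g"
  let ?c = "ip ?Cg g" and ?N = "nrm g + 1"
  assume c: "?c \<noteq> 0"
  have N: "?N > 0" using L2.norm_nonneg[of g] by linarith
  have Cg: "?Cg \<in> L2 \<mu>" using Ckernel_bdd g by (rule L2.kernel_op_L2)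
  have Rg: "AE x in \<mu>. kop R g x = 0" by (rule L2.op_AE_zero[OF psd_R es g orth d])
  have RL: "kop R h \<in> L2 \<mu>" if "h \<in> L2 \<mu>" for h
    using L2.psd_imp_bdd[OF psd_R] that by (rule L2.kernel_op_L2)
  have "nrm (\<lambda>x. ?Cg x - ?Cg x) = 0" by (simp add: L2_norm_def L2_inner_def)
  then have "?Cg \<in> L2_closure \<mu> (kop (Ckernel M \<xi> 0) ` L2 \<mu>)"
    unfolding L2_closure_def using Cg g by force
  then have "?Cg \<in> L2_closure \<mu> (kop R ` L2 \<mu>)" using ran by simp
  moreover have "\<bar>?c\<bar> / ?N > 0" using c N by simp
  ultimately obtain h where h: "h \<in> L2 \<mu>" "nrm (\<lambda>x. ?Cg x - kop R h x) < \<bar>?c\<bar> / ?N"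
    unfolding L2_closure_def by blast
  have "ip (kop R h) g = ip h (kop R g)"
    by (rule L2.inner_kernel_op_sym[OF psd_R h(1) g])
  also have "\<dots> = ip h (\<lambda>_. 0)"
    using Rg h(1) RL[OF g] by (intro L2.inner_cong_AE_right) auto
  also have "\<dots> = 0" by (simp add: L2_inner_def)
  finally have "?c = ip (\<lambda>x. ?Cg x - kop R h x) g"
    using Cg RL[OF h(1)] g by (simp add: L2.inner_diff_left)
  then have "\<bar>?c\<bar> \<le> nrm (\<lambda>x. ?Cg x - kop R h x) * nrm g"
    using L2.inner_abs_le[OF L2.L2_diff[OF Cg RL[OF h(1)]] g] by simp
  also have "\<dots> \<le> (\<bar>?c\<bar> / ?N) * nrm g"
    using h(2) by (intro mult_right_mono) auto
  also have "\<dots> < (\<bar>?c\<bar> / ?N) * ?N" using c N by (intro mult_strict_left_mono) auto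
  also have "\<dots> = \<bar>?c\<bar>" using N by simp
  finally show False by simp
qed

text \<open>
If \<open>\<theta> d = 0\<close>, the random function \<open>F\<^sub>t - m\<close> lies almost surely in the span of the first \<open>d\<close>
eigenfunctions: its residual is almost surely orthogonal to each half-line indicator, and
rational end points suffice.
\<close>

lemma finite_rank_expansion:
  assumes d: "\<theta> d = 0"
  shows "AE w in M. AE x in \<mu>. F t w x - EF x = (\<Sum>i<d. W t i w * \<psi> i x)"
proof -
  define u where "u w x = (F t w x - EF x) - (\<Sum>i<d. W t i w * \<psi> i x)" for w x
  have uL: "u w \<in> L2 \<mu>" if w: "w \<in> space M" for w
    unfolding u_def[abs_def] using F_L2[OF w] EF_L2 by (intro L2.L2_diff L2.L2_sum L2.L2_scale psi_L2)
  have "AE w in M. ip (u w) (indicat_real {..r}) = 0" for r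
  proof -
    let ?f = "indicat_real {..r}"
    define s where "s = (\<lambda>x. \<Sum>i<d. ip (\<psi> i) ?f * \<psi> i x)"
    define g where "g = (\<lambda>x. ?f x - s x)"
    have f: "?f \<in> L2 \<mu>" by simp
    have s: "s \<in> L2 \<mu>" unfolding s_def by (intro L2.L2_sum L2.L2_scale psi_L2)
    have g: "g \<in> L2 \<mu>" unfolding g_def using f s by (rule L2.L2_diff)
    have orth: "ip (\<psi> i) g = 0" if "i < d" for i
    proof -
      have "ip (\<psi> i) s = ip (\<psi> i) ?f"
        unfolding s_def using L2.inner_eigen_sum[OF psd_R es, of "{..<d}" i "\<lambda>i. ip (\<psi> i) ?f"] that by simp
      then show ?thesis unfolding g_def using f s by (simp add: L2.inner_diff_right)
    qed
    have W_s: "ip (Fc t w) s = (\<Sum>i<d. W t i w * ip (\<psi> i) ?f)"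
      if w: "w \<in> space M" for w
      unfolding s_def using F_L2[OF w] EF_L2
      by (subst L2.inner_sum_right)
        (simp_all only: L2.inner_scale_right L2.L2_scale L2.L2_diff psi_L2 mult.commute[of "W t _ w"])
    have ug: "ip (u w) ?f = ip (Fc t w) g" if w: "w \<in> space M" for w
    proof -
      have a: "(Fc t w) \<in> L2 \<mu>" using F_L2[OF w] EF_L2 by auto
      have b: "(\<lambda>x. \<Sum>i<d. W t i w * \<psi> i x) \<in> L2 \<mu>" by (intro L2.L2_sum L2.L2_scale psi_L2)
      have "ip (u w) ?f = ip (Fc t w) ?f - ip (\<lambda>x. \<Sum>i<d. W t i w * \<psi> i x) ?f"
        unfolding u_def[abs_def] by (rule L2.inner_diff_left[OF a b f])
      also have "ip (\<lambda>x. \<Sum>i<d. W t i w * \<psi> i x) ?f = (\<Sum>i<d. W t i w * ip (\<psi> i) ?f)"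
        using f by (subst L2.inner_sum_left) (auto simp: L2.inner_scale_left)
      finally show ?thesis unfolding g_def using L2.inner_diff_right[OF f s a] W_s[OF w] by simp
    qed
    have m: "expectation (\<lambda>w. (ip (Fc t w) g)\<^sup>2) = 0"
      unfolding second_moment_score[OF g] by (rule Ckernel_form_zero[OF g orth d])
    have i: "integrable M (\<lambda>w. (ip (Fc t w) g)\<^sup>2)"
    proof (rule integrable_const_bound[where B="(sqrt mass * nrm g)\<^sup>2"])
      show "AE w in M. norm ((ip (Fc t w) g)\<^sup>2) \<le> (sqrt mass * nrm g)\<^sup>2"
      proof (rule AE_I2)
        fix w assume w: "w \<in> space M"
        show "norm ((ip (Fc t w) g)\<^sup>2) \<le> (sqrt mass * nrm g)\<^sup>2"
          using power_mono[OF W_abs_le(1)[OF w g, of t], of 2] by simp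
      qed
    qed (use W_measurable[OF g] in measurable)
    have "AE w in M. (ip (Fc t w) g)\<^sup>2 = 0"
      using m by (subst (asm) integral_nonneg_eq_0_iff_AE[OF i]) auto
    then show ?thesis using AE_space
    proof eventually_elim
      case (elim w)
      then show ?case using ug[of w] by simp
    qed
  qed
  then have "AE w in M. \<forall>r\<in>\<rat>. ip (u w) (indicat_real {..r}) = 0"
    using countable_rat by (subst AE_ball_countable) auto
  then show ?thesis using AE_space
  proof eventually_elim
    case (elim w)
    then have "AE x in \<mu>. u w x = 0"
      by (intro L2.AE_zero_if_orthogonal_half_lines uL) auto
    then show ?case by eventually_elim (simp add: u_def)
  qed
qed

text \<open>
The next two lemmas bound the effect of replacing the eigenfunction by its estimate in the score of
\<open>F\<^sub>t\<close>. If the eigenvalue is nonzero, the estimated eigenfunction is close to the true one.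
\<close>

lemma score_drift_nonzero:
  assumes j: "\<theta> j \<noteq> 0"
  shows "\<exists>C\<ge>0. AE w in M. \<forall>n>p. \<bar>ip (Fc t w) (\<psi>' n w j) - W t j w\<bar> \<le> C * total_error p n w"
proof -
  obtain C where C: "C \<ge> 0" "\<And>n w. n > p \<Longrightarrow> w \<in> space M \<Longrightarrow>
    nrm (\<lambda>x. \<psi>' n w j x - \<psi> j x) \<le> C * total_error p n w"
    using eigenfunction_error[OF j] by blast
  have "\<bar>ip (Fc t w) (\<psi>' n w j) - W t j w\<bar> \<le> (sqrt mass * C) * total_error p n w"
    if n: "n > p" and w: "w \<in> space M" for n w
  proof -
    have d: "(\<lambda>x. \<psi>' n w j x - \<psi> j x) \<in> L2 \<mu>" using psi'_L2[OF n w] by auto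
    have a: "(Fc t w) \<in> L2 \<mu>" using F_L2[OF w] EF_L2 by auto
    have "\<bar>ip (Fc t w) (\<psi>' n w j) - W t j w\<bar>
        = \<bar>ip (Fc t w) (\<lambda>x. \<psi>' n w j x - \<psi> j x)\<bar>"
      using a psi'_L2[OF n w] by (simp add: L2.inner_diff_right)
    also have "\<dots> \<le> sqrt mass * nrm (\<lambda>x. \<psi>' n w j x - \<psi> j x)" by (rule W_abs_le(1)[OF w d])
    also have "\<dots> \<le> sqrt mass * (C * total_error p n w)" using C(2)[OF n w] by (intro mult_left_mono) auto
    finally show ?thesis by simp
  qed
  then show ?thesis using C(1) by (intro exI[of _ "sqrt mass * C"]) auto
qed

text \<open>
If the eigenvalue is zero, the estimated eigenfunction need not be close to \<open>\<psi> j\<close>, but it is nearly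
orthogonal to the span in which \<open>F\<^sub>t - m\<close> lies, and the true score vanishes almost surely.
\<close>

lemma score_drift_zero:
  assumes j: "\<theta> j = 0"
  shows "\<exists>C\<ge>0. AE w in M. \<forall>n>p. \<bar>ip (Fc t w) (\<psi>' n w j) - W t j w\<bar> \<le> C * total_error p n w"
proof -
  \<comment> \<open>The first vanishing eigenvalue: all \<open>i < d\<close> have \<open>\<theta> i \<noteq> 0\<close>, so that dividing by them is
    harmless.\<close>
  define d where "d = (LEAST d. \<theta> d = 0)"
  have d: "\<theta> d = 0" "d \<le> j" unfolding d_def using j by (auto intro: LeastI Least_le)
  have nz: "\<theta> i \<noteq> 0" if "i < d" for i using not_less_Least that unfolding d_def by blast
  have pos: "\<theta> i > 0" if "i < d" for i using nz[OF that] L2.eigen_nonneg[OF psd_R es, of i] by simp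
  let ?C = "\<Sum>i<d. sqrt mass * (2 * (2 * mass) / \<theta> i)"
  have C0: "?C \<ge> 0" using pos by (intro sum_nonneg) (auto simp: less_imp_le)
  have "AE w in M. \<forall>n>p. \<bar>ip (Fc t w) (\<psi>' n w j) - W t j w\<bar> \<le> ?C * total_error p n w"
    using finite_rank_expansion[OF d(1), of t] AE_space
  proof eventually_elim
    case (elim w)
    then have w: "w \<in> space M" and ex: "AE x in \<mu>. F t w x - EF x = (\<Sum>i<d. W t i w * \<psi> i x)" by auto
    have a: "(Fc t w) \<in> L2 \<mu>" using F_L2[OF w] EF_L2 by auto
    have b: "(\<lambda>x. \<Sum>i<d. W t i w * \<psi> i x) \<in> L2 \<mu>" by (intro L2.L2_sum L2.L2_scale psi_L2)
    have exp: "ip (Fc t w) f = (\<Sum>i<d. W t i w * ip (\<psi> i) f)" if f: "f \<in> L2 \<mu>" for f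
      using L2.inner_cong_AE_left[OF a b f ex] L2.inner_eigen_sum'[OF psd_R es f, of "\<lambda>i. W t i w" "{..<d}"] by simp
    have W0: "W t j w = 0"
      using exp[OF psi_L2[of j]] d(2) by (simp add: L2.eigen_orth[OF psd_R es])
    show ?case
    proof (intro allI impI)
      fix n assume n: "n > p"
      note pL = psi'_L2[OF n w, of j]
      have "\<bar>ip (Fc t w) (\<psi>' n w j) - W t j w\<bar> = \<bar>\<Sum>i<d. W t i w * ip (\<psi> i) (\<psi>' n w j)\<bar>"
        unfolding W0 exp[OF pL] by simp
      also have "\<dots> \<le> (\<Sum>i<d. \<bar>W t i w\<bar> * \<bar>ip (\<psi> i) (\<psi>' n w j)\<bar>)"
        unfolding abs_mult[symmetric] by (rule sum_abs)
      also have "\<dots> \<le> (\<Sum>i<d. sqrt mass * (2 * (2 * mass * total_error p n w) / \<theta> i))"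
      proof (rule sum_mono)
        fix i assume i: "i \<in> {..<d}"
        have "\<bar>W t i w\<bar> \<le> sqrt mass" using W_abs_le(1)[OF w psi_L2, of t i] by (simp add: psi_norm)
        moreover have "\<bar>ip (\<psi> i) (\<psi>' n w j)\<bar> \<le> 2 * (2 * mass * total_error p n w) / \<theta> i"
        proof -
          have "\<bar>ip (\<psi> i) (\<psi>' n w j)\<bar> \<le> 2 * D n w / \<theta> i"
            using i nz by (intro L2.cross_inner_le[OF psd_R es psd_Rh[OF w] es'[OF n w] operator_error_le[OF w] j]) auto
          also have "\<dots> \<le> 2 * (2 * mass * total_error p n w) / \<theta> i"
            using D_le[of n w] pos[of i] i by (intro divide_right_mono mult_left_mono) auto
          finally show ?thesis .
        qed
        ultimately show "\<bar>W t i w\<bar> * \<bar>ip (\<psi> i) (\<psi>' n w j)\<bar>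
            \<le> sqrt mass * (2 * (2 * mass * total_error p n w) / \<theta> i)"
          by (intro mult_mono) auto
      qed
      also have "\<dots> = ?C * total_error p n w"
        unfolding sum_distrib_right by (intro sum.cong refl) simp
      finally show "\<bar>ip (Fc t w) (\<psi>' n w j) - W t j w\<bar> \<le> ?C * total_error p n w" .
    qed
  qed
  then show ?thesis using C0 by blast
qed

text \<open>
The norm of the conditional expectation in \<open>L\<^sup>1\<close> is found by pairing it with its own sign, which is
measurable with respect to \<open>\<Xi>\<close>.
\<close>

lemma cond_exp_L1_le:
  assumes r: "integrable M r"
  shows "integrable M (real_cond_exp M Xi r)"
    and "expectation (\<lambda>w. \<bar>real_cond_exp M Xi r w\<bar>) \<le> expectation (\<lambda>w. \<bar>r w\<bar>)"
proof -
  let ?Y = "real_cond_exp M Xi r"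
  show Yi: "integrable M ?Y" using r by (rule Xi.real_cond_exp_int(1))
  have [measurable]: "r \<in> borel_measurable M" using r by auto
  have sX: "(\<lambda>w. sgn (?Y w)) \<in> borel_measurable Xi" by measurable
  have sM [measurable]: "(\<lambda>w. sgn (?Y w)) \<in> borel_measurable M" by (rule measurable_from_subalg[OF subalg sX])
  have i: "integrable M (\<lambda>w. sgn (?Y w) * r w)"
    using r by (rule Bochner_Integration.integrable_bound) (auto simp: abs_mult sgn_if)
  have "expectation (\<lambda>w. \<bar>?Y w\<bar>) = expectation (\<lambda>w. sgn (?Y w) * ?Y w)"
    by (intro Bochner_Integration.integral_cong) (auto simp: sgn_if)
  also have "\<dots> = expectation (\<lambda>w. sgn (?Y w) * r w)"
    using i sX by (intro Xi.real_cond_exp_intg(2)) auto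
  also have "\<dots> \<le> expectation (\<lambda>w. \<bar>r w\<bar>)"
    using i r by (intro integral_mono) (auto simp: sgn_if)
  finally show "expectation (\<lambda>w. \<bar>?Y w\<bar>) \<le> expectation (\<lambda>w. \<bar>r w\<bar>)" .
qed

abbreviation "Wh n t j w \<equiv> ip (\<lambda>x. Fh t w x - EFh n w x) (\<psi>' n w j)"

lemma mean_inner_le:
  assumes n: "n > p" and w: "w \<in> space M"
  shows "\<bar>ip (\<lambda>x. EFh n w x - EF x) (\<psi>' n w j)\<bar> \<le> total_error p n w"
proof -
  have a: "(\<lambda>x. EFh n w x - EF x) \<in> L2 \<mu>" using EFh_L2[OF w] EF_L2 by auto
  have "\<bar>ip (\<lambda>x. EFh n w x - EF x) (\<psi>' n w j)\<bar> \<le> mean_error n w"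
    using L2.inner_abs_le[OF a psi'_L2[OF n w, of j]] by (simp add: mean_error_def psi'_norm[OF n w])
  also have "\<dots> \<le> total_error p n w" by (simp add: total_error_def sum_nonneg)
  finally show ?thesis .
qed

lemma Wh_measurable: "n > p \<Longrightarrow> t \<ge> 1 \<Longrightarrow> Wh n t j \<in> borel_measurable M"
  by (rule score_hat_measurable[OF _ rnd])

lemma Wh_integrable: "n > p \<Longrightarrow> t \<ge> 1 \<Longrightarrow> integrable M (Wh n t j)"
  using W_abs_le(3)[OF _ psi'_L2] psi'_norm
  by (intro integrable_const_bound[where B="sqrt mass"] Wh_measurable) (auto intro!: AE_I2)

theorem conditional_score_rate:
  assumes t: "t \<ge> 1" and j: "\<theta> j \<noteq> 0"
  shows "O_prob M (\<lambda>n w. real_cond_exp M Xi (Wh n t j) w - W t j w) (\<lambda>n. real n powr (- 1 / 2))"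
proof -
  obtain C where C: "C \<ge> 0" "\<And>n w. n > p \<Longrightarrow> w \<in> space M \<Longrightarrow>
    nrm (\<lambda>x. \<psi>' n w j x - \<psi> j x) \<le> C * total_error p n w"
    using eigenfunction_error[OF j] by blast
  obtain c where c: "c \<ge> 0" "\<And>n. n > p \<Longrightarrow> n \<ge> 2 * p \<Longrightarrow> integrable M (total_error p n)"
    "\<And>n. n > p \<Longrightarrow> n \<ge> 2 * p \<Longrightarrow> expectation (total_error p n) \<le> c * real n powr (- 1 / 2)"
    using total_error_L1[of p] by blast
  define V where "V w = ip (Fhc t w) (\<psi> j)" for w
  define r where "r n w = Wh n t j w - V w" for n w
  let ?K = "sqrt mass * C + 1"
  have Vi: "integrable M V"
  proof (rule integrable_const_bound[where B="sqrt mass"])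
    show "AE w in M. norm (V w) \<le> sqrt mass"
      unfolding V_def using W_abs_le(2)[OF _ psi_L2 t] psi_norm by (intro AE_I2) auto
    have [measurable]: "\<psi> j \<in> borel_measurable \<mu>" by (rule L2.L2_measurable[OF psi_L2])
    show "V \<in> borel_measurable M" unfolding V_def[abs_def] L2_inner_def using t by measurable
  qed
  have r_le: "\<bar>r n w\<bar> \<le> ?K * total_error p n w" if n: "n > p" and w: "w \<in> space M" for n w
  proof -
    note pL = psi'_L2[OF n w, of j]
    note L = Fh_L2[OF w t] EFh_L2[OF w] EF_L2 L2.L2_diff
    have d: "(\<lambda>x. \<psi>' n w j x - \<psi> j x) \<in> L2 \<mu>" using pL by auto
    have "r n w = ip (Fhc t w) (\<lambda>x. \<psi>' n w j x - \<psi> j x)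
        - ip (\<lambda>x. EFh n w x - EF x) (\<psi>' n w j)"
      unfolding r_def V_def using pL L by (simp add: L2.inner_diff_left L2.inner_diff_right)
    then have "\<bar>r n w\<bar> \<le> \<bar>ip (Fhc t w) (\<lambda>x. \<psi>' n w j x - \<psi> j x)\<bar>
        + \<bar>ip (\<lambda>x. EFh n w x - EF x) (\<psi>' n w j)\<bar>" by linarith
    also have "\<dots> \<le> sqrt mass * (C * total_error p n w) + total_error p n w"
      by (intro add_mono mean_inner_le n w order_trans[OF W_abs_le(2)[OF w d t] mult_left_mono] C(2)) simp
    finally show ?thesis by (simp add: distrib_right mult.assoc)
  qed
  show ?thesis
  proof (rule O_prob_if_L1[OF prob_space_axioms])
    show "\<forall>\<^sub>F n in sequentially. integrable M (\<lambda>w. real_cond_exp M Xi (Wh n t j) w - W t j w) \<and>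
        expectation (\<lambda>w. \<bar>real_cond_exp M Xi (Wh n t j) w - W t j w\<bar>) \<le> (?K * c) * real n powr (- 1 / 2)"
      using eventually_gt_at_top[of p] eventually_ge_at_top[of "2 * p"]
    proof eventually_elim
      case (elim n)
      have ri: "integrable M (r n)"
        unfolding r_def[abs_def] using Wh_integrable[OF elim(1) t] Vi by auto
      have Whi: "integrable M (Wh n t j)" by (rule Wh_integrable[OF elim(1) t])
      have Wm: "W t j \<in> borel_measurable M" by (rule W_measurable[OF psi_L2])
      have Wi: "integrable M (W t j)"
        using W_abs_le(1)[OF _ psi_L2] psi_norm
        by (intro integrable_const_bound[where B="sqrt mass"] Wm AE_I2) auto
      have "AE w in M. real_cond_exp M Xi (\<lambda>w. V w + r n w) w = real_cond_exp M Xi V w + real_cond_exp M Xi (r n) w"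
        using Vi ri by (rule Xi.real_cond_exp_add)
      moreover have "(\<lambda>w. V w + r n w) = Wh n t j" unfolding r_def by auto
      ultimately have "AE w in M. real_cond_exp M Xi (Wh n t j) w = real_cond_exp M Xi V w + real_cond_exp M Xi (r n) w"
        by simp
      then have ae: "AE w in M. \<bar>real_cond_exp M Xi (Wh n t j) w - W t j w\<bar> = \<bar>real_cond_exp M Xi (r n) w\<bar>"
        using cond_exp_score[OF t psi_L2[of j]] unfolding V_def[symmetric, abs_def]
        by eventually_elim simp
      have Zi: "integrable M (\<lambda>w. real_cond_exp M Xi (Wh n t j) w - W t j w)"
        using cond_exp_L1_le(1)[OF Whi] Wi by auto
      have "expectation (\<lambda>w. \<bar>real_cond_exp M Xi (Wh n t j) w - W t j w\<bar>) = expectation (\<lambda>w. \<bar>real_cond_exp M Xi (r n) w\<bar>)"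
        using ae Zi cond_exp_L1_le(1)[OF ri] by (intro integral_cong_AE) auto
      also have "\<dots> \<le> expectation (\<lambda>w. \<bar>r n w\<bar>)" by (rule cond_exp_L1_le(2)[OF ri])
      also have "\<dots> \<le> expectation (\<lambda>w. ?K * total_error p n w)"
        using ri c(2)[OF elim] r_le[OF elim(1)] by (intro integral_mono) auto
      also have "\<dots> = ?K * expectation (total_error p n)" using c(2)[OF elim] by simp
      also have "\<dots> \<le> ?K * (c * real n powr (- 1 / 2))"
        using c(3)[OF elim] C(1) by (intro mult_left_mono) auto
      finally show ?case using Zi by (simp add: mult.assoc)
    qed
  qed
qed

theorem score_rate:
  assumes t: "t \<ge> 1"
  shows "\<exists>Z. O_prob M Z (\<lambda>n. real n powr (- 1 / 2)) \<and>
     (\<forall>n>p. \<forall>w\<in>space M. \<bar>Wh n t j w - W t j w\<bar> \<le> nrm (\<lambda>x. Fh t w x - F t w x) + Z n w)"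
proof -
  obtain C where C: "C \<ge> 0" and drift: "AE w in M. \<forall>n>p.
      \<bar>ip (Fc t w) (\<psi>' n w j) - W t j w\<bar> \<le> C * total_error p n w"
    using score_drift_nonzero[of j t] score_drift_zero[of j t] by blast
  obtain c where c: "c \<ge> 0" "\<And>n. n > p \<Longrightarrow> n \<ge> 2 * p \<Longrightarrow> integrable M (total_error p n)"
    "\<And>n. n > p \<Longrightarrow> n \<ge> 2 * p \<Longrightarrow> expectation (total_error p n) \<le> c * real n powr (- 1 / 2)"
    using total_error_L1[of p] by blast
  \<comment> \<open>The smallest nonnegative remainder. It satisfies the inequality at every point of the sample
    space, while the bounds on it need only hold almost surely.\<close>
  define Z where "Z n w = max 0 (\<bar>Wh n t j w - W t j w\<bar> - nrm (\<lambda>x. Fh t w x - F t w x))" for n w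
  have Z_le: "AE w in M. \<bar>Z n w\<bar> \<le> (C + 1) * total_error p n w" if n: "n > p" for n
    using drift AE_space
  proof eventually_elim
    case (elim w)
    then have w: "w \<in> space M" by simp
    note pL = psi'_L2[OF n w, of j]
    note L = Fh_L2[OF w t] F_L2[OF w, of t] EFh_L2[OF w] EF_L2 L2.L2_diff
    have "Wh n t j w - W t j w = ip (\<lambda>x. Fh t w x - F t w x) (\<psi>' n w j)
        + (ip (Fc t w) (\<psi>' n w j) - W t j w)
        - ip (\<lambda>x. EFh n w x - EF x) (\<psi>' n w j)"
      using pL L by (simp add: L2.inner_diff_left)
    then have "\<bar>Wh n t j w - W t j w\<bar> \<le> \<bar>ip (\<lambda>x. Fh t w x - F t w x) (\<psi>' n w j)\<bar>
        + \<bar>ip (Fc t w) (\<psi>' n w j) - W t j w\<bar>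
        + \<bar>ip (\<lambda>x. EFh n w x - EF x) (\<psi>' n w j)\<bar>" by linarith
    also have "\<dots> \<le> nrm (\<lambda>x. Fh t w x - F t w x) + C * total_error p n w + total_error p n w"
    proof (intro add_mono mean_inner_le n w)
      show "\<bar>ip (\<lambda>x. Fh t w x - F t w x) (\<psi>' n w j)\<bar> \<le> nrm (\<lambda>x. Fh t w x - F t w x)"
        using L2.inner_abs_le[OF L2.L2_diff[OF L(1,2)] pL] by (simp add: psi'_norm[OF n w])
    qed (use elim n in auto)
    finally have "\<bar>Wh n t j w - W t j w\<bar> - nrm (\<lambda>x. Fh t w x - F t w x) \<le> (C + 1) * total_error p n w"
      by (simp add: distrib_right)
    moreover have "0 \<le> (C + 1) * total_error p n w" using C by simp
    ultimately show ?case unfolding Z_def by simp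
  qed
  have "O_prob M Z (\<lambda>n. real n powr (- 1 / 2))"
  proof (rule O_prob_if_L1[OF prob_space_axioms])
    show "\<forall>\<^sub>F n in sequentially. integrable M (Z n) \<and>
        expectation (\<lambda>w. \<bar>Z n w\<bar>) \<le> ((C + 1) * c) * real n powr (- 1 / 2)"
      using eventually_gt_at_top[of p] eventually_ge_at_top[of "2 * p"]
    proof eventually_elim
      case (elim n)
      have [measurable]: "Wh n t j \<in> borel_measurable M" by (rule Wh_measurable[OF elim(1) t])
      have [measurable]: "W t j \<in> borel_measurable M" by (rule W_measurable[OF psi_L2])
      have [measurable]: "(\<lambda>w. nrm (\<lambda>x. Fh t w x - F t w x)) \<in> borel_measurable M"
        unfolding L2_norm_def L2_inner_def using t by measurable
      have Zm: "Z n \<in> borel_measurable M" unfolding Z_def[abs_def] by measurable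
      have ti: "integrable M (\<lambda>w. (C + 1) * total_error p n w)" using c(2)[OF elim] by simp
      have Zi: "integrable M (Z n)"
        using ti Zm
      proof (rule Bochner_Integration.integrable_bound)
        show "AE w in M. norm (Z n w) \<le> norm ((C + 1) * total_error p n w)"
          using Z_le[OF elim(1)] by eventually_elim (use C in \<open>auto intro: order_trans\<close>)
      qed
      have "expectation (\<lambda>w. \<bar>Z n w\<bar>) \<le> expectation (\<lambda>w. (C + 1) * total_error p n w)"
        using Zi ti Z_le[OF elim(1)] by (intro integral_mono_AE) auto
      also have "\<dots> = (C + 1) * expectation (total_error p n)" using c(2)[OF elim] by simp
      also have "\<dots> \<le> (C + 1) * (c * real n powr (- 1 / 2))"
        using c(3)[OF elim] C by (intro mult_left_mono) auto
      finally show ?case using Zi by (simp add: mult.assoc)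
    qed
  qed
  moreover have "\<bar>Wh n t j w - W t j w\<bar> \<le> nrm (\<lambda>x. Fh t w x - F t w x) + Z n w" for n w
    unfolding Z_def by linarith
  ultimately show ?thesis by blast
qed

end

theorem corollary2:
  fixes M :: "'a measure"
    and \<xi> :: "nat \<Rightarrow> 'a \<Rightarrow> real measure"
    and X :: "real \<Rightarrow> 'a \<Rightarrow> real"
    and \<mu> :: "real measure"
    and p :: nat
    and \<theta> :: "nat \<Rightarrow> real" and \<psi> :: "nat \<Rightarrow> real \<Rightarrow> real"
    and q :: "nat \<Rightarrow> nat" and \<tau> :: "nat \<Rightarrow> nat \<Rightarrow> real"
    and \<theta>' :: "nat \<Rightarrow> 'a \<Rightarrow> nat \<Rightarrow> real" and \<psi>' :: "nat \<Rightarrow> 'a \<Rightarrow> nat \<Rightarrow> real \<Rightarrow> real"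
  assumes "prob_space M"
    and "stationary M \<xi>"
    and "conjugate_process M \<xi> X"
    and "cyclic_independent M \<xi> X"
    and "diffraction M \<xi> \<mu>"
    and "p \<ge> 1"
    and "eigensystem \<mu> (Rkernel M \<xi> \<mu> p) \<theta> \<psi>"
    and "L2_closure \<mu> (kernel_op \<mu> (Rkernel M \<xi> \<mu> p) ` L2 \<mu>) =
         L2_closure \<mu> (kernel_op \<mu> (Ckernel M \<xi> 0) ` L2 \<mu>)"
    and "\<And>t. t \<ge> 1 \<Longrightarrow> q t \<ge> 1"
    and "\<And>t i. t \<ge> 1 \<Longrightarrow> i \<in> {1..q t} \<Longrightarrow> \<tau> t i \<in> {real t..<real t + 1}"
    and "\<And>n \<omega>. n > p \<Longrightarrow> \<omega> \<in> space M \<Longrightarrow>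
           eigensystem \<mu> (Rkernel_hat X q \<tau> \<mu> p n \<omega>) (\<theta>' n \<omega>) (\<psi>' n \<omega>)"
    and "\<And>n j. n > p \<Longrightarrow> random_L2 M \<mu> (\<lambda>\<omega>. \<psi>' n \<omega> j)"
    and "\<And>n j \<omega>. n > p \<Longrightarrow> \<omega> \<in> space M \<Longrightarrow> L2_inner \<mu> (\<psi> j) (\<psi>' n \<omega> j) \<ge> 0"
    and a1: "converges_in_prob M (average_measure \<xi>) (baricenter M (\<xi> 0))"
    and a2: "O_prob M (\<lambda>n \<omega>. L2_norm \<mu> (\<lambda>x. (\<Sum>t=1..n. Fcdf \<xi> t \<omega> x) / real n - EFcdf M \<xi> x))
               (\<lambda>n. real n powr (- 1 / 2))"
    and b: "psi_mixing M (Fcdf_hat X q \<tau>)" "psi_summable M (Fcdf_hat X q \<tau>)"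
    and c: "inj_on \<theta> {j. \<theta> j \<noteq> 0}"
  shows "\<forall>t\<ge>1. \<forall>j.
    (\<theta> j \<noteq> 0 \<longrightarrow>
       O_prob M (\<lambda>n \<omega>. real_cond_exp M (sigma_xi M \<xi>) (Wscore_hat X q \<tau> \<mu> \<psi>' n t j) \<omega> - Wscore M \<xi> \<mu> \<psi> t j \<omega>)
         (\<lambda>n. real n powr (- 1 / 2))) \<and>
    (\<exists>Z. O_prob M Z (\<lambda>n. real n powr (- 1 / 2)) \<and>
       (\<forall>n > p. n \<ge> t \<longrightarrow> (\<forall>\<omega>\<in>space M.
          \<bar>Wscore_hat X q \<tau> \<mu> \<psi>' n t j \<omega> - Wscore M \<xi> \<mu> \<psi> t j \<omega>\<bar>
            \<le> L2_norm \<mu> (\<lambda>x. Fcdf_hat X q \<tau> t \<omega> x - Fcdf \<xi> t \<omega> x) + Z n \<omega>)))"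
proof -
  have fin: "finite_measure \<mu>" and sets: "sets \<mu> = sets borel"
    using \<open>diffraction M \<xi> \<mu>\<close> unfolding diffraction_def by auto
  have L2: "L2_space \<mu>"
    by (rule L2_space.intro[OF fin]) (unfold_locales, rule sets)
  interpret score_estimation M \<mu> \<xi> X q \<tau> p \<theta> \<psi> \<theta>' \<psi>'
    using assms by (intro score_estimation.intro conjugate_sample.intro conjugate_sample_axioms.intro
        score_estimation_axioms.intro L2) auto
  have Wh: "Wscore_hat X q \<tau> \<mu> \<psi>' n t j = Wh n t j" for n t j
    by (intro ext) (simp add: Wscore_hat_def)
  have W: "Wscore M \<xi> \<mu> \<psi> t j = W t j" for t j
    by (intro ext) (simp add: Wscore_def)
  show ?thesis
    unfolding Wh W using conditional_score_rate score_rate by blast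
qed

end
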